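(* Let $N\ge 1$, $p\in[0,1)$, $q=1-p\neq 0$, $\tau=p/q$, and consider the $N$-particle ASEP on $\mathbb{Z}$ started from $Y=\{y_1<\cdots<y_N\}$, with particle positions $x_1(t)<\cdots<x_N(t)$ at time $t\ge0$. Let $1\le m\le N$ and let $x_1<\cdots<x_m$ be integers. Then for all sufficiently large $R>0$, \[ \mathbb{P}_Y\big(x_i(t)=x_i,\ i=1,\dots,m\big)=\sum_{\Lambda,\,S}(-1)^{\sigma(S,\Lambda)-(m-1)k}\,\mathrm{sgn}\,\Lambda\ \tau^{\sum_{i<m}(\ell_i-i)+\sigma(S)-mk}\,q^{k(k-1)/2} \int_{\mathcal{C}_R}\!\!\cdots\!\int_{\mathcal{C}_R} \frac{\prod_{i\in\Lambda,\,j\in S}f(\xi_i,\xi_j)\ \prod_{1\le i<j\le m-1}f(\xi_{\ell_i},\xi_{\ell_j})}{\prod_{i<j,\ i,j\in S\cup\Lambda}f(\xi_i,\xi_j)} \] \[ \times\Big(1-\prod_{j\in S}\xi_j\Big)\frac{\prod_{i<j,\ i,j\in S}(\xi_j-\xi_i)}{\prod_{j\in S}(1-\xi_j)}\ \prod_{i<m}\xi_{\ell_i}^{x_i}\ \prod_{j\in S}\xi_j^{x_m}\prod_{i\in S\cup\Lambda}\xi_i^{-y_i-1}\,e^{\sum_{i\in S\cup\Lambda}\varepsilon(\xi_i)t}\prod_{i\in S\cup\Lambda}d\xi_i , \] where the sum runs over all subsets $S\subset\{1,\dots,N\}$ and all ordered $(m-1)$-tuples $\Lambda=(\ell_1,\dots,\ell_{m-1})$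 of distinct elements of $\{1,\dots,N\}$ disjoint from $S$, $k=|S|$, and each variable is integrated over the circle $\mathcal{C}_R$ centered at $0$ of radius $R$.
   Context: ASEP: each particle independently waits an exponential time (rate 1); then with probability $p$ it attempts to jump one step right and with probability $q=1-p$ one step left, the jump being executed only if the target site is unoccupied. $\mathbb{P}_Y$ denotes probability for the process started from $Y$. Notation: $f(\xi,\xi')=p+q\xi\xi'-\xi$, $\varepsilon(\xi)=p\xi^{-1}+q\xi-1$. Every contour integral carries a factor $1/(2\pi i)$. $\Lambda$ is also regarded as the set $\{\ell_1,\dots,\ell_{m-1}\}$ where appropriate. $\mathrm{sgn}\,\Lambda=(-1)^{\#\{(i,j):\,i<j,\ \ell_i>\ell_j\}}$. For sets $U,V$ of indices, $\sigma(U,V)=\#\{(i,j): i\in U,\ j\in V,\ i\ge j\}$, and $\sigma(U)=\sigma(U,\{1,\dots,N\})$. When $p=0$, $\tau^0$ is interpreted as $1$. In a product $\prod$ the product symbol applies only to the factor immediately following it. *)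

theory Defs
  imports "HOL-Complex_Analysis.Complex_Analysis"
begin

text \<open>A configuration of N particles is a strictly increasing list of integers
  (entry k-1 is the position of particle k).  Particle i (0-based list index)
  attempts a right / left jump; it is executed only if the target is empty.\<close>

definition asep_right :: "int list \<Rightarrow> nat \<Rightarrow> int list" where
  "asep_right X i = (if X ! i + 1 \<notin> set X then X[i := X ! i + 1] else X)"

definition asep_left :: "int list \<Rightarrow> nat \<Rightarrow> int list" where
  "asep_left X i = (if X ! i - 1 \<notin> set X then X[i := X ! i - 1] else X)"

text \<open>Uniformised (jump) chain: at each event, a uniformly chosen particle
  attempts a jump right with probability p, left with probability 1-p.
  jump_prob p n Y E = probability that after n events the configuration satisfies E.\<close>

fun jump_prob :: "real \<Rightarrow> nat \<Rightarrow> int list \<Rightarrow> (int list \<Rightarrow> bool) \<Rightarrow> real" where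
  "jump_prob p 0 Y E = (if E Y then 1 else 0)"
| "jump_prob p (Suc n) Y E =
     (\<Sum>i<length Y. p * jump_prob p n (asep_right Y i) E
                    + (1 - p) * jump_prob p n (asep_left Y i) E) / real (length Y)"

text \<open>Continuous-time ASEP: every particle has an independent rate-1 clock, so
  the total event rate is exactly N = length Y; the law at time t is the
  Poisson(N t) mixture of the jump chain (uniformisation).  asep_prob p t Y E is
  P_Y(configuration at time t satisfies E).\<close>

definition asep_prob :: "real \<Rightarrow> real \<Rightarrow> int list \<Rightarrow> (int list \<Rightarrow> bool) \<Rightarrow> real" where
  "asep_prob p t Y E =
     (\<Sum>n. exp (- real (length Y) * t) * (real (length Y) * t) ^ n / fact n * jump_prob p n Y E)"

definition fA :: "real \<Rightarrow> complex \<Rightarrow> complex \<Rightarrow> complex" where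
  "fA p a b = complex_of_real p + complex_of_real (1 - p) * a * b - a"

definition epsA :: "real \<Rightarrow> complex \<Rightarrow> complex" where
  "epsA p z = complex_of_real p / z + complex_of_real (1 - p) * z - 1"

definition sigma_pairs :: "nat set \<Rightarrow> nat set \<Rightarrow> nat" where
  "sigma_pairs U V = card {(i, j). i \<in> U \<and> j \<in> V \<and> j \<le> i}"

definition sgn_list :: "nat list \<Rightarrow> real" where
  "sgn_list L = (-1) ^ card {(a, b). a < b \<and> b < length L \<and> L ! a > L ! b}"

text \<open>Iterated contour integral over the circle of radius R (each variable
  xi_i, i in the list, integrated over circlepath 0 R; without the 1/(2 pi i) factors).\<close>
fun iter_cint :: "real \<Rightarrow> nat list \<Rightarrow> ((nat \<Rightarrow> complex) \<Rightarrow> complex) \<Rightarrow> complex" where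
  "iter_cint R [] F = F (\<lambda>_. 0)"
| "iter_cint R (i # is) F =
     contour_integral (circlepath 0 R) (\<lambda>z. iter_cint R is (\<lambda>\<xi>. F (\<xi>(i := z))))"

text \<open>The integrand, for particle labels 1..N, S a set of labels, L the tuple
  Lambda as a list (L!(a) = l_{a+1}), xs = [x_1,...,x_m], Y = [y_1,...,y_N].\<close>
definition asep_integrand ::
  "real \<Rightarrow> real \<Rightarrow> nat \<Rightarrow> int list \<Rightarrow> int list \<Rightarrow> nat set \<Rightarrow> nat list \<Rightarrow> (nat \<Rightarrow> complex) \<Rightarrow> complex" where
  "asep_integrand p t m xs Y S L \<xi> =
     (let V = S \<union> set L in
      (\<Prod>i\<in>set L. \<Prod>j\<in>S. fA p (\<xi> i) (\<xi> j))
      * (\<Prod>a<m-1. \<Prod>b\<in>{a<..<m-1}. fA p (\<xi> (L ! a)) (\<xi> (L ! b)))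
      / (\<Prod>(i, j)\<in>{(i, j). i \<in> V \<and> j \<in> V \<and> i < j}. fA p (\<xi> i) (\<xi> j))
      * (1 - (\<Prod>j\<in>S. \<xi> j))
      * (\<Prod>(i, j)\<in>{(i, j). i \<in> S \<and> j \<in> S \<and> i < j}. \<xi> j - \<xi> i)
      / (\<Prod>j\<in>S. 1 - \<xi> j)
      * (\<Prod>a<m-1. \<xi> (L ! a) powi (xs ! a))
      * (\<Prod>j\<in>S. \<xi> j powi (xs ! (m - 1)))
      * (\<Prod>i\<in>V. \<xi> i powi (- (Y ! (i - 1)) - 1))
      * exp (\<Sum>i\<in>V. epsA p (\<xi> i) * complex_of_real t))"

definition asep_coeff :: "real \<Rightarrow> nat \<Rightarrow> nat \<Rightarrow> nat set \<Rightarrow> nat list \<Rightarrow> real" where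
  "asep_coeff p N m S L =
     (let k = card S; \<tau> = p / (1 - p) in
      (-1) powi (int (sigma_pairs S (set L)) - int (m - 1) * int k) * sgn_list L
      * \<tau> powi ((\<Sum>a<m-1. int (L ! a) - int (a + 1)) + int (sigma_pairs S {1..N}) - int m * int k)
      * (1 - p) ^ (k * (k - 1) div 2))"

end

theory Submission
  imports Defs "HOL-Combinatorics.Multiset_Permutations"
begin

text \<open>
  The probability is a function of the initial configuration \<open>Y\<close>, and it is computed from the
  backward equation of the uniformised chain. The right-hand side is a mean over a torus of one
  function of the variables \<open>\<xi>\<^sub>1, \<dots>, \<xi>\<^sub>N\<close> in which \<open>Y\<close> enters only through \<open>\<xi>\<^sub>i\<close> to the
  power \<open>- y\<^sub>i\<close>. Grouping the terms by \<open>V = S \<union> \<Lambda>\<close>, the numerator is an antisymmetrisation over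
  \<open>V\<close>. Exchanging \<open>\<xi>\<^sub>i\<close> and \<open>\<xi>\<^sub>i\<^sub>+\<^sub>1\<close> therefore shows that the right-hand side satisfies the
  exclusion boundary condition, so that one step of the chain multiplies the integrand by
  \<open>1 + (1/N) \<Sum> \<epsilon>(\<xi>\<^sub>i)\<close>.

  It remains to check the case \<open>t = 0\<close>, by induction on \<open>m\<close>, looking at the first particle.
  If \<open>y\<^sub>1 > x\<^sub>1\<close>, some variable can be moved to infinity. If \<open>y\<^sub>1 = x\<^sub>1\<close>, only \<open>\<ell>\<^sub>1 = 1\<close> survives and
  its factors cancel, which leaves the problem for \<open>m - 1\<close>. If \<open>y\<^sub>1 < x\<^sub>1\<close>, the variable \<open>\<xi>\<^sub>1\<close> is
  integrated by residues: the pole at \<open>1\<close> cancels the sets \<open>V\<close> against the sets \<open>V - {1}\<close>, and the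
  residue at \<open>p / (1 - q \<xi>\<^sub>n)\<close> is, by antisymmetry, holomorphic in \<open>\<xi>\<^sub>n\<close> outside the circle and
  vanishes at infinity. The poles must be simple and distinct for this, so it is done for \<open>p > 0\<close> and
  pairwise distinct radii, and the general case follows by continuity.
\<close>


section \<open>Means over the torus\<close>

text \<open>Uniformisation replaces the Kolmogorov equations, and a uniqueness argument for them, by
  an induction on the number of events; the Poisson sum then rebuilds exp(\<epsilon> t) as a power
  series. The powers of \<tau> make the sets V fit together. Replacing the label i by i + 1
  multiplies the weight by \<tau> = p / q, the ratio that the exclusion condition requires when only
  one of the two variables is present. Adding the smallest label changes the weight so that it
  absorbs, up to sign, the coefficient of the residue at 1. The delicate estimate concerns the
  residue at p / (1 - q \<xi>_n): as \<xi>_n grows, \<xi>_v shrinks like 1 / \<xi>_n. Arrangements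
  with v in \<Lambda> and n after it contain the factor f(\<xi>_v, \<xi>_n) = 0. If n in \<Lambda>
  comes before v, the inequality x_1 < x_2 < ... makes the decay of \<xi>_v outweigh the power of
  \<xi>_n. If both are in S, their powers cancel. All circles are rescaled to the unit circle, so
  that every V lives on one torus and the radii become parameters. As d\<xi> / (2 pi i) is \<xi>
  times the normalised mean, the exponent - y - 1 becomes - y.\<close>

definition torus :: "(nat \<Rightarrow> complex) set" where
  "torus = {\<xi>. \<forall>i. norm (\<xi> i) = 1}"

definition av :: "nat \<Rightarrow> ((nat \<Rightarrow> complex) \<Rightarrow> complex) \<Rightarrow> (nat \<Rightarrow> complex) \<Rightarrow> complex" where
  "av i F \<xi> = integral {0..1} (\<lambda>t. F (\<xi>(i := cis (2 * pi * t))))"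

text \<open>The base point matters only for coordinates outside \<open>ls\<close>, which keep the
  value 1.\<close>

definition torus_mean :: "nat list \<Rightarrow> ((nat \<Rightarrow> complex) \<Rightarrow> complex) \<Rightarrow> complex" where
  "torus_mean ls F = foldr av ls F (\<lambda>_. 1)"

lemma torus_update [simp]: "\<xi> \<in> torus \<Longrightarrow> norm z = 1 \<Longrightarrow> \<xi>(i := z) \<in> torus"
  by (auto simp: torus_def)

lemma one_in_torus [simp]: "(\<lambda>_. 1) \<in> torus"
  by (simp add: torus_def)

lemma continuous_on_coordinate:
  fixes f :: "'a::topological_space \<Rightarrow> 'b \<Rightarrow> complex"
  assumes "continuous_on S f"
  shows "continuous_on S (\<lambda>x. f x i)"
  using assms by (rule continuous_on_product_then_coordinatewise)

lemma continuous_on_fun_upd: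
  fixes f :: "'a::topological_space \<Rightarrow> nat \<Rightarrow> complex"
  assumes "continuous_on S f" "continuous_on S g"
  shows "continuous_on S (\<lambda>x. (f x)(i := g x))"
proof (rule continuous_on_coordinatewise_then_product)
  fix j
  show "continuous_on S (\<lambda>x. ((f x)(i := g x)) j)"
    using assms(2) continuous_on_coordinate[OF assms(1), of j] by (cases "j = i") auto
qed

lemma continuous_on_av_param:
  fixes F :: "'a::topological_space \<Rightarrow> (nat \<Rightarrow> complex) \<Rightarrow> complex"
  assumes "continuous_on (A \<times> torus) (\<lambda>(s, \<xi>). F s \<xi>)"
  shows "continuous_on (A \<times> torus) (\<lambda>(s, \<xi>). av i (F s) \<xi>)"
proof -
  have "continuous_on ((A \<times> torus) \<times> cbox (0::real) 1)
     ((\<lambda>(s, \<xi>). F s \<xi>) \<circ> (\<lambda>x. (fst (fst x), (snd (fst x))(i := cis (2 * pi * snd x)))))"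
    by (intro continuous_on_compose continuous_intros continuous_on_fun_upd
        continuous_on_subset[OF assms])
       (auto simp: split_def)
  then have "continuous_on ((A \<times> torus) \<times> cbox (0::real) 1)
     (\<lambda>(x, t). F (fst x) ((snd x)(i := cis (2 * pi * t))))"
    by (simp add: comp_def split_def)
  from integral_continuous_on_param[OF this] show ?thesis
    by (simp add: av_def split_def)
qed

lemma continuous_on_av:
  assumes "continuous_on torus F"
  shows "continuous_on torus (av i F)"
proof -
  have "continuous_on ({0::real} \<times> torus) (\<lambda>(s, \<xi>). F \<xi>)"
    using continuous_on_compose2[OF assms continuous_on_snd[OF continuous_on_id],
        of "{0::real} \<times> torus"]
    by (auto simp: split_def)
  from continuous_on_av_param[OF this, of i]
  have *: "continuous_on ({0::real} \<times> torus) (\<lambda>(s, \<xi>). av i F \<xi>)" by simp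
  have "continuous_on torus ((\<lambda>(s, \<xi>). av i F \<xi>) \<circ> (\<lambda>\<xi>. (0::real, \<xi>)))"
    by (intro continuous_on_compose continuous_intros continuous_on_subset[OF *]) auto
  then show ?thesis by (simp add: comp_def)
qed

lemma continuous_on_foldr_av_param:
  fixes F :: "'a::topological_space \<Rightarrow> (nat \<Rightarrow> complex) \<Rightarrow> complex"
  assumes "continuous_on (A \<times> torus) (\<lambda>(s, \<xi>). F s \<xi>)"
  shows "continuous_on (A \<times> torus) (\<lambda>(s, \<xi>). foldr av ls (F s) \<xi>)"
proof (induction ls)
  case (Cons i ls)
  then show ?case using continuous_on_av_param[of A "\<lambda>s. foldr av ls (F s)" i] by simp
qed (use assms in simp)

lemma continuous_on_foldr_av:
  assumes "continuous_on torus F"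
  shows "continuous_on torus (foldr av ls F)"
  by (induction ls) (auto simp: assms continuous_on_av)

text \<open>The parameter serves the final limit, in which \<open>p\<close> and the radii move
  together.\<close>

lemma continuous_on_torus_mean:
  fixes F :: "'a::topological_space \<Rightarrow> (nat \<Rightarrow> complex) \<Rightarrow> complex"
  assumes "continuous_on (A \<times> torus) (\<lambda>(s, \<xi>). F s \<xi>)"
  shows "continuous_on A (\<lambda>s. torus_mean ls (F s))"
proof -
  have "continuous_on A ((\<lambda>(s, \<xi>). foldr av ls (F s) \<xi>) \<circ> (\<lambda>s. (s, \<lambda>_. 1)))"
    by (intro continuous_on_compose continuous_intros
        continuous_on_subset[OF continuous_on_foldr_av_param[OF assms]]) auto
  then show ?thesis by (simp add: comp_def torus_mean_def)
qed

lemma continuous_on_torus_circle: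
  assumes "continuous_on torus F" "\<xi> \<in> torus"
  shows "continuous_on S (\<lambda>t::real. F (\<xi>(i := cis (2 * pi * t))))"
proof -
  have "continuous_on S (F \<circ> (\<lambda>t. \<xi>(i := cis (2 * pi * t))))"
    using assms(2) by (intro continuous_on_compose continuous_intros continuous_on_fun_upd
        continuous_on_subset[OF assms(1)]) auto
  then show ?thesis by (simp add: comp_def)
qed

lemma av_integrable:
  fixes F :: "(nat \<Rightarrow> complex) \<Rightarrow> complex"
  assumes "continuous_on torus F" "\<xi> \<in> torus"
  shows "(\<lambda>t. F (\<xi>(i := cis (2 * pi * t)))) integrable_on {0..1}"
  using continuous_on_torus_circle[OF assms, of "{0..1}" i] by (rule integrable_continuous_interval)

lemma av_cong:
  assumes "\<And>\<xi>. \<xi> \<in> torus \<Longrightarrow> F \<xi> = G \<xi>" "\<xi> \<in> torus"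
  shows "av i F \<xi> = av i G \<xi>"
  unfolding av_def using assms by (intro integral_cong) auto

lemma foldr_av_cong:
  assumes "\<And>\<xi>. \<xi> \<in> torus \<Longrightarrow> F \<xi> = G \<xi>" "\<xi> \<in> torus"
  shows "foldr av ls F \<xi> = foldr av ls G \<xi>"
  using assms(2) by (induction ls arbitrary: \<xi>) (auto simp: assms(1) intro: av_cong)

lemma torus_mean_cong:
  assumes "\<And>\<xi>. \<xi> \<in> torus \<Longrightarrow> F \<xi> = G \<xi>"
  shows "torus_mean ls F = torus_mean ls G"
  unfolding torus_mean_def by (rule foldr_av_cong) (auto simp: assms)

lemma av_add:
  assumes "continuous_on torus F" "continuous_on torus G" "\<xi> \<in> torus"
  shows "av i (\<lambda>\<xi>. F \<xi> + G \<xi>) \<xi> = av i F \<xi> + av i G \<xi>"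
  unfolding av_def using assms by (intro integral_add av_integrable) auto

lemma av_cmult: "av i (\<lambda>\<xi>. c * F \<xi>) \<xi> = c * av i F \<xi>"
  unfolding av_def by simp

lemma av_indep:
  assumes "\<And>z. norm z = 1 \<Longrightarrow> F (\<xi>(i := z)) = c"
  shows "av i F \<xi> = c"
proof -
  have "av i F \<xi> = integral {0..1::real} (\<lambda>_. c)"
    unfolding av_def by (intro integral_cong) (auto simp: assms)
  then show ?thesis by simp
qed

lemma foldr_av_add:
  assumes "continuous_on torus F" "continuous_on torus G" "\<xi> \<in> torus"
  shows "foldr av ls (\<lambda>\<xi>. F \<xi> + G \<xi>) \<xi> = foldr av ls F \<xi> + foldr av ls G \<xi>"
  using assms(3)
proof (induction ls arbitrary: \<xi>)
  case (Cons i ls)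
  have "foldr av (i # ls) (\<lambda>\<xi>. F \<xi> + G \<xi>) \<xi>
      = av i (\<lambda>\<xi>. foldr av ls F \<xi> + foldr av ls G \<xi>) \<xi>"
    using Cons by (auto intro!: av_cong)
  also have "\<dots> = foldr av (i # ls) F \<xi> + foldr av (i # ls) G \<xi>"
    using assms Cons.prems by (subst av_add) (auto intro: continuous_on_foldr_av)
  finally show ?case .
qed simp

lemma torus_mean_add:
  assumes "continuous_on torus F" "continuous_on torus G"
  shows "torus_mean ls (\<lambda>\<xi>. F \<xi> + G \<xi>) = torus_mean ls F + torus_mean ls G"
  using assms unfolding torus_mean_def by (simp add: foldr_av_add)

lemma foldr_av_cmult: "foldr av ls (\<lambda>\<xi>. c * F \<xi>) = (\<lambda>\<xi>. c * foldr av ls F \<xi>)"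
proof (induction ls)
  case (Cons i ls)
  show ?case unfolding foldr_Cons comp_apply Cons by (rule ext) (rule av_cmult)
qed simp

lemma torus_mean_cmult: "torus_mean ls (\<lambda>\<xi>. c * F \<xi>) = c * torus_mean ls F"
  by (simp add: torus_mean_def foldr_av_cmult)

lemma torus_mean_const [simp]: "torus_mean ls (\<lambda>\<xi>. c) = c"
proof -
  have "foldr av ls (\<lambda>\<xi>. c) \<xi> = c" for \<xi>
    by (induction ls arbitrary: \<xi>) (auto intro: av_indep)
  then show ?thesis by (simp add: torus_mean_def)
qed

lemma torus_mean_sum:
  assumes "\<And>x. x \<in> A \<Longrightarrow> continuous_on torus (F x)"
  shows "torus_mean ls (\<lambda>\<xi>. \<Sum>x\<in>A. F x \<xi>) = (\<Sum>x\<in>A. torus_mean ls (F x))"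
  using assms
proof (induction A rule: infinite_finite_induct)
  case (insert x A)
  then show ?case by (simp add: torus_mean_add continuous_on_sum)
qed auto

lemma torus_mean_uminus: "torus_mean ls (\<lambda>\<xi>. - F \<xi>) = - torus_mean ls F"
  using torus_mean_cmult[of ls "-1" F] by simp

lemma torus_mean_diff:
  assumes "continuous_on torus F" "continuous_on torus G"
  shows "torus_mean ls (\<lambda>\<xi>. F \<xi> - G \<xi>) = torus_mean ls F - torus_mean ls G"
  using torus_mean_add[OF assms(1) continuous_on_minus[OF assms(2)], of ls]
  by (simp add: torus_mean_uminus)

lemma norm_av_le:
  assumes "continuous_on torus F" "\<And>\<xi>. \<xi> \<in> torus \<Longrightarrow> norm (F \<xi>) \<le> B" "\<xi> \<in> torus"
  shows "norm (av i F \<xi>) \<le> B"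
  using integral_bound[OF _ continuous_on_torus_circle[OF assms(1,3), of "{0..1}" i], of B] assms
  by (auto simp: av_def)

lemma norm_torus_mean_le:
  assumes "continuous_on torus F" "\<And>\<xi>. \<xi> \<in> torus \<Longrightarrow> norm (F \<xi>) \<le> B"
  shows "norm (torus_mean ls F) \<le> B"
proof -
  have "norm (foldr av ls F \<xi>) \<le> B" if "\<xi> \<in> torus" for \<xi>
    using that
    by (induction ls arbitrary: \<xi>)
       (auto simp: assms intro!: norm_av_le continuous_on_foldr_av)
  then show ?thesis by (simp add: torus_mean_def)
qed

text \<open>Uniform convergence suffices because the mean does not increase the supremum
  norm.\<close>

lemma tendsto_torus_mean:
  assumes "\<And>n. continuous_on torus (F n)" "continuous_on torus G"
    and "uniform_limit torus F G sequentially"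
  shows "(\<lambda>n. torus_mean ls (F n)) \<longlonglongrightarrow> torus_mean ls G"
proof (rule tendstoI)
  fix e :: real assume "e > 0"
  then have "\<forall>\<^sub>F n in sequentially. \<forall>\<xi>\<in>torus. dist (F n \<xi>) (G \<xi>) < e / 2"
    using assms(3) by (auto dest: uniform_limitD[of _ _ _ _ "e / 2"])
  then show "\<forall>\<^sub>F n in sequentially. dist (torus_mean ls (F n)) (torus_mean ls G) < e"
  proof eventually_elim
    case (elim n)
    have "norm (torus_mean ls (\<lambda>\<xi>. F n \<xi> - G \<xi>)) \<le> e / 2"
      using elim by (intro norm_torus_mean_le continuous_intros assms)
        (auto simp: dist_norm less_imp_le)
    then show ?case
      using \<open>e > 0\<close> by (simp add: torus_mean_diff assms dist_norm)
  qed
qed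

text \<open>Fubini for a continuous function on the unit square.\<close>

lemma av_commute:
  assumes F: "continuous_on torus F" and \<xi>: "\<xi> \<in> torus"
  shows "av i (av j F) \<xi> = av j (av i F) \<xi>"
proof (cases "i = j")
  case False
  have "continuous_on (cbox (0, 0) (1, 1))
     (F \<circ> (\<lambda>x. (\<xi>(i := cis (2 * pi * fst x)))(j := cis (2 * pi * snd x))))"
    using \<xi> by (intro continuous_on_compose continuous_intros continuous_on_fun_upd
        continuous_on_subset[OF F]) auto
  then have "continuous_on (cbox (0, 0) (1, 1))
     (\<lambda>(x, y). F (\<xi>(i := cis (2 * pi * x), j := cis (2 * pi * y))))"
    by (simp add: comp_def split_def)
  from integral_swap_continuous[OF this] show ?thesis
    using False by (simp add: av_def fun_upd_twist)
qed simp

lemma foldr_av_swap_adjacent: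
  assumes "continuous_on torus F" "\<xi> \<in> torus"
  shows "foldr av (xs @ i # j # ys) F \<xi> = foldr av (xs @ j # i # ys) F \<xi>"
proof -
  have "foldr av xs (foldr av (i # j # ys) F) \<xi> = foldr av xs (foldr av (j # i # ys) F) \<xi>"
    using assms by (intro foldr_av_cong) (auto intro: av_commute continuous_on_foldr_av)
  then show ?thesis by simp
qed

lemma foldr_av_move_front:
  assumes "continuous_on torus F" "\<xi> \<in> torus"
  shows "foldr av (xs @ i # ys) F \<xi> = foldr av (i # xs @ ys) F \<xi>"
  using assms(2)
proof (induction xs arbitrary: \<xi>)
  case (Cons x xs)
  have "foldr av ((x # xs) @ i # ys) F \<xi> = av x (foldr av (i # xs @ ys) F) \<xi>"
    using Cons by (auto intro: av_cong)
  also have "\<dots> = foldr av (i # (x # xs) @ ys) F \<xi>"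
    using foldr_av_swap_adjacent[OF assms(1) Cons.prems, of "[]" x i "xs @ ys"] by simp
  finally show ?case .
qed simp

lemma foldr_av_mset:
  assumes "continuous_on torus F" "\<xi> \<in> torus" "mset xs = mset ys"
  shows "foldr av xs F \<xi> = foldr av ys F \<xi>"
  using assms(2,3)
proof (induction xs arbitrary: ys \<xi>)
  case (Cons x xs)
  then have "x \<in> set ys" by (metis list.set_intros(1) set_mset_mset)
  then obtain as bs where ys: "ys = as @ x # bs" by (auto simp: in_set_conv_decomp)
  have "mset xs = mset (as @ bs)" using Cons.prems ys by simp
  then have "foldr av xs F \<xi> = foldr av (as @ bs) F \<xi>" if "\<xi> \<in> torus" for \<xi>
    using Cons.IH that by blast
  then have "foldr av (x # xs) F \<xi> = av x (foldr av (as @ bs) F) \<xi>"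
    unfolding foldr_Cons comp_apply by (rule av_cong[OF _ Cons.prems(1)])
  also have "\<dots> = foldr av ys F \<xi>"
    using foldr_av_move_front[OF assms(1) Cons.prems(1)] ys by simp
  finally show ?case .
qed simp

lemma torus_mean_mset:
  assumes "continuous_on torus F" "mset xs = mset ys"
  shows "torus_mean xs F = torus_mean ys F"
  unfolding torus_mean_def by (rule foldr_av_mset) (use assms in auto)

text \<open>Averaging a coordinate twice is averaging it once. Hence any single variable may be
  integrated first, and a contour argument in that variable applies with the others frozen.\<close>

lemma torus_mean_av:
  assumes "continuous_on torus F" "i \<in> set ls"
  shows "torus_mean ls (av i F) = torus_mean ls F"
proof -
  obtain as bs where ls: "ls = as @ i # bs" using assms(2) by (auto simp: in_set_conv_decomp)
  have m: "mset ls = mset ((as @ bs) @ [i])" using ls by simp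
  have "torus_mean ls (av i F) = torus_mean (as @ bs) (av i (av i F))"
    using torus_mean_mset[OF continuous_on_av[OF assms(1)] m] by (simp add: torus_mean_def)
  also have "av i (av i F) = av i F"
    by (rule ext, rule av_indep) (simp add: av_def)
  also have "torus_mean (as @ bs) (av i F) = torus_mean ls F"
    using torus_mean_mset[OF assms(1) m] by (simp add: torus_mean_def)
  finally show ?thesis .
qed

lemma fun_upd_comp_transpose:
  "(\<xi>(k := z)) \<circ> Transposition.transpose i j
     = (\<xi> \<circ> Transposition.transpose i j)(Transposition.transpose i j k := z)"
proof
  fix l
  have "Transposition.transpose i j l = k \<longleftrightarrow> l = Transposition.transpose i j k"
    by (metis transpose_involutory)
  then show "((\<xi>(k := z)) \<circ> Transposition.transpose i j) l
     = ((\<xi> \<circ> Transposition.transpose i j)(Transposition.transpose i j k := z)) l"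
    by simp
qed

lemma foldr_av_transpose:
  "foldr av ls (\<lambda>\<xi>. F (\<xi> \<circ> Transposition.transpose i j)) \<xi>
     = foldr av (map (Transposition.transpose i j) ls) F (\<xi> \<circ> Transposition.transpose i j)"
proof (induction ls arbitrary: \<xi>)
  case (Cons k ls)
  let ?G = "foldr av (map (Transposition.transpose i j) ls) F"
  have "foldr av (k # ls) (\<lambda>\<xi>. F (\<xi> \<circ> Transposition.transpose i j)) \<xi>
     = integral {0..1} (\<lambda>t. ?G ((\<xi>(k := cis (2 * pi * t))) \<circ> Transposition.transpose i j))"
    unfolding foldr_Cons comp_apply[of "av k"] av_def[of k] by (subst Cons) (rule refl)
  also have "\<dots> = av (Transposition.transpose i j k) ?G (\<xi> \<circ> Transposition.transpose i j)"
    unfolding av_def fun_upd_comp_transpose by (rule refl)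
  also have "\<dots> = foldr av (map (Transposition.transpose i j) (k # ls)) F
      (\<xi> \<circ> Transposition.transpose i j)"
    by (simp only: list.map foldr_Cons comp_apply)
  finally show ?case .
qed simp

text \<open>All coordinates range over the same circle, so the exchange merely renames integration
  variables; the permuted list is then sorted back by \<open>torus_mean_mset\<close>.\<close>

lemma torus_mean_transpose:
  assumes "continuous_on torus F" "distinct ls" "i \<in> set ls" "j \<in> set ls"
  shows "torus_mean ls (\<lambda>\<xi>. F (\<xi> \<circ> Transposition.transpose i j)) = torus_mean ls F"
proof -
  have "Transposition.transpose i j ` set ls = set ls"
    using assms(3,4) by simp
  then have "mset (map (Transposition.transpose i j) ls) = mset ls"
    using assms(2) by (subst set_eq_iff_mset_eq_distinct[symmetric])
      (auto simp: distinct_map)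
  then have "torus_mean (map (Transposition.transpose i j) ls) F = torus_mean ls F"
    by (rule torus_mean_mset[OF assms(1)])
  moreover have "(\<lambda>_. 1) \<circ> Transposition.transpose i j = (\<lambda>_. 1 :: complex)"
    by (rule ext) simp
  ultimately show ?thesis
    using foldr_av_transpose[of ls F i j "\<lambda>_. 1"] unfolding torus_mean_def by simp
qed


section \<open>Means over circles\<close>

definition circ_mean :: "real \<Rightarrow> (complex \<Rightarrow> complex) \<Rightarrow> complex" where
  "circ_mean r h = integral {0..1} (\<lambda>t. h (of_real r * cis (2 * pi * t)))"

lemma circ_mean_cong:
  assumes "\<And>z. norm z = \<bar>r\<bar> \<Longrightarrow> f z = g z"
  shows "circ_mean r f = circ_mean r g"
  unfolding circ_mean_def by (intro integral_cong) (auto intro!: assms simp: norm_mult)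

lemma circ_mean_cmult: "circ_mean r (\<lambda>z. c * h z) = c * circ_mean r h"
  by (simp add: circ_mean_def)

text \<open>The extra \<open>z\<close> comes from dz = 2 pi i z dt.\<close>

lemma contour_integral_circlepath_mean:
  "contour_integral (circlepath 0 r) g = 2 * complex_of_real pi * \<i> * circ_mean r (\<lambda>z. g z * z)"
proof -
  have "circlepath 0 r x = of_real r * cis (2 * pi * x)" for x
    by (simp add: circlepath cis_conv_exp mult_ac)
  moreover have "vector_derivative (circlepath 0 r) (at x)
      = 2 * complex_of_real pi * \<i> * (of_real r * cis (2 * pi * x))" for x
    by (simp add: vector_derivative_circlepath cis_conv_exp mult_ac)
  ultimately have "contour_integral (circlepath 0 r) g = integral {0..1} (\<lambda>x.
      2 * complex_of_real pi * \<i> * (g (of_real r * cis (2 * pi * x)) * (of_real r * cis (2 * pi * x))))"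
    by (simp add: contour_integral_integral mult_ac)
  then show ?thesis by (simp only: circ_mean_def integral_mult_right)
qed

lemma circ_mean_eq_contour_integral:
  assumes "r > 0"
  shows "circ_mean r (\<lambda>z. z * g z) = contour_integral (circlepath 0 r) g / (2 * complex_of_real pi * \<i>)"
  by (simp add: contour_integral_circlepath_mean mult.commute[of _ "g _"])

text \<open>Cauchy's formula at the centre, applied to h(u) / u.\<close>

lemma circ_mean_holomorphic:
  assumes "h holomorphic_on ball 0 s" "0 < r" "r < s"
  shows "circ_mean r h = h 0"
proof -
  have "((\<lambda>u. h u / (u - 0)) has_contour_integral (2 * of_real pi * \<i> * h 0)) (circlepath 0 r)"
    using assms by (intro Cauchy_integral_circlepath)
      (auto intro!: holomorphic_on_imp_continuous_on holomorphic_on_subset[OF assms(1)])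
  then have "contour_integral (circlepath 0 r) (\<lambda>u. h u / u) = 2 * of_real pi * \<i> * h 0"
    by (simp add: contour_integral_unique)
  moreover have "circ_mean r h = circ_mean r (\<lambda>z. z * (h z / z))"
    using assms by (intro circ_mean_cong) auto
  ultimately show ?thesis
    using assms by (simp add: circ_mean_eq_contour_integral del: times_divide_eq_right)
qed

text \<open>The mean integrates against dz / z, so convergence of \<open>h\<close> to 0 is enough,
  without any rate: the inversion w = 1 / z leads to the mean value property at 0.\<close>

lemma circ_mean_at_infinity:
  assumes h: "h holomorphic_on {z. norm z > s}" and s: "0 < s" "s < r"
    and lim: "(h \<longlongrightarrow> 0) at_infinity"
  shows "circ_mean r h = 0"
proof -
  define k where "k = (\<lambda>w. if w = 0 then 0 else h (inverse w))"
  have "(\<lambda>w. h (inverse w)) holomorphic_on ball 0 (1 / s) - {0}"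
    using s by (intro holomorphic_on_compose_gen[OF _ h, unfolded comp_def] holomorphic_intros)
      (auto simp: norm_divide field_simps)
  moreover have "(\<lambda>w. h (inverse w)) \<midarrow>0\<rightarrow> 0"
    using lim by (subst (asm) lim_at_infinity_0) (simp add: comp_def)
  ultimately have k: "k holomorphic_on ball 0 (1 / s)"
    using removable_singularity[of "\<lambda>w. h (inverse w)" "ball 0 (1 / s)" 0 0]
    by (simp add: k_def)
  have "(cnj \<circ> k \<circ> cnj) holomorphic_on ball 0 (1 / s)"
  proof (rule holomorphic_on_compose_cnj_cnj)
    have "cnj ` ball 0 (1 / s) \<subseteq> ball 0 (1 / s)" by auto
    then show "k holomorphic_on cnj ` ball 0 (1 / s)"
      using k holomorphic_on_subset by blast
  qed auto
  then have "circ_mean (1 / r) (cnj \<circ> k \<circ> cnj) = (cnj \<circ> k \<circ> cnj) 0"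
    using s by (intro circ_mean_holomorphic) (auto simp: field_simps)
  also have "\<dots> = 0" by (simp add: k_def)
  also have "circ_mean (1 / r) (cnj \<circ> k \<circ> cnj) = cnj (circ_mean r h)"
    unfolding circ_mean_def integral_cnj
  proof (rule integral_cong)
    fix x :: real
    have "inverse (cnj (of_real (1 / r) * cis (2 * pi * x))) = of_real r * cis (2 * pi * x)"
      using s by (simp add: cis_cnj field_simps flip: cis_inverse)
    then show "(cnj \<circ> k \<circ> cnj) (complex_of_real (1 / r) * cis (2 * pi * x)) =
         cnj (h (complex_of_real r * cis (2 * pi * x)))"
      using s by (auto simp: k_def)
  qed
  finally show ?thesis by simp
qed

text \<open>One linear factor is divided out at a time. The difference quotient is holomorphic and
  keeps the zeros at the other points of \<open>A\<close>.\<close>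

lemma holomorphic_divide_zeros:
  assumes "finite A" "open U" "P holomorphic_on U" "A \<subseteq> U" "\<And>a. a \<in> A \<Longrightarrow> P a = 0"
  shows "\<exists>Q. Q holomorphic_on U \<and> (\<forall>z\<in>U. P z = Q z * (\<Prod>a\<in>A. z - a))"
  using assms
proof (induction A arbitrary: P)
  case empty
  then show ?case by auto
next
  case (insert a A)
  define P1 where "P1 = (\<lambda>z. if z = a then deriv P a else (P z - P a) / (z - a))"
  have "P1 holomorphic_on U"
    unfolding P1_def using insert.prems by (intro pole_lemma_open)
  moreover have "P1 b = 0" if "b \<in> A" for b
    using insert that by (auto simp: P1_def)
  ultimately obtain Q where Q: "Q holomorphic_on U" "\<forall>z\<in>U. P1 z = Q z * (\<Prod>a\<in>A. z - a)"
    using insert by blast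
  have "P z = P1 z * (z - a)" for z
    using insert.prems by (auto simp: P1_def)
  then show ?case
    using Q insert.hyps by (intro exI[of _ Q]) (auto simp: mult_ac)
qed

text \<open>The points of \<open>A\<close> are only apparent poles: away from them the quotient
  agrees with a holomorphic \<open>Q\<close>. On the contour itself division by zero would give 0
  instead of the value of \<open>Q\<close>, hence \<open>avoid\<close>.\<close>

lemma circ_mean_at_infinity_removable:
  assumes A: "finite A" and P: "P holomorphic_on {z. norm z > s}" and s: "0 < s" "s < r"
    and AU: "\<And>a. a \<in> A \<Longrightarrow> norm a > s" and zero: "\<And>a. a \<in> A \<Longrightarrow> P a = 0"
    and avoid: "\<And>a. a \<in> A \<Longrightarrow> norm a \<noteq> r"
    and lim: "((\<lambda>z. P z / (\<Prod>a\<in>A. z - a)) \<longlongrightarrow> 0) at_infinity"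
  shows "circ_mean r (\<lambda>z. P z / (\<Prod>a\<in>A. z - a)) = 0"
proof -
  have "open {z::complex. norm z > s}"
    by (intro open_Collect_less continuous_intros)
  then obtain Q where Q: "Q holomorphic_on {z. norm z > s}"
      "\<And>z. norm z > s \<Longrightarrow> P z = Q z * (\<Prod>a\<in>A. z - a)"
    using holomorphic_divide_zeros[OF A _ P] AU zero by (auto simp: subset_iff)
  have eq: "P z / (\<Prod>a\<in>A. z - a) = Q z" if "norm z > s" "z \<notin> A" for z
    using Q(2)[OF that(1)] that A by auto
  have "\<forall>\<^sub>F z in at_infinity. P z / (\<Prod>a\<in>A. z - a) = Q z"
  proof -
    obtain B where "\<And>a. a \<in> A \<Longrightarrow> norm a \<le> B"
      using finite_imp_bounded[OF A] by (auto simp: bounded_iff)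
    then have "P z / (\<Prod>a\<in>A. z - a) = Q z" if "max s B + 1 \<le> norm z" for z
      using that by (intro eq) fastforce+
    then show ?thesis
      unfolding eventually_at_infinity by blast
  qed
  then have "(Q \<longlongrightarrow> 0) at_infinity"
    using lim by (rule Lim_transform_eventually[rotated])
  then have "circ_mean r Q = 0"
    using Q s by (intro circ_mean_at_infinity[of _ s])
  moreover have "circ_mean r (\<lambda>z. P z / (\<Prod>a\<in>A. z - a)) = circ_mean r Q"
    using s avoid by (intro circ_mean_cong eq) auto
  ultimately show ?thesis by simp
qed

text \<open>The factor \<open>z\<close> cancels the dz / z of the mean, so that 0 does not become a
  pole.\<close>

lemma circ_mean_simple_poles:
  assumes A: "finite A" and K: "K holomorphic_on UNIV" and r: "\<And>a. a \<in> A \<Longrightarrow> norm a < r" "r > 0"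
  shows "circ_mean r (\<lambda>z. z * (K z / (\<Prod>a\<in>A. z - a))) = (\<Sum>a\<in>A. K a / (\<Prod>b\<in>A - {a}. a - b))"
proof -
  have res: "residue (\<lambda>z. K z / (\<Prod>a\<in>A. z - a)) a = K a / (\<Prod>b\<in>A - {a}. a - b)" if a: "a \<in> A" for a
  proof -
    have "(\<lambda>z. K z / (\<Prod>b\<in>A - {a}. z - b)) holomorphic_on - (A - {a})"
      using A by (intro holomorphic_intros holomorphic_on_subset[OF K]) auto
    then have "residue (\<lambda>w. (K w / (\<Prod>b\<in>A - {a}. w - b)) / (w - a)) a
        = K a / (\<Prod>b\<in>A - {a}. a - b)"
    proof (rule residue_simple[rotated 2])
      show "open (- (A - {a}))" using A by (intro open_Compl finite_imp_closed) auto
    qed (use a in auto)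
    moreover have "(\<lambda>w. (K w / (\<Prod>b\<in>A - {a}. w - b)) / (w - a)) = (\<lambda>w. K w / (\<Prod>a\<in>A. w - a))"
      using A a by (subst prod.remove[of A a]) auto
    ultimately show ?thesis by (simp only:)
  qed
  have "contour_integral (circlepath 0 r) (\<lambda>z. K z / (\<Prod>a\<in>A. z - a))
      = 2 * pi * \<i> * (\<Sum>a\<in>A. winding_number (circlepath 0 r) a * residue (\<lambda>z. K z / (\<Prod>a\<in>A. z - a)) a)"
  proof (rule Residue_theorem[of UNIV])
    show "(\<lambda>z. K z / (\<Prod>a\<in>A. z - a)) holomorphic_on UNIV - A"
      using A by (intro holomorphic_intros holomorphic_on_subset[OF K]) auto
    show "path_image (circlepath 0 r) \<subseteq> UNIV - A"
      using r(1) by fastforce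
  qed (use A in auto)
  also have "\<dots> = 2 * pi * \<i> * (\<Sum>a\<in>A. K a / (\<Prod>b\<in>A - {a}. a - b))"
    using r by (intro arg_cong[of _ _ "(*) _"] sum.cong refl)
      (simp add: res winding_number_circlepath)
  finally show ?thesis
    using r by (simp add: circ_mean_eq_contour_integral del: times_divide_eq_right)
qed


section \<open>Antisymmetrised Bethe products\<close>

fun pairprod :: "('a \<Rightarrow> 'a \<Rightarrow> complex) \<Rightarrow> 'a list \<Rightarrow> complex" where
  "pairprod s [] = 1"
| "pairprod s (x # xs) = prod_list (map (s x) xs) * pairprod s xs"

lemma prod_list_mult:
  "prod_list (map (\<lambda>x. f x * g x :: complex) xs) = prod_list (map f xs) * prod_list (map g xs)"
  by (induction xs) auto

lemma prod_list_minus: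
  "prod_list (map (\<lambda>x. - f x :: complex) xs) = (-1) ^ length xs * prod_list (map f xs)"
  by (induction xs) auto

lemma pairprod_append:
  "pairprod s (xs @ ys) = pairprod s xs * pairprod s ys * (\<Prod>x\<leftarrow>xs. \<Prod>y\<leftarrow>ys. s x y)"
  by (induction xs) (auto simp: algebra_simps)

lemma pairprod_map: "pairprod s (map f xs) = pairprod (\<lambda>a b. s (f a) (f b)) xs"
  by (induction xs) (auto simp: comp_def)

lemma pairprod_mult: "pairprod (\<lambda>a b. s a b * t a b) xs = pairprod s xs * pairprod t xs"
  by (induction xs) (auto simp: prod_list_mult)

text \<open>Every entry of \<open>bs\<close> causes two sign changes, one with \<open>x\<close> and
  one with \<open>y\<close>; the factor of \<open>x\<close> and \<open>y\<close> causes the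
  remaining one.\<close>

lemma pairprod_swap:
  assumes anti: "\<And>a b. s b a = - s a b"
  shows "pairprod s (as @ y # bs @ x # cs) = - pairprod s (as @ x # bs @ y # cs)"
proof -
  have m: "(\<Prod>b\<leftarrow>bs. s b y) = (-1) ^ length bs * (\<Prod>b\<leftarrow>bs. s y b)" for y
    by (subst anti) (simp add: prod_list_minus)
  have sq: "(-1::complex) ^ n * (-1) ^ n = 1" for n
    by (simp flip: power_add mult_2)
  have eq: "(\<Prod>b\<leftarrow>bs. s y b) * (s y x * (\<Prod>b\<leftarrow>bs. s b x))
      = - ((\<Prod>b\<leftarrow>bs. s x b) * (s x y * (\<Prod>b\<leftarrow>bs. s b y)))"
    unfolding m[of x] m[of y] anti[of y x] by (simp add: mult_ac)
  have "pairprod s (y # bs @ [x]) = - pairprod s (x # bs @ [y])"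
    using arg_cong[OF eq, of "\<lambda>z. z * pairprod s bs"]
    by (simp add: pairprod_append algebra_simps)
  moreover have "(\<Prod>a\<leftarrow>as. \<Prod>b\<leftarrow>y # bs @ [x]. s a b) = (\<Prod>a\<leftarrow>as. \<Prod>b\<leftarrow>x # bs @ [y]. s a b)" for as
    by (simp add: mult_ac)
  moreover have "(\<Prod>a\<leftarrow>y # bs @ [x]. \<Prod>c\<leftarrow>cs. s a c) = (\<Prod>a\<leftarrow>x # bs @ [y]. \<Prod>c\<leftarrow>cs. s a c)" for cs
    by (simp add: mult_ac)
  ultimately have "pairprod s (as @ (y # bs @ [x]) @ cs) = - pairprod s (as @ (x # bs @ [y]) @ cs)"
    by (simp only: pairprod_append[of s as] pairprod_append[of s "y # bs @ [x]"]
        pairprod_append[of s "x # bs @ [y]"]) (simp add: mult_ac)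
  then show ?thesis by simp
qed

text \<open>The names \<open>x\<close> and \<open>y\<close> hide which of \<open>i\<close> and
  \<open>j\<close> comes first, so that a single exchange lemma covers both orders.\<close>

lemma transpose_pair_split:
  assumes "distinct M" "i \<in> set M" "j \<in> set M" "i \<noteq> j"
  obtains as bs cs x y where "M = as @ x # bs @ y # cs"
    "map (Transposition.transpose i j) M = as @ y # bs @ x # cs"
proof -
  have "\<exists>as bs cs. M = as @ i # bs @ j # cs \<or> M = as @ j # bs @ i # cs"
  proof -
    obtain as ds where M: "M = as @ i # ds" using assms by (auto simp: in_set_conv_decomp)
    then have "j \<in> set as \<or> j \<in> set ds" using assms by auto
    then show ?thesis
    proof
      assume "j \<in> set as"
      then obtain as1 as2 where "as = as1 @ j # as2" by (auto simp: in_set_conv_decomp)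
      then show ?thesis using M by auto
    next
      assume "j \<in> set ds"
      then obtain as1 as2 where "ds = as1 @ j # as2" by (auto simp: in_set_conv_decomp)
      then show ?thesis using M by auto
    qed
  qed
  then obtain as bs cs where *: "M = as @ i # bs @ j # cs \<or> M = as @ j # bs @ i # cs" by blast
  have id: "map (Transposition.transpose i j) L = L" if "i \<notin> set L" "j \<notin> set L" for L
    using that by (intro map_idI) (metis transpose_apply_other)
  from * show ?thesis
  proof
    assume M: "M = as @ i # bs @ j # cs"
    show ?thesis
    proof (rule that[OF M])
      show "map (Transposition.transpose i j) M = as @ j # bs @ i # cs"
        using assms(1) unfolding M by (auto simp: id)
    qed
  next
    assume M: "M = as @ j # bs @ i # cs"
    show ?thesis
    proof (rule that[OF M])
      show "map (Transposition.transpose i j) M = as @ i # bs @ j # cs"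
        using assms(1) unfolding M by (auto simp: id)
    qed
  qed
qed

lemma pairprod_transpose:
  assumes "\<And>a b. s b a = - s a b" "distinct M" "i \<in> set M" "j \<in> set M" "i \<noteq> j"
  shows "pairprod s (map (Transposition.transpose i j) M) = - pairprod s M"
proof -
  obtain as bs cs x y where M: "M = as @ x # bs @ y # cs"
    "map (Transposition.transpose i j) M = as @ y # bs @ x # cs"
    by (rule transpose_pair_split[OF assms(2-5)])
  have "pairprod s (as @ y # bs @ x # cs) = - pairprod s (as @ x # bs @ y # cs)"
    by (rule pairprod_swap[OF assms(1)])
  then show ?thesis by (simp only: M(2)) (simp only: M(1))
qed

definition lt_pairs :: "nat set \<Rightarrow> (nat \<times> nat) set" where
  "lt_pairs V = {(i, j). i \<in> V \<and> j \<in> V \<and> i < j}"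

lemma finite_lt_pairs [simp]: "finite V \<Longrightarrow> finite (lt_pairs V)"
  by (rule finite_subset[of _ "V \<times> V"]) (auto simp: lt_pairs_def)

lemma prod_lt_pairs_insert:
  fixes s :: "nat \<Rightarrow> nat \<Rightarrow> complex"
  assumes "finite V" "n \<notin> V"
  shows "(\<Prod>(i, j)\<in>lt_pairs (insert n V). s i j)
     = (\<Prod>i\<in>V. if i < n then s i n else s n i) * (\<Prod>(i, j)\<in>lt_pairs V. s i j)"
proof -
  let ?g = "\<lambda>i. if i < n then (i, n) else (n, i)"
  have eq: "lt_pairs (insert n V) = ?g ` V \<union> lt_pairs V"
    using assms(2) by (auto simp: lt_pairs_def image_iff split: if_splits)
      (metis linorder_neqE_nat)+
  have "inj_on ?g V" by (auto simp: inj_on_def split: if_splits)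
  then have "(\<Prod>(i, j)\<in>?g ` V. s i j) = (\<Prod>i\<in>V. if i < n then s i n else s n i)"
    by (subst prod.reindex) (auto intro!: prod.cong)
  moreover have "?g ` V \<inter> lt_pairs V = {}"
    using assms(2) by (auto simp: lt_pairs_def split: if_splits)
  ultimately show ?thesis
    unfolding eq using assms(1) by (subst prod.union_disjoint) auto
qed

text \<open>Serves the Vandermonde product, which becomes symmetric in the labels once it is
  multiplied by the signs \<open>isgn\<close>.\<close>

lemma pairprod_symmetric:
  fixes s :: "nat \<Rightarrow> nat \<Rightarrow> complex"
  assumes "\<And>a b. s b a = s a b" "distinct M"
  shows "pairprod s M = (\<Prod>(i, j)\<in>lt_pairs (set M). s i j)"
  using assms(2)
proof (induction M)
  case Nil
  then show ?case by (simp add: lt_pairs_def)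
next
  case (Cons n M)
  have "(\<Prod>i\<in>set M. if i < n then s i n else s n i) = prod_list (map (s n) M)"
    using Cons.prems by (subst prod.distinct_set_conv_list)
      (auto intro!: arg_cong[of _ _ prod_list] assms(1))
  then show ?case using Cons by (simp add: prod_lt_pairs_insert)
qed

text \<open>\<open>pairprod isgn M\<close> is the sign of the arrangement \<open>M\<close> relative
  to increasing order. Comparing labels instead of positions lets it split along
  \<open>pairprod_append\<close>.\<close>

definition isgn :: "nat \<Rightarrow> nat \<Rightarrow> complex" where
  "isgn i j = of_int (sgn (int j - int i))"

lemma isgn_anti: "isgn b a = - isgn a b"
  by (simp add: isgn_def sgn_if)

lemma isgn_less: "i < j \<Longrightarrow> isgn i j = 1"
  by (simp add: isgn_def)

text \<open>The numerator of the integrand in the variables \<open>\<xi>\<close> listed in the order \<open>\<Lambda>\<close>, \<open>S\<close>. It carries the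
  extra factors \<open>1 - \<xi>\<^sub>l\<close> for \<open>l \<in> \<Lambda>\<close>, so that the denominator, including the product of all
  \<open>1 - \<xi>\<^sub>i\<close>, depends only on the set \<open>S \<union> \<Lambda>\<close>.\<close>

fun bethe :: "real \<Rightarrow> int list \<Rightarrow> complex list \<Rightarrow> complex" where
  "bethe p [] zs = 0"
| "bethe p [x] zs = (1 - prod_list zs) * pairprod (\<lambda>a b. b - a) zs * (\<Prod>z\<leftarrow>zs. z powi x)"
| "bethe p (x # x' # xs) [] = 0"
| "bethe p (x # x' # xs) (z # zs) =
     (1 - z) * z powi x * (\<Prod>w\<leftarrow>zs. fA p z w) * bethe p (x' # xs) zs"

lemma bethe_short: "length zs < length xs \<Longrightarrow> bethe p xs zs = 0"
  by (induction p xs zs rule: bethe.induct) auto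

definition bethe_sum :: "real \<Rightarrow> int list \<Rightarrow> nat set \<Rightarrow> (nat \<Rightarrow> complex) \<Rightarrow> complex" where
  "bethe_sum p xs V \<eta> = (\<Sum>M\<in>permutations_of_set V. pairprod isgn M * bethe p xs (map \<eta> M))"

lemma bethe_sum_short:
  assumes "card V < length xs"
  shows "bethe_sum p xs V \<eta> = 0"
  unfolding bethe_sum_def using assms
  by (intro sum.neutral) (auto simp: bethe_short length_finite_permutations_of_set)

text \<open>Exchanging two variables composes every arrangement with a transposition, which reverses
  its sign.\<close>

lemma bethe_sum_transpose:
  assumes ij: "i \<in> V" "j \<in> V" "i \<noteq> j"
  shows "bethe_sum p xs V (\<eta> \<circ> Transposition.transpose i j) = - bethe_sum p xs V \<eta>"
proof -
  let ?\<pi> = "Transposition.transpose i j"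
  have inv: "map ?\<pi> (map ?\<pi> M) = M" for M by simp
  have "bethe_sum p xs V (\<eta> \<circ> ?\<pi>) = (\<Sum>M\<in>permutations_of_set V. - pairprod isgn M * bethe p xs (map \<eta> M))"
    unfolding bethe_sum_def
  proof (rule sum.reindex_bij_witness[of _ "map ?\<pi>" "map ?\<pi>"])
    fix M assume M: "M \<in> permutations_of_set V"
    have "?\<pi> ` V = V" using ij by simp
    then show "map ?\<pi> M \<in> permutations_of_set V"
      using M by (auto simp: permutations_of_set_def distinct_map)
    then show "map ?\<pi> M \<in> permutations_of_set V" .
    have "pairprod isgn (map ?\<pi> M) = - pairprod isgn M"
      using M ij by (intro pairprod_transpose isgn_anti) (auto simp: permutations_of_set_def)
    then show "- pairprod isgn (map ?\<pi> M) * bethe p xs (map \<eta> (map ?\<pi> M)) =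
         pairprod isgn M * bethe p xs (map (\<eta> \<circ> ?\<pi>) M)"
      by (simp add: comp_def)
  qed (use inv in auto)
  then show ?thesis by (simp add: bethe_sum_def sum_negf)
qed

text \<open>An antisymmetric function vanishes on the diagonal. This is what removes the apparent
  poles outside the contour later on.\<close>

lemma bethe_sum_coincident:
  assumes "i \<in> V" "j \<in> V" "i \<noteq> j" "\<eta> i = \<eta> j"
  shows "bethe_sum p xs V \<eta> = 0"
proof -
  have "\<eta> \<circ> Transposition.transpose i j = \<eta>"
    using assms(4) by (auto simp: fun_eq_iff Transposition.transpose_def)
  then show ?thesis using bethe_sum_transpose[OF assms(1-3), of p xs \<eta>] by simp
qed

lemma pairprod_cong:
  assumes "\<And>a b. a \<in> set M \<Longrightarrow> b \<in> set M \<Longrightarrow> s a b = t a b"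
  shows "pairprod s M = pairprod t M"
  using assms
proof (induction M)
  case (Cons a M)
  then have "map (s a) M = map (t a) M" "pairprod s M = pairprod t M" by auto
  then show ?case by (simp only: pairprod.simps)
qed simp

text \<open>The signs see only the relative order of the labels. Needed for replacing
  \<open>i\<close> by \<open>Suc i\<close> in a set that does not contain
  \<open>Suc i\<close>.\<close>

lemma bethe_sum_relabel:
  assumes "inj_on f V" "\<And>a b. a \<in> V \<Longrightarrow> b \<in> V \<Longrightarrow> f a < f b \<longleftrightarrow> a < b"
  shows "bethe_sum p xs (f ` V) \<eta> = bethe_sum p xs V (\<eta> \<circ> f)"
proof -
  have "pairprod isgn (map f M) = pairprod isgn M" if "M \<in> permutations_of_set V" for M
    unfolding pairprod_map
  proof (rule pairprod_cong)
    fix a b assume "a \<in> set M" "b \<in> set M"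
    then have "a \<in> V" "b \<in> V" using that by (auto simp: permutations_of_set_def)
    then show "isgn (f a) (f b) = isgn a b"
      using assms(2)[of a b] assms(2)[of b a] by (auto simp: isgn_def sgn_if)
  qed
  moreover have "inj_on (map f) (permutations_of_set V)"
    by (rule inj_on_mapI[OF inj_on_subset[OF assms(1)]]) (auto simp: permutations_of_set_def)
  ultimately show ?thesis
    unfolding bethe_sum_def permutations_of_set_image_inj[OF assms(1)]
    by (subst sum.reindex) (auto intro!: sum.cong)
qed

text \<open>Each variable carries exactly one exponent taken from \<open>xs\<close>, so a common
  shift factors out.\<close>

lemma bethe_shift:
  assumes "\<And>z. z \<in> set zs \<Longrightarrow> z \<noteq> 0"
  shows "bethe p (map (\<lambda>x. x + c) xs) zs = bethe p xs zs * (\<Prod>z\<leftarrow>zs. z powi c)"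
  using assms
proof (induction p xs zs rule: bethe.induct)
  case (2 p x zs)
  then have "map (\<lambda>z. z powi (x + c)) zs = map (\<lambda>z. z powi x * z powi c) zs"
    by (auto simp: power_int_add)
  then have "(\<Prod>z\<leftarrow>zs. z powi (x + c)) = (\<Prod>z\<leftarrow>zs. z powi x) * (\<Prod>z\<leftarrow>zs. z powi c)"
    by (simp only: prod_list_mult)
  then show ?case by simp
qed (auto simp: power_int_add)


section \<open>Specialising one variable to 1\<close>

lemma fA_one: "fA p a 1 = of_real p * (1 - a)"
  by (simp add: fA_def algebra_simps)

text \<open>In a slot of \<Lambda> the value 1 is killed by the factor 1 - z. In the last block each
  variable a of \<Lambda> gives f(a, 1) = p (1 - a), and the Vandermonde factor gives 1 - z up to
  sign for the others. The sign on the left is that of inserting a smallest label at this place;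
  with it the value no longer depends on the place.\<close>

lemma bethe_insert_one:
  "(-1) ^ length as * bethe p xs (as @ 1 # bs) =
     (if length as + 1 < length xs then 0
      else (-1) ^ (length as + length bs) * of_real p ^ (length xs - 1)
        * (\<Prod>z\<leftarrow>as @ bs. 1 - z) * bethe p xs (as @ bs))"
proof (induction xs arbitrary: as)
  case Nil
  then show ?case by simp
next
  case (Cons x xs)
  show ?case
  proof (cases xs)
    case Nil
    have "(\<Prod>w\<leftarrow>bs. w - 1 :: complex) = (-1) ^ length bs * (\<Prod>w\<leftarrow>bs. 1 - w)"
      using prod_list_minus[of "\<lambda>w. 1 - w" bs] by simp
    then show ?thesis
      unfolding Nil by (simp add: pairprod_append prod_list_mult power_add mult_ac)
  next
    case (Cons x' xs')
    show ?thesis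
    proof (cases as)
      case Nil
      then show ?thesis by (simp add: Cons)
    next
      case as: (Cons a as')
      let ?c = "(1 - a) * a powi x * (\<Prod>w\<leftarrow>as' @ bs. fA p a w)"
      have "(-1) ^ length as * bethe p (x # xs) (as @ 1 # bs)
         = - ?c * (of_real p * (1 - a)) * ((-1) ^ length as' * bethe p xs (as' @ 1 # bs))"
        by (simp add: Cons as fA_one algebra_simps)
      also have "\<dots> = (if length as + 1 < length (x # xs) then 0
          else (-1) ^ (length as + length bs) * of_real p ^ (length (x # xs) - 1)
            * (\<Prod>z\<leftarrow>as @ bs. 1 - z) * bethe p (x # xs) (as @ bs))"
        unfolding Cons.IH by (simp add: Cons as)
      finally show ?thesis .
    qed
  qed
qed

text \<open>An arrangement of the larger set is an arrangement of \<open>V\<close> together with the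
  place \<open>n\<close> of \<open>v\<close>; \<open>takeWhile\<close> recovers that place.\<close>

lemma sum_permutations_insert:
  assumes "finite V" "v \<notin> V"
  shows "(\<Sum>M\<in>permutations_of_set (insert v V). g M)
       = (\<Sum>M\<in>permutations_of_set V. \<Sum>n\<le>card V. g (take n M @ v # drop n M))"
proof -
  have len: "length M = card V" if "M \<in> permutations_of_set V" for M
    using that by (rule length_finite_permutations_of_set)
  have "(\<Sum>(M, n)\<in>permutations_of_set V \<times> {..card V}. g (take n M @ v # drop n M))
      = (\<Sum>M\<in>permutations_of_set (insert v V). g M)"
  proof (rule sum.reindex_bij_witness[of _
        "\<lambda>M. (takeWhile (\<lambda>i. i \<noteq> v) M @ tl (dropWhile (\<lambda>i. i \<noteq> v) M), length (takeWhile (\<lambda>i. i \<noteq> v) M))"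
        "\<lambda>(M, n). take n M @ v # drop n M"])
    fix a assume "a \<in> permutations_of_set V \<times> {..card V}"
    then obtain M n where a: "a = (M, n)" and M: "M \<in> permutations_of_set V" and n: "n \<le> length M"
      using len by auto
    have M': "set M = V" "distinct M" using M by (auto simp: permutations_of_set_def)
    have tv: "v \<notin> set (take n M)" using M' assms by (meson in_set_takeD)
    then have "takeWhile (\<lambda>i. i \<noteq> v) (take n M @ v # drop n M) = take n M"
      "dropWhile (\<lambda>i. i \<noteq> v) (take n M @ v # drop n M) = v # drop n M"
      by (auto simp: takeWhile_append dropWhile_append)
    then show "(takeWhile (\<lambda>i. i \<noteq> v) (case a of (M, n) \<Rightarrow> take n M @ v # drop n M) @
          tl (dropWhile (\<lambda>i. i \<noteq> v) (case a of (M, n) \<Rightarrow> take n M @ v # drop n M)),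
          length (takeWhile (\<lambda>i. i \<noteq> v) (case a of (M, n) \<Rightarrow> take n M @ v # drop n M))) = a"
      using n by (simp add: a)
    have "distinct (take n M @ drop n M)" using M' by simp
    moreover have "set (take n M) \<union> set (drop n M) = V"
      using M' by (metis append_take_drop_id set_append)
    ultimately show "(case a of (M, n) \<Rightarrow> take n M @ v # drop n M) \<in> permutations_of_set (insert v V)"
      using assms unfolding a by (auto simp: permutations_of_set_def simp del: append_take_drop_id)
  next
    fix M assume M: "M \<in> permutations_of_set (insert v V)"
    then have "v \<in> set M" by (auto simp: permutations_of_set_def)
    then obtain as bs where ab: "M = as @ v # bs" "v \<notin> set as"
      using split_list_first by metis
    have tw: "takeWhile (\<lambda>i. i \<noteq> v) M = as" "dropWhile (\<lambda>i. i \<noteq> v) M = v # bs"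
      using ab by (auto simp: takeWhile_append dropWhile_append)
    show "(case (takeWhile (\<lambda>i. i \<noteq> v) M @ tl (dropWhile (\<lambda>i. i \<noteq> v) M),
               length (takeWhile (\<lambda>i. i \<noteq> v) M)) of (M, n) \<Rightarrow> take n M @ v # drop n M) = M"
      unfolding tw using ab(1) by simp
    have "as @ bs \<in> permutations_of_set V"
      using M ab assms by (auto simp: permutations_of_set_def)
    with len[OF this] show "(takeWhile (\<lambda>i. i \<noteq> v) M @ tl (dropWhile (\<lambda>i. i \<noteq> v) M),
          length (takeWhile (\<lambda>i. i \<noteq> v) M)) \<in> permutations_of_set V \<times> {..card V}"
      by (auto simp: tw)
  qed auto
  then show ?thesis by (simp add: sum.cartesian_product)
qed

text \<open>The smallest label forms an inversion with every entry before it and with none after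
  it.\<close>

lemma pairprod_isgn_insert_min:
  assumes "\<And>a. a \<in> set as \<union> set bs \<Longrightarrow> v < a"
  shows "pairprod isgn (as @ v # bs) = (-1) ^ length as * pairprod isgn (as @ bs)"
proof -
  have "map (\<lambda>a. isgn a v * (\<Prod>b\<leftarrow>bs. isgn a b)) as = map (\<lambda>a. - (\<Prod>b\<leftarrow>bs. isgn a b)) as"
    using assms by (auto simp: isgn_less isgn_anti[of _ v])
  then have "(\<Prod>a\<leftarrow>as. isgn a v * (\<Prod>b\<leftarrow>bs. isgn a b))
      = (-1) ^ length as * (\<Prod>a\<leftarrow>as. \<Prod>b\<leftarrow>bs. isgn a b)"
    by (simp only: prod_list_minus)
  moreover have "map (isgn v) bs = map (\<lambda>_. 1) bs"
    using assms by (auto simp: isgn_less)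
  then have "(\<Prod>b\<leftarrow>bs. isgn v b) = 1" by (simp only: map_replicate_const prod_list_replicate) simp
  ultimately show ?thesis by (simp add: pairprod_append mult_ac)
qed

text \<open>All admissible places of the value 1 contribute equally, and the natural number in the
  formula counts them.\<close>

lemma bethe_sum_insert_one:
  assumes V: "finite V" "\<And>a. a \<in> V \<Longrightarrow> v < a" and xs: "xs \<noteq> []"
  shows "bethe_sum p xs (insert v V) (\<eta>(v := 1)) =
     (-1) ^ card V * of_nat (card V + 2 - length xs) * of_real p ^ (length xs - 1)
       * (\<Prod>i\<in>V. 1 - \<eta> i) * bethe_sum p xs V \<eta>"
proof -
  have v: "v \<notin> V" using V(2) by auto
  have "(\<Sum>n\<le>card V. pairprod isgn (take n M @ v # drop n M)
          * bethe p xs (map (\<eta>(v := 1)) (take n M @ v # drop n M)))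
      = (-1) ^ card V * of_nat (card V + 2 - length xs) * of_real p ^ (length xs - 1)
       * (\<Prod>i\<in>V. 1 - \<eta> i) * (pairprod isgn M * bethe p xs (map \<eta> M))"
    if M: "M \<in> permutations_of_set V" for M
  proof -
    have M': "set M = V" "distinct M" "length M = card V"
      using M by (auto simp: permutations_of_set_def distinct_card)
    let ?c = "(-1) ^ card V * of_real p ^ (length xs - 1)
       * (\<Prod>i\<in>V. 1 - \<eta> i) * (pairprod isgn M * bethe p xs (map \<eta> M))"
    have val: "pairprod isgn (take n M @ v # drop n M)
          * bethe p xs (map (\<eta>(v := 1)) (take n M @ v # drop n M))
        = (if n + 1 < length xs then 0 else ?c)" if n: "n \<le> card V" for n
    proof -
      have tv: "set (take n M) \<subseteq> V" "set (drop n M) \<subseteq> V"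
        using M' by (auto dest: in_set_takeD in_set_dropD)
      then have m: "map (\<eta>(v := 1)) (take n M) = map \<eta> (take n M)"
         "map (\<eta>(v := 1)) (drop n M) = map \<eta> (drop n M)"
        using v by auto
      have sg: "pairprod isgn (take n M @ v # drop n M) = (-1) ^ n * pairprod isgn M"
        using pairprod_isgn_insert_min[of "take n M" "drop n M" v] tv V n M' by auto
      have pr: "(\<Prod>z\<leftarrow>map \<eta> M. 1 - z) = (\<Prod>i\<in>V. 1 - \<eta> i)"
        using M' prod.distinct_set_conv_list[of M "\<lambda>i. 1 - \<eta> i"] by (simp add: comp_def)
      have "pairprod isgn (take n M @ v # drop n M)
          * bethe p xs (map (\<eta>(v := 1)) (take n M @ v # drop n M))
        = pairprod isgn M * ((-1) ^ n * bethe p xs (map \<eta> (take n M) @ 1 # map \<eta> (drop n M)))"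
        unfolding sg by (simp add: m)
      also have "(-1) ^ n * bethe p xs (map \<eta> (take n M) @ 1 # map \<eta> (drop n M))
        = (if n + 1 < length xs then 0 else (-1) ^ card V * of_real p ^ (length xs - 1)
            * (\<Prod>i\<in>V. 1 - \<eta> i) * bethe p xs (map \<eta> M))"
        using bethe_insert_one[of "map \<eta> (take n M)" p xs "map \<eta> (drop n M)"] n M'(3) pr
        by (simp add: min_absorb2 flip: map_append)
      finally show ?thesis
        by (cases "n + 1 < length xs") (simp_all only: if_True if_False mult_zero_right mult_zero_left mult_ac)
    qed
    have "(\<Sum>n\<le>card V. pairprod isgn (take n M @ v # drop n M)
          * bethe p xs (map (\<eta>(v := 1)) (take n M @ v # drop n M)))
        = (\<Sum>n\<le>card V. if n + 1 < length xs then 0 else ?c)"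
      by (rule sum.cong) (use val in auto)
    \<comment> \<open>The places before \<open>length xs - 1\<close> are the slots of
      \<Lambda>.\<close>
    also have "\<dots> = (\<Sum>n\<in>{length xs - 1..card V}. ?c)"
      by (rule sum.mono_neutral_cong_right) auto
    also have "\<dots> = of_nat (card V + 2 - length xs) * ?c"
      using xs by (cases xs) auto
    finally show ?thesis by (simp add: mult_ac)
  qed
  then show ?thesis
    unfolding bethe_sum_def sum_permutations_insert[OF V(1) v] sum_distrib_left
    by (intro sum.cong) auto
qed

section \<open>Growth at infinity\<close>

text \<open>\<open>h\<close> is O(u^d). Only upper bounds are tracked, so a degree may always be
  rounded up.\<close>

definition growth :: "(complex \<Rightarrow> complex) \<Rightarrow> int \<Rightarrow> bool" where
  "growth h d \<longleftrightarrow> (\<exists>C\<ge>0. \<forall>\<^sub>F u in at_infinity. norm (h u) \<le> C * norm u powi d)"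

lemma eventually_norm_ge_at_infinity: "\<forall>\<^sub>F u::complex in at_infinity. norm u \<ge> b"
  by (auto simp: eventually_at_infinity)

lemma growth_mult:
  assumes "growth h d" "growth k e"
  shows "growth (\<lambda>u. h u * k u) (d + e)"
proof -
  obtain C D where CD: "C \<ge> 0" "D \<ge> 0"
    "\<forall>\<^sub>F u in at_infinity. norm (h u) \<le> C * norm u powi d"
    "\<forall>\<^sub>F u in at_infinity. norm (k u) \<le> D * norm u powi e"
    using assms by (auto simp: growth_def)
  have "\<forall>\<^sub>F u in at_infinity. norm (h u * k u) \<le> (C * D) * norm u powi (d + e)"
    using CD(3,4) eventually_norm_ge_at_infinity[of 1]
  proof eventually_elim
    case (elim u)
    have "norm (h u) * norm (k u) \<le> (C * norm u powi d) * (D * norm u powi e)"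
      using elim CD by (intro mult_mono) auto
    moreover have "norm u \<noteq> 0" using elim by auto
    ultimately show ?case
      by (simp add: norm_mult power_int_add mult_ac)
  qed
  then show ?thesis using CD unfolding growth_def by (metis mult_nonneg_nonneg)
qed

lemma growth_mono:
  assumes "growth h d" "d \<le> e"
  shows "growth h e"
proof -
  obtain C where C: "C \<ge> 0" "\<forall>\<^sub>F u in at_infinity. norm (h u) \<le> C * norm u powi d"
    using assms by (auto simp: growth_def)
  have "\<forall>\<^sub>F u in at_infinity. norm (h u) \<le> C * norm u powi e"
    using C(2) eventually_norm_ge_at_infinity[of 1]
  proof eventually_elim
    case (elim u)
    have "norm u powi d \<le> norm u powi e"
      using elim assms by (intro power_int_increasing) auto
    then show ?case
      using elim C mult_left_mono[of "norm u powi d" "norm u powi e" C] by linarith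
  qed
  then show ?thesis using C unfolding growth_def by blast
qed

lemma growth_add:
  assumes "growth h d" "growth k d"
  shows "growth (\<lambda>u. h u + k u) d"
proof -
  obtain C D where CD: "C \<ge> 0" "D \<ge> 0"
    "\<forall>\<^sub>F u in at_infinity. norm (h u) \<le> C * norm u powi d"
    "\<forall>\<^sub>F u in at_infinity. norm (k u) \<le> D * norm u powi d"
    using assms by (auto simp: growth_def)
  have "\<forall>\<^sub>F u in at_infinity. norm (h u + k u) \<le> (C + D) * norm u powi d"
    using CD(3,4)
  proof eventually_elim
    case (elim u)
    then show ?case using norm_triangle_ineq[of "h u" "k u"] by (simp add: distrib_right)
  qed
  then show ?thesis using CD unfolding growth_def by (metis add_nonneg_nonneg)
qed

lemma growth_const: "growth (\<lambda>u. c) 0"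
  unfolding growth_def by (intro exI[of _ "norm c"]) auto

lemma growth_zero: "growth (\<lambda>u. 0) d"
  unfolding growth_def by (intro exI[of _ 0]) auto

lemma growth_powi: "growth (\<lambda>u. u powi d) d"
  unfolding growth_def by (intro exI[of _ 1]) (auto simp: norm_power_int)

lemma growth_id: "growth (\<lambda>u. u) 1"
  using growth_powi[of 1] by simp

lemma growth_minus: "growth h d \<Longrightarrow> growth (\<lambda>u. - h u) d"
  by (simp add: growth_def)

lemma growth_diff: "growth h d \<Longrightarrow> growth k d \<Longrightarrow> growth (\<lambda>u. h u - k u) d"
  using growth_add[OF _ growth_minus] by simp

lemma growth_power: "growth h d \<Longrightarrow> growth (\<lambda>u. h u ^ n) (int n * d)"
proof (induction n)
  case 0
  then show ?case using growth_const[of 1] by simp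
next
  case (Suc n)
  then show ?case using growth_mult[OF Suc(2) Suc.IH] by (simp add: algebra_simps)
qed

lemma growth_power_int:
  assumes "growth h d" "n \<ge> 0"
  shows "growth (\<lambda>u. h u powi n) (n * d)"
  using growth_power[OF assms(1), of "nat n"] assms(2) by (simp add: power_int_def)

lemma growth_inverse_linear:
  assumes "b \<noteq> 0"
  shows "growth (\<lambda>u. 1 / (a + b * u)) (-1)"
proof -
  have "\<forall>\<^sub>F u in at_infinity. norm (1 / (a + b * u)) \<le> (2 / norm b) * norm u powi (-1)"
    \<comment> \<open>Beyond this radius \<open>norm a\<close> is at most half of
      \<open>norm (b * u)\<close>.\<close>
    using eventually_norm_ge_at_infinity[of "2 * norm a / norm b + 1"]
  proof eventually_elim
    case (elim u)
    have nb: "norm b > 0" using assms by simp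
    have u0: "norm u > 0" using elim nb by (smt (verit) divide_nonneg_pos norm_ge_zero)
    have "2 * norm a / norm b \<le> norm u" using elim by simp
    then have "2 * norm a \<le> norm b * norm u" using nb by (simp add: field_simps)
    moreover have "norm (a + b * u) \<ge> norm (b * u) - norm a"
      by (metis add.commute norm_diff_ineq)
    ultimately have ge: "norm (a + b * u) \<ge> norm b * norm u / 2"
      by (simp add: norm_mult)
    moreover have pos: "norm b * norm u / 2 > 0" using nb u0 by simp
    ultimately have "1 / norm (a + b * u) \<le> 1 / (norm b * norm u / 2)"
      by (intro divide_left_mono mult_pos_pos) linarith+
    then show ?case using nb u0 by (simp add: norm_divide power_int_minus field_simps)
  qed
  then show ?thesis unfolding growth_def by (intro exI[of _ "2 / norm b"]) auto
qed

lemma growth_prod: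
  assumes "\<And>i. i \<in> A \<Longrightarrow> growth (h i) (d i)"
  shows "growth (\<lambda>u. \<Prod>i\<in>A. h i u) (\<Sum>i\<in>A. d i)"
  using assms
proof (induction A rule: infinite_finite_induct)
  case (insert i A)
  then show ?case by (auto intro: growth_mult)
qed (auto intro: growth_const)

lemma growth_prod_list:
  assumes "\<And>i. i \<in> set M \<Longrightarrow> growth (h i) d"
  shows "growth (\<lambda>u. \<Prod>i\<leftarrow>M. h i u) (int (length M) * d)"
  using assms
proof (induction M)
  case (Cons i M)
  then have "growth (\<lambda>u. h i u * (\<Prod>i\<leftarrow>M. h i u)) (d + int (length M) * d)"
    by (intro growth_mult) auto
  then show ?case by (simp add: algebra_simps)
qed (auto intro: growth_const)

lemma growth_sum:
  assumes "\<And>i. i \<in> A \<Longrightarrow> growth (h i) d"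
  shows "growth (\<lambda>u. \<Sum>i\<in>A. h i u) d"
  using assms
proof (induction A rule: infinite_finite_induct)
  case (insert i A)
  then show ?case by (auto intro: growth_add)
qed (auto intro: growth_zero)

lemma growth_tendsto_0:
  assumes "growth h (-1)"
  shows "(h \<longlongrightarrow> 0) at_infinity"
proof -
  obtain C where C: "C \<ge> 0" "\<forall>\<^sub>F u in at_infinity. norm (h u) \<le> C * norm u powi (-1)"
    using assms by (auto simp: growth_def)
  have "((\<lambda>u. C * norm (inverse u)) \<longlongrightarrow> 0) (at_infinity :: complex filter)"
    using tendsto_mult_right_zero[OF tendsto_norm_zero[OF tendsto_inverse_0], of C] by simp
  then show ?thesis
    by (rule Lim_null_comparison[rotated])
       (use C in \<open>auto simp: power_int_minus norm_inverse\<close>)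
qed


text \<open>For points of this size no denominator of the integrand vanishes, whatever \<open>p < 1\<close>.\<close>

definition good :: "real \<Rightarrow> complex \<Rightarrow> bool" where
  "good p z \<longleftrightarrow> norm z > 4 / (1 - p)"

definition fprod :: "real \<Rightarrow> nat set \<Rightarrow> (nat \<Rightarrow> complex) \<Rightarrow> complex" where
  "fprod p V \<eta> = (\<Prod>(i, j)\<in>lt_pairs V. fA p (\<eta> i) (\<eta> j))"

definition denom :: "real \<Rightarrow> nat set \<Rightarrow> (nat \<Rightarrow> complex) \<Rightarrow> complex" where
  "denom p V \<eta> = (\<Prod>i\<in>V. 1 - \<eta> i) * fprod p V \<eta>"

lemma good_norm:
  assumes "0 \<le> p" "p < 1" "good p z"
  shows "norm z > 4" "norm (of_real (1 - p) * z) > 4"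
proof -
  show *: "norm (of_real (1 - p) * z) > 4"
    using assms by (simp add: good_def norm_mult field_simps del: of_real_diff)
  have "(1 - p) * norm z \<le> 1 * norm z"
    using assms by (intro mult_right_mono) auto
  then show "norm z > 4"
    using * assms by (simp add: norm_mult del: of_real_diff)
qed

lemma good_nonzero:
  assumes "0 \<le> p" "p < 1" "good p z"
  shows "z \<noteq> 0" "1 - z \<noteq> 0" "of_real (1 - p) * z - 1 \<noteq> 0" "1 - of_real (1 - p) * z \<noteq> 0"
  using good_norm[OF assms] by (auto simp del: of_real_diff)

text \<open>A zero would force |z| |q w| = |z - p| \<le> |z| + p, whereas |q w| > 4 makes the left
  side at least 4 |z|.\<close>

lemma fA_nonzero:
  assumes p: "0 \<le> p" "p < 1" and z: "good p z" and w: "good p w"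
  shows "fA p z w \<noteq> 0"
proof
  assume "fA p z w = 0"
  then have "z * (of_real (1 - p) * w) = z - of_real p"
    by (simp add: fA_def algebra_simps)
  then have "norm z * norm (of_real (1 - p) * w) = norm (z - of_real p)"
    by (metis norm_mult)
  also have "\<dots> \<le> norm z + p"
    using norm_triangle_ineq4[of z "of_real p"] p by simp
  finally have "norm z * norm (of_real (1 - p) * w) \<le> norm z + p" .
  moreover have "norm z * 4 \<le> norm z * norm (of_real (1 - p) * w)"
    using good_norm[OF p w] by (intro mult_left_mono) auto
  ultimately show False using good_norm[OF p z] p by simp
qed

lemma denom_nonzero:
  assumes "0 \<le> p" "p < 1" "finite V" "\<And>i. i \<in> V \<Longrightarrow> good p (\<eta> i)"
  shows "denom p V \<eta> \<noteq> 0"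
proof -
  have "fprod p V \<eta> \<noteq> 0"
    unfolding fprod_def using finite_lt_pairs[OF assms(3)] assms
    by (subst prod_zero_iff) (auto simp: lt_pairs_def fA_nonzero)
  moreover have "(\<Prod>i\<in>V. 1 - \<eta> i) \<noteq> 0"
    using good_nonzero(2)[OF assms(1,2)] assms(3,4) by (subst prod_zero_iff) auto
  ultimately show ?thesis by (simp add: denom_def)
qed

lemma fprod_insert:
  assumes "finite V" "n \<notin> V"
  shows "fprod p (insert n V) \<eta> =
    (\<Prod>i\<in>V. if i < n then fA p (\<eta> i) (\<eta> n) else fA p (\<eta> n) (\<eta> i)) * fprod p V \<eta>"
  unfolding fprod_def by (rule prod_lt_pairs_insert[OF assms])

lemma fprod_cong: "(\<And>i. i \<in> V \<Longrightarrow> \<eta> i = \<eta>' i) \<Longrightarrow> fprod p V \<eta> = fprod p V \<eta>'"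
  unfolding fprod_def by (intro prod.cong) (auto simp: lt_pairs_def)

text \<open>With \<open>v\<close> smallest, \<xi>_v is the first argument in all its factors, so the
  poles in \<xi>_v come from 1 and from the zeros of f(., \<xi>_i).\<close>

lemma denom_insert_min:
  assumes "finite V" "\<And>i. i \<in> V \<Longrightarrow> v < i"
  shows "denom p (insert v V) \<eta> = (1 - \<eta> v) * (\<Prod>i\<in>V. fA p (\<eta> v) (\<eta> i)) * denom p V \<eta>"
proof -
  have "v \<notin> V" using assms by auto
  moreover have "(\<Prod>i\<in>V. if i < v then fA p (\<eta> i) (\<eta> v) else fA p (\<eta> v) (\<eta> i))
      = (\<Prod>i\<in>V. fA p (\<eta> v) (\<eta> i))"
    using assms by (intro prod.cong) (auto dest: less_asym)
  ultimately show ?thesis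
    using assms by (simp add: denom_def fprod_insert mult_ac)
qed

section \<open>Continuity in the variables and in \<open>p\<close>, holomorphy in a single
  parameter\<close>

lemma continuous_on_prod_list:
  fixes h :: "'i \<Rightarrow> 'a::topological_space \<Rightarrow> complex"
  assumes "\<And>i. i \<in> set M \<Longrightarrow> continuous_on A (h i)"
  shows "continuous_on A (\<lambda>x. \<Prod>i\<leftarrow>M. h i x)"
  using assms by (induction M) (auto intro!: continuous_on_mult)

lemma continuous_on_pairprod:
  fixes s :: "'a::topological_space \<Rightarrow> 'i \<Rightarrow> 'i \<Rightarrow> complex"
  assumes "\<And>i j. i \<in> set M \<Longrightarrow> j \<in> set M \<Longrightarrow> continuous_on A (\<lambda>x. s x i j)"
  shows "continuous_on A (\<lambda>x. pairprod (s x) M)"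
  using assms by (induction M) (auto intro!: continuous_on_mult continuous_on_prod_list)

lemma continuous_on_fA:
  assumes "continuous_on A P" "continuous_on A f" "continuous_on A g"
  shows "continuous_on A (\<lambda>x. fA (P x) (f x) (g x))"
  unfolding fA_def by (intro continuous_intros assms)

lemma continuous_on_bethe:
  fixes \<eta> :: "'a::topological_space \<Rightarrow> 'i \<Rightarrow> complex"
  assumes "continuous_on A P" "\<And>i. i \<in> set M \<Longrightarrow> continuous_on A (\<lambda>x. \<eta> x i)"
    "\<And>i x. i \<in> set M \<Longrightarrow> x \<in> A \<Longrightarrow> \<eta> x i \<noteq> 0"
  shows "continuous_on A (\<lambda>x. bethe (P x) xs (map (\<eta> x) M))"
  using assms(2,3)
proof (induction xs arbitrary: M)
  case (Cons c xs)
  show ?case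
  proof (cases xs)
    case Nil
    have "continuous_on A (\<lambda>x. (1 - (\<Prod>i\<leftarrow>M. \<eta> x i)) * pairprod (\<lambda>i j. \<eta> x j - \<eta> x i) M
        * (\<Prod>i\<leftarrow>M. \<eta> x i powi c))"
      using Cons.prems
      by (intro continuous_on_mult continuous_on_diff continuous_on_const continuous_on_prod_list
          continuous_on_pairprod continuous_on_power_int) auto
    then show ?thesis by (simp add: Nil pairprod_map comp_def)
  next
    case xs: (Cons c' xs')
    show ?thesis
    proof (cases M)
      case Nil
      then show ?thesis by (simp add: xs)
    next
      case M: (Cons i M')
      have "continuous_on A (\<lambda>x. (1 - \<eta> x i) * \<eta> x i powi c * (\<Prod>w\<leftarrow>M'. fA (P x) (\<eta> x i) (\<eta> x w))
          * bethe (P x) xs (map (\<eta> x) M'))"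
        using Cons.prems
        by (intro continuous_on_mult continuous_on_diff continuous_on_const continuous_on_prod_list
          Cons.IH continuous_on_fA assms(1) continuous_on_power_int) (auto simp: M)
      then show ?thesis by (simp add: xs M comp_def)
    qed
  qed
qed auto

lemma continuous_on_bethe_sum:
  fixes \<eta> :: "'a::topological_space \<Rightarrow> nat \<Rightarrow> complex"
  assumes "continuous_on A P" "\<And>i. i \<in> V \<Longrightarrow> continuous_on A (\<lambda>x. \<eta> x i)"
    "\<And>i x. i \<in> V \<Longrightarrow> x \<in> A \<Longrightarrow> \<eta> x i \<noteq> 0"
  shows "continuous_on A (\<lambda>x. bethe_sum (P x) xs V (\<eta> x))"
  unfolding bethe_sum_def using assms
  by (intro continuous_on_sum continuous_on_mult continuous_on_const continuous_on_bethe)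
     (auto simp: permutations_of_set_def)

lemma continuous_on_denom:
  fixes \<eta> :: "'a::topological_space \<Rightarrow> nat \<Rightarrow> complex"
  assumes "continuous_on A P" "\<And>i. i \<in> V \<Longrightarrow> continuous_on A (\<lambda>x. \<eta> x i)"
  shows "continuous_on A (\<lambda>x. denom (P x) V (\<eta> x))"
  unfolding denom_def fprod_def split_def using assms
  by (intro continuous_on_mult continuous_on_prod continuous_on_diff continuous_on_const continuous_on_fA)
     (auto simp: lt_pairs_def)

lemma holomorphic_on_prod_list:
  assumes "\<And>i. i \<in> set M \<Longrightarrow> h i holomorphic_on A"
  shows "(\<lambda>x. \<Prod>i\<leftarrow>M. h i x) holomorphic_on A"
  using assms by (induction M) (auto intro!: holomorphic_intros)

lemma holomorphic_on_pairprod: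
  assumes "\<And>i j. i \<in> set M \<Longrightarrow> j \<in> set M \<Longrightarrow> (\<lambda>x. s x i j) holomorphic_on A"
  shows "(\<lambda>x. pairprod (s x) M) holomorphic_on A"
  using assms by (induction M) (auto intro!: holomorphic_intros holomorphic_on_prod_list)

lemma holomorphic_on_fA:
  assumes "f holomorphic_on A" "g holomorphic_on A"
  shows "(\<lambda>x. fA p (f x) (g x)) holomorphic_on A"
  unfolding fA_def by (intro holomorphic_intros assms)

text \<open>Holomorphy of the powers is left as a hypothesis: it holds away from 0 for all
  exponents, and also at 0 for non-negative ones, which the residue computation relies on.\<close>

lemma holomorphic_on_bethe:
  assumes "\<And>i. i \<in> set M \<Longrightarrow> (\<lambda>x. \<eta> x i) holomorphic_on A"
    "\<And>i c. i \<in> set M \<Longrightarrow> c \<in> set xs \<Longrightarrow> (\<lambda>x. \<eta> x i powi c) holomorphic_on A"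
  shows "(\<lambda>x. bethe p xs (map (\<eta> x) M)) holomorphic_on A"
  using assms
proof (induction xs arbitrary: M)
  case (Cons c xs)
  show ?case
  proof (cases xs)
    case Nil
    have "(\<lambda>x. (1 - (\<Prod>i\<leftarrow>M. \<eta> x i)) * pairprod (\<lambda>i j. \<eta> x j - \<eta> x i) M
        * (\<Prod>i\<leftarrow>M. \<eta> x i powi c)) holomorphic_on A"
      using Cons.prems
      by (intro holomorphic_on_mult holomorphic_on_diff holomorphic_on_const holomorphic_on_prod_list
          holomorphic_on_pairprod) auto
    then show ?thesis by (simp add: Nil pairprod_map comp_def)
  next
    case xs: (Cons c' xs')
    show ?thesis
    proof (cases M)
      case Nil
      then show ?thesis by (simp add: xs)
    next
      case M: (Cons i M')
      have "(\<lambda>x. (1 - \<eta> x i) * \<eta> x i powi c * (\<Prod>w\<leftarrow>M'. fA p (\<eta> x i) (\<eta> x w))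
          * bethe p xs (map (\<eta> x) M')) holomorphic_on A"
        using Cons.prems
        by (intro holomorphic_on_mult holomorphic_on_diff holomorphic_on_const holomorphic_on_prod_list
          Cons.IH holomorphic_on_fA) (auto simp: M)
      then show ?thesis by (simp add: xs M comp_def)
    qed
  qed
qed auto

lemma holomorphic_on_bethe_sum:
  assumes "\<And>i. i \<in> V \<Longrightarrow> (\<lambda>x. \<eta> x i) holomorphic_on A"
    "\<And>i c. i \<in> V \<Longrightarrow> c \<in> set xs \<Longrightarrow> (\<lambda>x. \<eta> x i powi c) holomorphic_on A"
  shows "(\<lambda>x. bethe_sum p xs V (\<eta> x)) holomorphic_on A"
  unfolding bethe_sum_def using assms
  by (intro holomorphic_on_sum holomorphic_on_mult holomorphic_on_const holomorphic_on_bethe)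
     (auto simp: permutations_of_set_def)

lemma holomorphic_on_denom:
  assumes "\<And>i. i \<in> V \<Longrightarrow> (\<lambda>x. \<eta> x i) holomorphic_on A"
  shows "(\<lambda>x. denom p V (\<eta> x)) holomorphic_on A"
  unfolding denom_def fprod_def split_def using assms
  by (intro holomorphic_on_mult holomorphic_on_prod holomorphic_on_diff holomorphic_on_const holomorphic_on_fA)
     (auto simp: lt_pairs_def)

text \<open>Besides 1 - u there are \<open>card V - 1\<close> factors containing u, all linear in u.
  Their leading coefficients are q \<eta>_i or q \<eta>_i - 1, depending on the place of u in f, and
  neither vanishes at good points.\<close>

lemma growth_inverse_denom:
  assumes p: "0 \<le> p" "p < 1" and V: "finite V" "n \<in> V" and good: "\<And>i. i \<in> V - {n} \<Longrightarrow> good p (\<eta> i)"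
  shows "growth (\<lambda>u. 1 / denom p V (\<eta>(n := u))) (- int (card V))"
proof -
  define W where "W = V - {n}"
  have W: "V = insert n W" "finite W" "n \<notin> W" "card V = Suc (card W)"
    using V by (auto simp: W_def card.remove[of V n] simp del: card_Diff_insert)
  define F where "F = (\<lambda>i u. if i < n then fA p (\<eta> i) u else fA p u (\<eta> i))"
  have eq: "1 / denom p V (\<eta>(n := u)) = 1 / (1 + (-1) * u) * ((\<Prod>i\<in>W. 1 / F i u) *
      (1 / ((\<Prod>i\<in>W. 1 - \<eta> i) * fprod p W \<eta>)))" for u
  proof -
    have "fprod p W (\<eta>(n := u)) = fprod p W \<eta>" by (rule fprod_cong) (use W in auto)
    moreover have "(\<Prod>i\<in>W. 1 - (\<eta>(n := u)) i) = (\<Prod>i\<in>W. 1 - \<eta> i)"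
      using W by (intro prod.cong) auto
    moreover have "(\<Prod>i\<in>W. if i < n then fA p ((\<eta>(n := u)) i) ((\<eta>(n := u)) n)
        else fA p ((\<eta>(n := u)) n) ((\<eta>(n := u)) i)) = (\<Prod>i\<in>W. F i u)"
      using W by (intro prod.cong) (auto simp: F_def)
    ultimately have "denom p V (\<eta>(n := u))
        = (1 - u) * (\<Prod>i\<in>W. 1 - \<eta> i) * ((\<Prod>i\<in>W. F i u) * fprod p W \<eta>)"
      using W unfolding denom_def by (simp add: fprod_insert)
    then show ?thesis by (simp add: prod_dividef)
  qed
  have "growth (\<lambda>u. 1 / F i u) (-1)" if "i \<in> W" for i
  proof -
    have g: "good p (\<eta> i)" using good that by (simp add: W_def)
    show ?thesis
    proof (cases "i < n")
      case True
      have "growth (\<lambda>u. 1 / ((of_real p - \<eta> i) + (of_real (1 - p) * \<eta> i) * u)) (-1)"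
        using good_nonzero[OF p g] p by (intro growth_inverse_linear) auto
      moreover have "F i u = (of_real p - \<eta> i) + (of_real (1 - p) * \<eta> i) * u" for u
        using True by (simp add: F_def fA_def algebra_simps)
      ultimately show ?thesis by simp
    next
      case False
      have "growth (\<lambda>u. 1 / (of_real p + (of_real (1 - p) * \<eta> i - 1) * u)) (-1)"
        using good_nonzero[OF p g] by (intro growth_inverse_linear) auto
      moreover have "F i u = of_real p + (of_real (1 - p) * \<eta> i - 1) * u" for u
        using False by (simp add: F_def fA_def algebra_simps)
      ultimately show ?thesis by simp
    qed
  qed
  then have "growth (\<lambda>u. \<Prod>i\<in>W. 1 / F i u) (\<Sum>i\<in>W. -1)"
    by (rule growth_prod)
  then have "growth (\<lambda>u. 1 / (1 + (-1) * u) * ((\<Prod>i\<in>W. 1 / F i u) *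
      (1 / ((\<Prod>i\<in>W. 1 - \<eta> i) * fprod p W \<eta>)))) (-1 + ((\<Sum>i\<in>W. -1) + 0))"
    by (intro growth_mult growth_const growth_inverse_linear) auto
  then show ?thesis unfolding eq using W by simp
qed

text \<open>The zero of \<open>f(\<cdot>, u)\<close>.\<close>

definition gA :: "real \<Rightarrow> complex \<Rightarrow> complex" where
  "gA p u = of_real p / (1 - of_real (1 - p) * u)"

text \<open>At the zero of f(., u) the other factors f(., w) become proportional to w - u. Hence the
  poles that a residue creates lie on diagonals, where antisymmetry applies.\<close>

lemma fA_gA:
  assumes "1 - of_real (1 - p) * u \<noteq> 0"
  shows "fA p (gA p u) w = of_real p * of_real (1 - p) * (w - u) / (1 - of_real (1 - p) * u)"
proof -
  have "fA p g w * d = of_real p * of_real (1 - p) * (w - u)"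
    if "g * d = of_real p" "d = 1 - of_real (1 - p) * u" for g d
  proof -
    have "fA p g w * d = of_real p * d + (of_real (1 - p) * w - 1) * (g * d)"
      by (simp add: fA_def algebra_simps)
    also have "\<dots> = of_real p * of_real (1 - p) * (w - u)"
      unfolding that(1) unfolding that(2) by (simp add: algebra_simps)
    finally show ?thesis .
  qed
  from this[of "gA p u" "1 - of_real (1 - p) * u"] show ?thesis
    using assms by (simp add: gA_def eq_divide_eq)
qed

lemma growth_gA: "p < 1 \<Longrightarrow> growth (gA p) (-1)"
proof -
  assume "p < 1"
  then have "growth (\<lambda>u. of_real p * (1 / (1 + (- of_real (1 - p)) * u))) (0 + -1)"
    by (intro growth_mult growth_const growth_inverse_linear) auto
  moreover have "gA p = (\<lambda>u. of_real p * (1 / (1 + (- of_real (1 - p)) * u)))"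
    by (simp add: gA_def fun_eq_iff algebra_simps)
  ultimately show ?thesis by simp
qed


section \<open>Degree of the numerator when one or two variables move to infinity or 0\<close>

lemma growth_cong:
  assumes "growth h d" "\<forall>\<^sub>F u in at_infinity. h u = k u"
  shows "growth k d"
proof -
  obtain C where C: "C \<ge> 0" "\<forall>\<^sub>F u in at_infinity. norm (h u) \<le> C * norm u powi d"
    using assms by (auto simp: growth_def)
  have "\<forall>\<^sub>F u in at_infinity. norm (k u) \<le> C * norm u powi d"
    using C(2) assms(2) by eventually_elim simp
  then show ?thesis using C unfolding growth_def by blast
qed

lemma growth_prod_list_sum:
  assumes "\<And>i. i \<in> set M \<Longrightarrow> growth (h i) (d i)"
  shows "growth (\<lambda>u. \<Prod>i\<leftarrow>M. h i u) (\<Sum>i\<leftarrow>M. d i)"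
  using assms
proof (induction M)
  case (Cons i M)
  then show ?case by (auto intro!: growth_mult)
qed (auto intro: growth_const)

lemma sum_list_of_bool:
  "distinct M \<Longrightarrow> (\<Sum>i\<leftarrow>M. of_bool (i = n) :: int) = of_bool (n \<in> set M)"
  by (induction M) auto

text \<open>Non-negative degrees ensure that the summands p and f(u) do not exceed the degree of the
  product term.\<close>

lemma growth_fA:
  assumes "growth f d" "growth g e" "d \<ge> 0" "e \<ge> 0"
  shows "growth (\<lambda>u. fA p (f u) (g u)) (d + e)"
proof -
  have "growth (\<lambda>u. of_real p + of_real (1 - p) * (f u * g u) - f u) (d + e)"
    using assms growth_mono[OF growth_const, of 0 "d + e"]
      growth_mult[OF growth_const[of "of_real (1 - p)"] growth_mult[OF assms(1,2)]]
      growth_mono[OF assms(1), of "d + e"]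
    by (intro growth_diff growth_add) (auto simp: growth_mono[OF growth_const])
  then show ?thesis by (simp add: fA_def mult.assoc)
qed

text \<open>The entry \<open>n\<close> meets each other entry once, so exactly
  \<open>length M - 1\<close> factors are of degree 1.\<close>

lemma growth_pairprod_diff:
  assumes "distinct M" "\<And>i. i \<in> set M \<Longrightarrow> growth (\<lambda>u. \<eta> u i) (of_bool (i = n))"
  shows "growth (\<lambda>u. pairprod (\<lambda>i j. \<eta> u j - \<eta> u i) M)
           (if n \<in> set M then int (length M) - 1 else 0)"
  using assms
proof (induction M)
  case Nil
  then show ?case using growth_const[of 1] by simp
next
  case (Cons a M)
  have "growth (\<lambda>u. \<eta> u j - \<eta> u a) (of_bool (a = n) + of_bool (j = n))" if "j \<in> set M" for j
    using that by (intro growth_diff growth_mono[OF Cons.prems(2)]) auto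
  then have "growth (\<lambda>u. \<Prod>j\<leftarrow>M. \<eta> u j - \<eta> u a) (\<Sum>j\<leftarrow>M. of_bool (a = n) + of_bool (j = n))"
    by (rule growth_prod_list_sum)
  then have "growth (\<lambda>u. \<Prod>j\<leftarrow>M. \<eta> u j - \<eta> u a)
      (int (length M) * of_bool (a = n) + of_bool (n \<in> set M))"
    using Cons.prems(1) by (simp add: sum_list_addf sum_list_of_bool sum_list_triv)
  from growth_mult[OF this Cons.IH] Cons.prems show ?case
    by (cases "a = n") (auto split: if_splits)
qed

text \<open>Models the situation after a residue: entry \<open>n\<close> is u, entry
  \<open>v\<close> is \<open>gA p u\<close> and thus of order 1 / u, and all others are
  bounded.\<close>

context
  fixes p :: real and v n :: nat and \<eta> :: "complex \<Rightarrow> nat \<Rightarrow> complex"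
  assumes gv: "growth (\<lambda>u. \<eta> u v) (-1)" and \<eta>n: "\<And>u. \<eta> u n = u" and vn: "v \<noteq> n"
    and gc: "\<And>i. i \<noteq> v \<Longrightarrow> i \<noteq> n \<Longrightarrow> growth (\<lambda>u. \<eta> u i) 0"
begin

lemma growth_entry: "growth (\<lambda>u. \<eta> u i) (of_bool (i = n))"
  using growth_id gc[of i] growth_mono[OF gv, of 0] \<eta>n by (cases "i = n"; cases "i = v") auto

lemma growth_entry_signed: "growth (\<lambda>u. \<eta> u i) (of_bool (i = n) - of_bool (i = v))"
  using growth_id gc[of i] gv \<eta>n vn by (cases "i = n"; cases "i = v") auto

lemma growth_factor: "growth (\<lambda>u. 1 - \<eta> u i) (of_bool (i = n))"
  using growth_entry[of i]
  by (intro growth_diff) (auto intro: growth_mono[OF growth_const])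

lemma growth_fA_row:
  assumes "distinct M"
  shows "growth (\<lambda>u. \<Prod>j\<leftarrow>M. fA p (\<eta> u i) (\<eta> u j))
     (int (length M) * of_bool (i = n) + of_bool (n \<in> set M))"
proof -
  have "growth (\<lambda>u. \<Prod>j\<leftarrow>M. fA p (\<eta> u i) (\<eta> u j)) (\<Sum>j\<leftarrow>M. of_bool (i = n) + of_bool (j = n))"
    by (intro growth_prod_list_sum growth_fA growth_entry) auto
  then show ?thesis
    using assms by (simp add: sum_list_addf sum_list_of_bool sum_list_triv)
qed

text \<open>For \<open>x \<ge> 0\<close> an upper bound on an entry passes to its power, so that the
  decay of entry \<open>v\<close> is exploited.\<close>

lemma growth_monomials:
  assumes "distinct M" "x \<ge> 0"
  shows "growth (\<lambda>u. \<Prod>i\<leftarrow>M. \<eta> u i powi x) (x * (of_bool (n \<in> set M) - of_bool (v \<in> set M)))"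
proof -
  have "growth (\<lambda>u. \<Prod>i\<leftarrow>M. \<eta> u i powi x) (\<Sum>i\<leftarrow>M. x * (of_bool (i = n) - of_bool (i = v)))"
    using assms by (intro growth_prod_list_sum growth_power_int growth_entry_signed) auto
  then show ?thesis
    using assms by (simp add: sum_list_const_mult sum_list_subtractf sum_list_of_bool)
qed

text \<open>Wherever \<open>v\<close> stands, its exponent is at least \<open>hd xs\<close>, because
  \<open>xs\<close> increases, and its entry is O(1 / u).\<close>

lemma growth_bethe_without:
  assumes "distinct M" "n \<notin> set M" "sorted_wrt (<) xs" "\<And>x. x \<in> set xs \<Longrightarrow> x \<ge> 0" "xs \<noteq> []"
  shows "growth (\<lambda>u. bethe p xs (map (\<eta> u) M)) (if v \<in> set M then - hd xs else 0)"
  using assms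
proof (induction xs arbitrary: M)
  case (Cons x xs)
  have m1: "growth (\<lambda>u. \<Prod>i\<leftarrow>M. \<eta> u i) 0"
    using growth_mono[OF growth_monomials[of M 1], of 0] Cons.prems by simp
  show ?case
  proof (cases xs)
    case Nil
    have "growth (\<lambda>u. (1 - (\<Prod>i\<leftarrow>M. \<eta> u i)) * pairprod (\<lambda>i j. \<eta> u j - \<eta> u i) M
        * (\<Prod>i\<leftarrow>M. \<eta> u i powi x)) (0 + 0 + (x * (of_bool (n \<in> set M) - of_bool (v \<in> set M))))"
      using Cons.prems growth_pairprod_diff[of M \<eta> n, OF _ growth_entry]
      by (intro growth_mult growth_diff growth_const m1 growth_monomials) auto
    then show ?thesis using Cons.prems
      by (cases "v \<in> set M") (simp_all add: Nil pairprod_map comp_def)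
  next
    case xs: (Cons x' xs')
    show ?thesis
    proof (cases M)
      case Nil
      then show ?thesis by (simp add: xs growth_zero)
    next
      case M: (Cons i M')
      have px: "growth (\<lambda>u. \<eta> u i powi x) (x * (- of_bool (i = v)))"
        using growth_power_int[OF growth_entry_signed[of i], of x] Cons.prems M by auto
      have "growth (\<lambda>u. (1 - \<eta> u i) * \<eta> u i powi x * (\<Prod>w\<leftarrow>M'. fA p (\<eta> u i) (\<eta> u w))
          * bethe p xs (map (\<eta> u) M')) (0 + x * (- of_bool (i = v)) + 0 + (if v \<in> set M' then - hd xs else 0))"
        using growth_factor[of i] growth_fA_row[of M' i] Cons.prems
        by (intro growth_mult px Cons.IH) (auto simp: M xs)
      then have "growth (\<lambda>u. bethe p (x # xs) (map (\<eta> u) M))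
          (x * (- of_bool (i = v)) + (if v \<in> set M' then - hd xs else 0))"
        by (simp add: xs M comp_def)
      then show ?thesis
        by (rule growth_mono) (use Cons.prems M xs in \<open>auto simp: vn\<close>)
    qed
  qed
qed simp

text \<open>Induction on the slots of \<Lambda>. A leading \<open>v\<close> meets \<open>n\<close>
  later, in the vanishing factor f(\<eta>_v, u). A leading \<open>n\<close> has degree
  \<open>1 + x + length M'\<close>, but the rest decays with the next exponent, which is at least
  \<open>x + 1\<close>. Any other head adds just one factor of degree 1. In the last block the
  powers of the entries \<open>n\<close> and \<open>v\<close> cancel, and the Vandermonde factor has
  degree \<open>length M - 1\<close>.\<close>

lemma growth_bethe_pair:
  assumes "distinct M" "n \<in> set M" "v \<in> set M" "sorted_wrt (<) xs" "\<And>x. x \<in> set xs \<Longrightarrow> x \<ge> 0" "xs \<noteq> []"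
    and zero: "\<forall>\<^sub>F u in at_infinity. fA p (\<eta> u v) u = 0"
  shows "growth (\<lambda>u. bethe p xs (map (\<eta> u) M)) (int (length M) - 1)"
  using assms(1-6)
proof (induction xs arbitrary: M)
  case (Cons x xs)
  show ?case
  proof (cases xs)
    case Nil
    have m1: "growth (\<lambda>u. \<Prod>i\<leftarrow>M. \<eta> u i) 0"
      using growth_monomials[of M 1] Cons.prems by auto
    have "growth (\<lambda>u. (1 - (\<Prod>i\<leftarrow>M. \<eta> u i)) * pairprod (\<lambda>i j. \<eta> u j - \<eta> u i) M
        * (\<Prod>i\<leftarrow>M. \<eta> u i powi x)) (0 + (int (length M) - 1) + (x * (of_bool (n \<in> set M) - of_bool (v \<in> set M))))"
      using Cons.prems growth_pairprod_diff[of M \<eta> n, OF _ growth_entry]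
      by (intro growth_mult growth_diff growth_const m1 growth_monomials) auto
    then show ?thesis using Cons.prems by (simp add: Nil pairprod_map comp_def)
  next
    case xs: (Cons x' xs')
    obtain i M' where M: "M = i # M'" using Cons.prems by (cases M) auto
    have d: "distinct M'" "i \<notin> set M'" using Cons.prems M by auto
    have eq: "bethe p (x # xs) (map (\<eta> u) M) = (1 - \<eta> u i) * \<eta> u i powi x
        * (\<Prod>w\<leftarrow>M'. fA p (\<eta> u i) (\<eta> u w)) * bethe p xs (map (\<eta> u) M')" for u
      by (simp add: xs M comp_def)
    consider "i = v" | "i = n" | "i \<noteq> v" "i \<noteq> n" by blast
    then show ?thesis
    proof cases
      case 1
      have "\<forall>\<^sub>F u in at_infinity. 0 = bethe p (x # xs) (map (\<eta> u) M)"
        using zero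
      proof eventually_elim
        case (elim u)
        have "n \<in> set M'" using 1 M Cons.prems vn by auto
        then have "(\<Prod>w\<leftarrow>M'. fA p (\<eta> u v) (\<eta> u w)) = 0"
          using elim \<eta>n by (auto simp: prod_list_zero_iff image_iff intro!: bexI[of _ n])
        then show ?case unfolding eq using 1 by simp
      qed
      then show ?thesis by (rule growth_cong[OF growth_zero])
    next
      case 2
      have px: "growth (\<lambda>u. \<eta> u i powi x) x"
        using growth_powi[of x] 2 \<eta>n by simp
      have "growth (\<lambda>u. (1 - \<eta> u i) * \<eta> u i powi x * (\<Prod>w\<leftarrow>M'. fA p (\<eta> u i) (\<eta> u w))
          * bethe p xs (map (\<eta> u) M')) (1 + x + int (length M') + (- hd xs))"
        using growth_factor[of i] growth_fA_row[of M' i] growth_bethe_without[of M' xs] Cons.prems 2 d vn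
        by (intro growth_mult px) (auto simp: M xs)
      then show ?thesis unfolding eq
        by (rule growth_mono) (use Cons.prems M xs in auto)
    next
      case 3
      have px: "growth (\<lambda>u. \<eta> u i powi x) 0"
        using growth_power_int[OF growth_entry[of i], of x] Cons.prems 3 by auto
      have "growth (\<lambda>u. (1 - \<eta> u i) * \<eta> u i powi x * (\<Prod>w\<leftarrow>M'. fA p (\<eta> u i) (\<eta> u w))
          * bethe p xs (map (\<eta> u) M')) (0 + 0 + 1 + (int (length M') - 1))"
        using growth_factor[of i] growth_fA_row[of M' i] Cons.prems 3 d
        by (intro growth_mult px Cons.IH) (auto simp: M xs)
      then show ?thesis unfolding eq
        by (rule growth_mono) (use M in auto)
    qed
  qed
qed simp

end

text \<open>Restricted to a leading \<open>n\<close> or to an empty \<Lambda>, since in any other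
  place \<open>n\<close> may carry a different exponent of the list.\<close>

lemma growth_bethe_single:
  assumes "distinct M" "n \<in> set M" "xs = [] \<or> hd M = n"
  shows "growth (\<lambda>u. bethe p (x # xs) (map (\<eta>(n := u)) M)) (int (length M) + x)"
proof -
  have e: "growth (\<lambda>u. (\<eta>(n := u)) i) (of_bool (i = n))" for i
    using growth_id growth_const[of "\<eta> i"] by (cases "i = n") auto
  have px: "growth (\<lambda>u. (\<eta>(n := u)) i powi x) (x * of_bool (i = n))" for i
    using growth_powi[of x] growth_const[of "\<eta> i powi x"] by (cases "i = n") auto
  have f1: "growth (\<lambda>u. 1 - (\<eta>(n := u)) i) (of_bool (i = n))" for i
    using e[of i] by (intro growth_diff) (auto intro: growth_mono[OF growth_const])
  show ?thesis
  proof (cases xs)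
    case Nil
    have "growth (\<lambda>u. \<Prod>i\<leftarrow>M. (\<eta>(n := u)) i) (\<Sum>i\<leftarrow>M. of_bool (i = n))"
      by (intro growth_prod_list_sum e)
    then have "growth (\<lambda>u. 1 - (\<Prod>i\<leftarrow>M. (\<eta>(n := u)) i)) 1"
      using assms by (intro growth_diff) (auto intro: growth_mono[OF growth_const] simp: sum_list_of_bool)
    moreover have "growth (\<lambda>u. \<Prod>i\<leftarrow>M. (\<eta>(n := u)) i powi x) (\<Sum>i\<leftarrow>M. x * of_bool (i = n))"
      by (intro growth_prod_list_sum px)
    ultimately have "growth (\<lambda>u. (1 - (\<Prod>i\<leftarrow>M. (\<eta>(n := u)) i)) * pairprod (\<lambda>i j. (\<eta>(n := u)) j - (\<eta>(n := u)) i) M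
        * (\<Prod>i\<leftarrow>M. (\<eta>(n := u)) i powi x)) (1 + (int (length M) - 1) + x)"
      using assms growth_pairprod_diff[of M "\<lambda>u. \<eta>(n := u)" n, OF _ e]
      by (intro growth_mult) (auto simp: sum_list_const_mult sum_list_of_bool)
    moreover have "1 + (int (length M) - 1) + x = int (length M) + x" by simp
    ultimately show ?thesis
      by (simp only: Nil bethe.simps pairprod_map map_map comp_def)
  next
    case xs: (Cons x' xs')
    obtain M' where M: "M = n # M'" using assms xs by (cases M) auto
    have m: "map (\<eta>(n := u)) M' = map \<eta> M'" for u
      using assms(1) M by auto
    have "growth (\<lambda>u. \<Prod>w\<leftarrow>M'. fA p u (\<eta> w)) (int (length M') * (1 + 0))"
      by (intro growth_prod_list growth_fA growth_id growth_const) auto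
    then have "growth (\<lambda>u. (1 - u) * u powi x * (\<Prod>w\<leftarrow>M'. fA p u (\<eta> w)) * bethe p xs (map \<eta> M'))
        (1 + x + int (length M') + 0)"
      using f1[of n] growth_powi[of x]
      by (intro growth_mult growth_const) auto
    moreover have "bethe p (x # xs) (map (\<eta>(n := u)) M) = (1 - u) * u powi x
        * (\<Prod>w\<leftarrow>M'. fA p u (\<eta> w)) * bethe p xs (map \<eta> M')" for u
      by (simp add: xs M m comp_def)
    moreover have "1 + x + int (length M') + 0 = int (length M) + x" by (simp add: M)
    ultimately show ?thesis by (simp only:)
  qed
qed


section \<open>The initial condition\<close>

definition scal :: "(nat \<Rightarrow> real) \<Rightarrow> (nat \<Rightarrow> complex) \<Rightarrow> nat \<Rightarrow> complex" where
  "scal r \<xi> = (\<lambda>i. of_real (r i) * \<xi> i)"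

text \<open>The exponent is \<open>- y i\<close> because the normalised mean absorbs one factor
  \<xi>_i of the contour integral.\<close>

definition bterm :: "real \<Rightarrow> int list \<Rightarrow> (nat \<Rightarrow> int) \<Rightarrow> nat list \<Rightarrow> (nat \<Rightarrow> complex) \<Rightarrow> complex" where
  "bterm p xs y M \<eta> = bethe p xs (map \<eta> M) * (\<Prod>i\<in>set M. \<eta> i powi (- y i)) / denom p (set M) \<eta>"

definition bsum :: "real \<Rightarrow> int list \<Rightarrow> (nat \<Rightarrow> int) \<Rightarrow> nat set \<Rightarrow> (nat \<Rightarrow> complex) \<Rightarrow> complex" where
  "bsum p xs y V \<eta> = bethe_sum p xs V \<eta> * (\<Prod>i\<in>V. \<eta> i powi (- y i)) / denom p V \<eta>"

lemma bsum_eq_sum_bterm: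
  "bsum p xs y V \<eta> = (\<Sum>M\<in>permutations_of_set V. pairprod isgn M * bterm p xs y M \<eta>)"
  unfolding bsum_def bterm_def bethe_sum_def sum_distrib_right sum_divide_distrib
  by (intro sum.cong) (auto simp: permutations_of_set_def)

lemma bsum_short: "card V < length xs \<Longrightarrow> bsum p xs y V \<eta> = 0"
  by (simp add: bsum_def bethe_sum_short)

text \<open>Translation invariance of the lattice, used to normalise the position of the first
  particle.\<close>

lemma bsum_shift:
  assumes "\<And>i. i \<in> V \<Longrightarrow> \<eta> i \<noteq> 0"
  shows "bsum p (map (\<lambda>x. x + c) xs) (\<lambda>i. y i + c) V \<eta> = bsum p xs y V \<eta>"
proof -
  have "bethe_sum p (map (\<lambda>x. x + c) xs) V \<eta> = bethe_sum p xs V \<eta> * (\<Prod>i\<in>V. \<eta> i powi c)"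
    unfolding bethe_sum_def sum_distrib_right
  proof (rule sum.cong)
    fix M assume M: "M \<in> permutations_of_set V"
    then have "set M = V" "distinct M" by (auto simp: permutations_of_set_def)
    then have "(\<Prod>z\<leftarrow>map \<eta> M. z powi c) = (\<Prod>i\<in>V. \<eta> i powi c)"
      using prod.distinct_set_conv_list[of M "\<lambda>i. \<eta> i powi c"] by (simp add: comp_def)
    then show "pairprod isgn M * bethe p (map (\<lambda>x. x + c) xs) (map \<eta> M)
       = pairprod isgn M * bethe p xs (map \<eta> M) * (\<Prod>i\<in>V. \<eta> i powi c)"
      using assms \<open>set M = V\<close> by (subst bethe_shift) auto
  qed simp
  moreover have "(\<Prod>i\<in>V. \<eta> i powi c) * (\<Prod>i\<in>V. \<eta> i powi (- (y i + c))) = (\<Prod>i\<in>V. \<eta> i powi (- y i))"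
    unfolding prod.distrib[symmetric] using assms
    by (intro prod.cong) (auto simp flip: power_int_add)
  ultimately show ?thesis by (simp add: bsum_def mult.assoc)
qed

lemma av_scal: "av n (\<lambda>\<xi>. G (scal r \<xi>)) \<xi> = circ_mean (r n) (\<lambda>z. G ((scal r \<xi>)(n := z)))"
proof -
  have "scal r (\<xi>(n := z)) = (scal r \<xi>)(n := of_real (r n) * z)" for z
    by (auto simp: scal_def)
  then show ?thesis by (simp add: av_def circ_mean_def)
qed

lemma good_scal:
  assumes "r i > 4 / (1 - p)" "\<xi> \<in> torus" "0 \<le> p" "p < 1"
  shows "good p (scal r \<xi> i)"
proof -
  have "0 \<le> 4 / (1 - p)" using assms by simp
  then have "r i > 0" using assms(1) by linarith
  then show ?thesis using assms by (simp add: good_def scal_def norm_mult torus_def)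
qed

lemma norm_scal: "\<xi> \<in> torus \<Longrightarrow> r i > 0 \<Longrightarrow> norm (scal r \<xi> i) = r i"
  by (simp add: scal_def norm_mult torus_def)

lemma continuous_on_scal: "continuous_on S (\<lambda>\<xi>. scal r \<xi> i)"
  unfolding scal_def by (intro continuous_on_mult continuous_on_const continuous_on_coordinate continuous_on_id)

lemma continuous_on_bterm:
  fixes \<eta> :: "'a::topological_space \<Rightarrow> nat \<Rightarrow> complex"
  assumes "continuous_on A P" "\<And>i. i \<in> set M \<Longrightarrow> continuous_on A (\<lambda>x. \<eta> x i)"
    "\<And>i x. i \<in> set M \<Longrightarrow> x \<in> A \<Longrightarrow> good (P x) (\<eta> x i)" "\<And>x. x \<in> A \<Longrightarrow> 0 \<le> P x \<and> P x < 1"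
  shows "continuous_on A (\<lambda>x. bterm (P x) xs y M (\<eta> x))"
proof -
  have "\<eta> x i \<noteq> 0" if "i \<in> set M" "x \<in> A" for i x
    using good_nonzero(1)[of "P x" "\<eta> x i"] assms(3)[OF that] assms(4)[OF that(2)] by simp
  then show ?thesis
    unfolding bterm_def using assms
    by (intro continuous_on_divide continuous_on_mult continuous_on_bethe continuous_on_denom
        continuous_on_prod continuous_on_power_int) (auto simp: denom_nonzero)
qed

lemma continuous_on_bsum:
  fixes \<eta> :: "'a::topological_space \<Rightarrow> nat \<Rightarrow> complex"
  assumes "continuous_on A P" "\<And>i. i \<in> V \<Longrightarrow> continuous_on A (\<lambda>x. \<eta> x i)"
    "\<And>i x. i \<in> V \<Longrightarrow> x \<in> A \<Longrightarrow> good (P x) (\<eta> x i)" "\<And>x. x \<in> A \<Longrightarrow> 0 \<le> P x \<and> P x < 1"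
  shows "continuous_on A (\<lambda>x. bsum (P x) xs y V (\<eta> x))"
  unfolding bsum_eq_sum_bterm using assms
  by (intro continuous_on_sum continuous_on_mult continuous_on_const continuous_on_bterm)
     (auto simp: permutations_of_set_def)

lemma torus_mean_eq_0:
  assumes "continuous_on torus F" "n \<in> set ls" "\<And>\<xi>. \<xi> \<in> torus \<Longrightarrow> av n F \<xi> = 0"
  shows "torus_mean ls F = 0"
proof -
  have "torus_mean ls F = torus_mean ls (av n F)"
    using torus_mean_av[OF assms(1,2)] by simp
  also have "\<dots> = torus_mean ls (\<lambda>_. 0)"
    by (rule torus_mean_cong) (use assms in auto)
  finally show ?thesis by simp
qed

text \<open>In \<xi>_n the numerator has degree \<open>length M + x\<close>, the monomial
  \<open>- y n\<close> and the inverse denominator \<open>- length M\<close>. The sum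
  \<open>x - y n\<close> is at most -1, and there are no poles outside the contour.\<close>

lemma torus_mean_bterm_eq_0:
  assumes p: "0 \<le> p" "p < 1" and r: "\<And>i. r i > 4 / (1 - p)"
    and M: "distinct M" "n \<in> set M" "xs = [] \<or> hd M = n" and y: "x < y n" and n: "n \<in> set ls"
  shows "torus_mean ls (\<lambda>\<xi>. bterm p (x # xs) y M (scal r \<xi>)) = 0"
proof (rule torus_mean_eq_0[OF _ n])
  show "continuous_on torus (\<lambda>\<xi>. bterm p (x # xs) y M (scal r \<xi>))"
    using p r by (intro continuous_on_bterm continuous_on_const continuous_on_scal good_scal) auto
  fix \<xi> assume \<xi>: "\<xi> \<in> torus"
  define \<eta> where "\<eta> = scal r \<xi>"
  have good: "good p (\<eta> i)" for i unfolding \<eta>_def by (rule good_scal[OF r \<xi> p])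
  have s: "0 < 4 / (1 - p)" using p by simp
  define W where "W = set M - {n}"
  have W: "set M = insert n W" "n \<notin> W" "finite W" using M(2) by (auto simp: W_def)
  have gu: "good p ((\<eta>(n := u)) i)" if "norm u > 4 / (1 - p)" for u i
    using that good by (auto simp: good_def)
  have dn: "denom p (set M) (\<eta>(n := u)) \<noteq> 0" if "norm u > 4 / (1 - p)" for u
    by (rule denom_nonzero[OF p _ gu[OF that]]) simp
  have "circ_mean (r n) (\<lambda>u. bterm p (x # xs) y M (\<eta>(n := u))) = 0"
  proof (rule circ_mean_at_infinity[OF _ s r])
    have hi: "(\<lambda>u. (\<eta>(n := u)) i) holomorphic_on {u. norm u > 4 / (1 - p)}" for i
      by (cases "i = n") auto
    show "(\<lambda>u. bterm p (x # xs) y M (\<eta>(n := u))) holomorphic_on {u. norm u > 4 / (1 - p)}"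
      unfolding bterm_def
      using good_nonzero(1)[OF p gu] dn
      by (intro holomorphic_on_divide holomorphic_on_mult holomorphic_on_bethe
          holomorphic_on_denom holomorphic_on_prod holomorphic_on_power_int hi) auto
    have pr: "(\<Prod>i\<in>set M. (\<eta>(n := u)) i powi (- y i)) = u powi (- y n) * (\<Prod>i\<in>W. \<eta> i powi (- y i))" for u
      unfolding W(1) using W(2,3) by (simp add: prod.insert) (intro disjI2 prod.cong, auto)
    have "growth (\<lambda>u. bethe p (x # xs) (map (\<eta>(n := u)) M)
        * (u powi (- y n) * (\<Prod>i\<in>W. \<eta> i powi (- y i))) * (1 / denom p (set M) (\<eta>(n := u))))
        ((int (length M) + x) + (- y n + 0) + (- int (card (set M))))"
      using M p good
      by (intro growth_mult growth_bethe_single growth_powi growth_const growth_inverse_denom) auto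
    then have "growth (\<lambda>u. bterm p (x # xs) y M (\<eta>(n := u)))
        ((int (length M) + x) + (- y n + 0) + (- int (card (set M))))"
      unfolding bterm_def pr by simp
    then have "growth (\<lambda>u. bterm p (x # xs) y M (\<eta>(n := u))) (-1)"
      by (rule growth_mono) (use y distinct_card[OF M(1)] in auto)
    then show "((\<lambda>u. bterm p (x # xs) y M (\<eta>(n := u))) \<longlongrightarrow> 0) at_infinity"
      by (rule growth_tendsto_0)
  qed
  then show "av n (\<lambda>\<xi>. bterm p (x # xs) y M (scal r \<xi>)) \<xi> = 0"
    by (simp add: av_scal \<eta>_def)
qed

text \<open>The residue at \<open>\<xi>\<^sub>v = p / (1 - q \<xi>\<^sub>n)\<close> of the integrand belonging to \<open>insert v V\<close>.\<close>

definition pole_term :: "real \<Rightarrow> int list \<Rightarrow> (nat \<Rightarrow> int) \<Rightarrow> nat \<Rightarrow> nat set \<Rightarrow> nat \<Rightarrow> (nat \<Rightarrow> complex) \<Rightarrow> complex" where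
  "pole_term p xs y v V n \<eta> =
     - (\<Prod>i\<in>V. \<eta> i powi (- y i)) / (denom p V \<eta> * (\<Prod>i\<in>V. of_real (1 - p) * \<eta> i - 1))
       * (bethe_sum p xs (insert v V) (\<eta>(v := gA p (\<eta> n)))
          / ((gA p (\<eta> n) - 1) * (\<Prod>j\<in>V - {n}. gA p (\<eta> n) - gA p (\<eta> j))))"

lemma gA_inj:
  assumes p: "0 < p" "p < 1" and g: "good p z" "good p w" and eq: "gA p z = gA p w"
  shows "z = w"
proof -
  have "1 - of_real (1 - p) * z \<noteq> 0" "1 - of_real (1 - p) * w \<noteq> 0"
    using good_nonzero[of p] p g by auto
  then have "complex_of_real p * (1 - of_real (1 - p) * w) = of_real p * (1 - of_real (1 - p) * z)"
    using eq by (auto simp: gA_def frac_eq_eq simp del: of_real_diff)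
  then show ?thesis using p by (auto simp del: of_real_diff)
qed

lemma gA_factor:
  assumes "0 < p" "p < 1" "good p z"
  shows "fA p w z = (of_real (1 - p) * z - 1) * (w - gA p z)"
  using good_nonzero[of p z] assms by (simp add: fA_def gA_def field_simps)

text \<open>The zeros of f(., z) lie in the unit disc, hence inside every contour, and apart from
  the pole at 1. That they differ from 0 uses \<open>p > 0\<close>.\<close>

lemma gA_bounds:
  assumes p: "0 < p" "p < 1" and g: "good p z"
  shows "gA p z \<noteq> 0" "norm (gA p z) < 1" "gA p z \<noteq> 1"
proof -
  have n: "norm (1 - of_real (1 - p) * z) > 3"
    using good_norm(2)[of p z] p g norm_triangle_ineq2[of "of_real (1 - p) * z" 1]
    by (simp add: norm_minus_commute del: of_real_diff)
  then show "gA p z \<noteq> 0" using p by (auto simp: gA_def)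
  have "norm (gA p z) = p / norm (1 - of_real (1 - p) * z)"
    using p by (simp add: gA_def norm_divide del: of_real_diff)
  also have "\<dots> < 1" using n p by (simp add: divide_less_eq del: of_real_diff)
  finally show "norm (gA p z) < 1" .
  then show "gA p z \<noteq> 1" by auto
qed

lemma continuous_on_gA:
  assumes "continuous_on A f" "\<And>x. x \<in> A \<Longrightarrow> good p (f x)" "0 \<le> p" "p < 1"
  shows "continuous_on A (\<lambda>x. gA p (f x))"
  unfolding gA_def using good_nonzero(4)[OF assms(3,4,2)]
  by (intro continuous_intros assms) auto

lemma holomorphic_on_gA:
  assumes "f holomorphic_on A" "\<And>x. x \<in> A \<Longrightarrow> good p (f x)" "0 \<le> p" "p < 1"
  shows "(\<lambda>x. gA p (f x)) holomorphic_on A"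
  unfolding gA_def using good_nonzero(4)[OF assms(3,4,2)]
  by (intro holomorphic_intros assms) auto


text \<open>Distinct radii keep the \<xi>_i, and by \<open>gA_inj\<close> also the poles
  \<open>gA p \<xi>_i\<close>, distinct at every point of the torus. Non-negative exponents are what
  the degree counts need for the shrinking entry.\<close>

context
  fixes p :: real and r :: "nat \<Rightarrow> real" and V :: "nat set" and v :: nat and xs :: "int list"
    and y :: "nat \<Rightarrow> int"
  assumes p: "0 < p" "p < 1" and r: "\<And>i. r i > 4 / (1 - p)"
    and V: "finite V" "v \<notin> V" and inj: "inj_on r V"
    and xs: "sorted_wrt (<) xs" "\<And>x. x \<in> set xs \<Longrightarrow> x \<ge> 0" "xs \<noteq> []"
begin

lemma radius_pos: "r i > 0"
proof -
  have "0 \<le> 4 / (1 - p)" using p by simp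
  then show ?thesis using r[of i] by linarith
qed

lemma p': "0 \<le> p" "p < 1" using p by auto

lemma scal_good: "\<xi> \<in> torus \<Longrightarrow> good p (scal r \<xi> i)"
  by (rule good_scal[OF r _ p'])

lemma scal_inj:
  assumes "\<xi> \<in> torus"
  shows "inj_on (scal r \<xi>) V"
proof (rule inj_onI)
  fix i j assume ij: "i \<in> V" "j \<in> V" "scal r \<xi> i = scal r \<xi> j"
  then have "norm (scal r \<xi> i) = norm (scal r \<xi> j)" by simp
  then have "r i = r j" by (simp add: norm_scal[OF assms radius_pos])
  then show "i = j" by (rule inj_onD[OF inj _ ij(1,2)])
qed

lemma gA_prod_nonzero:
  assumes "\<xi> \<in> torus" "n \<in> V"
  shows "(\<Prod>j\<in>V - {n}. gA p (scal r \<xi> n) - gA p (scal r \<xi> j)) \<noteq> 0"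
proof -
  have "gA p (scal r \<xi> n) \<noteq> gA p (scal r \<xi> j)" if "j \<in> V - {n}" for j
  proof
    assume "gA p (scal r \<xi> n) = gA p (scal r \<xi> j)"
    then have "scal r \<xi> n = scal r \<xi> j"
      by (rule gA_inj[OF p scal_good[OF assms(1)] scal_good[OF assms(1)]])
    then have "n = j" by (rule inj_onD[OF scal_inj[OF assms(1)]]) (use assms that in auto)
    then show False using that by simp
  qed
  then show ?thesis using V by (subst prod_zero_iff) auto
qed

lemma continuous_on_pole_term:
  assumes "n \<in> V"
  shows "continuous_on torus (\<lambda>\<xi>. pole_term p xs y v V n (scal r \<xi>))"
proof -
  have g: "continuous_on torus (\<lambda>\<xi>. gA p (scal r \<xi> i))" for i
    by (intro continuous_on_gA continuous_on_scal scal_good p')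
  have e: "continuous_on torus (\<lambda>\<xi>. ((scal r \<xi>)(v := gA p (scal r \<xi> n))) i)" for i
    using g[of n] continuous_on_scal[of torus r i] by (cases "i = v") auto
  have nz: "scal r \<xi> i \<noteq> 0" "gA p (scal r \<xi> i) \<noteq> 0" "gA p (scal r \<xi> i) - 1 \<noteq> 0"
      "of_real (1 - p) * scal r \<xi> i - 1 \<noteq> 0" if "\<xi> \<in> torus" for \<xi> i
    using good_nonzero[OF p' scal_good[OF that]] gA_bounds[OF p scal_good[OF that]] by auto
  have nz2: "(\<Prod>i\<in>V. of_real (1 - p) * scal r \<xi> i - 1) \<noteq> 0" if "\<xi> \<in> torus" for \<xi>
    using nz(4)[OF that] V(1) by (subst prod_zero_iff) auto
  have dn: "denom p V (scal r \<xi>) \<noteq> 0" if "\<xi> \<in> torus" for \<xi>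
    by (rule denom_nonzero[OF p' V(1) scal_good[OF that]])
  have nz3: "((scal r \<xi>)(v := gA p (scal r \<xi> n))) i \<noteq> 0" if "\<xi> \<in> torus" for \<xi> i
    using nz[OF that] by simp
  show ?thesis
    unfolding pole_term_def using nz(1,3) nz2 dn gA_prod_nonzero[OF _ assms] nz3
    by (intro continuous_on_divide continuous_on_mult continuous_on_minus continuous_on_denom
        continuous_on_prod continuous_on_power_int continuous_on_diff continuous_on_const
        continuous_on_bethe_sum g e continuous_on_scal) auto
qed

lemma growth_bethe_sum_pole:
  assumes "n \<in> V"
  shows "growth (\<lambda>u. bethe_sum p xs (insert v V) (\<eta>(n := u, v := gA p u))) (int (card V))"
  unfolding bethe_sum_def
proof (rule growth_sum)
  fix M assume M: "M \<in> permutations_of_set (insert v V)"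
  have vn: "v \<noteq> n" using V assms by auto
  have len: "length M = Suc (card V)"
    using length_finite_permutations_of_set[OF M] V by simp
  have "growth (\<lambda>u. bethe p xs (map (\<eta>(n := u, v := gA p u)) M)) (int (length M) - 1)"
  proof (rule growth_bethe_pair[of _ v n])
    show "growth (\<lambda>u. (\<eta>(n := u, v := gA p u)) v) (-1)"
      using growth_gA[OF p(2)] by simp
    show "growth (\<lambda>u. (\<eta>(n := u, v := gA p u)) i) 0" if "i \<noteq> v" "i \<noteq> n" for i
      using that by (simp add: growth_const)
    show "\<forall>\<^sub>F u in at_infinity. fA p ((\<eta>(n := u, v := gA p u)) v) u = 0"
      using eventually_norm_ge_at_infinity[of "4 / (1 - p) + 1"]
    proof eventually_elim
      case (elim u)
      then have "good p u" by (simp add: good_def)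
      from good_nonzero(4)[OF p' this] show ?case by (simp add: fA_gA del: of_real_diff)
    qed
  qed (use M xs vn assms in \<open>auto simp: permutations_of_set_def\<close>)
  then have "growth (\<lambda>u. pairprod isgn M * bethe p xs (map (\<eta>(n := u, v := gA p u)) M))
      (0 + (int (length M) - 1))"
    by (intro growth_mult growth_const)
  then show "growth (\<lambda>u. pairprod isgn M * bethe p xs (map (\<eta>(n := u, v := gA p u)) M)) (int (card V))"
    by (simp add: len)
qed

text \<open>Bounded because \<open>gA p u\<close> tends to 0 and so stays away from 1.\<close>

lemma growth_inverse_gA: "growth (\<lambda>u. 1 / (gA p u - 1)) 0"
proof -
  have "growth (\<lambda>u. (1 - of_real (1 - p) * u) * (1 / (of_real (p - 1) + of_real (1 - p) * u))) (1 + -1)"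
    using p growth_mult[OF growth_const[of "of_real (1 - p)"] growth_id]
    by (intro growth_mult growth_diff growth_inverse_linear) (auto intro: growth_mono[OF growth_const])
  then have "growth (\<lambda>u. (1 - of_real (1 - p) * u) * (1 / (of_real (p - 1) + of_real (1 - p) * u))) 0"
    by simp
  then show ?thesis
  proof (rule growth_cong)
    show "\<forall>\<^sub>F u in at_infinity. (1 - of_real (1 - p) * u) * (1 / (of_real (p - 1) + of_real (1 - p) * u))
        = 1 / (gA p u - 1)"
      using eventually_norm_ge_at_infinity[of "4 / (1 - p) + 1"]
    proof eventually_elim
      case (elim u)
      then have "good p u" by (simp add: good_def)
      from good_nonzero(4)[OF p' this]
      have "gA p u - 1 = (of_real (p - 1) + of_real (1 - p) * u) / (1 - of_real (1 - p) * u)"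
        by (simp add: gA_def divide_simps) (simp add: algebra_simps)?
      then show ?case by simp
    qed
  qed
qed

text \<open>The contour of \<xi>_n is moved to infinity: the apparent poles at the other \<xi>_j
  cancel, and the integrand decays.\<close>

lemma torus_mean_pole_term:
  assumes n: "n \<in> V" "n \<in> set ls" and yn: "y n \<ge> 0"
  shows "torus_mean ls (\<lambda>\<xi>. pole_term p xs y v V n (scal r \<xi>)) = 0"
proof (rule torus_mean_eq_0[OF continuous_on_pole_term[OF n(1)] n(2)])
  fix \<xi> assume \<xi>: "\<xi> \<in> torus"
  define \<eta> where "\<eta> = scal r \<xi>"
  define q where "q = complex_of_real (1 - p)"
  have good: "good p (\<eta> i)" for i unfolding \<eta>_def by (rule scal_good[OF \<xi>])
  have s: "0 < 4 / (1 - p)" using p by simp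
  have q0: "q \<noteq> 0" "complex_of_real p \<noteq> 0" using p by (auto simp: q_def)
  define W where "W = V - {n}"
  have W: "V = insert n W" "n \<notin> W" "finite W" using V n by (auto simp: W_def)
  have vn: "v \<noteq> n" using V n by auto
  have gu: "good p ((\<eta>(n := u)) i)" if "norm u > 4 / (1 - p)" for u i
    using that good by (auto simp: good_def)
  have gu': "good p u" if "norm u > 4 / (1 - p)" for u
    using that by (auto simp: good_def)
  have dn: "denom p V (\<eta>(n := u)) \<noteq> 0" if "norm u > 4 / (1 - p)" for u
    by (rule denom_nonzero[OF p' V(1) gu[OF that]])
  have injW: "inj_on \<eta> W"
    unfolding \<eta>_def by (rule inj_on_subset[OF scal_inj[OF \<xi>]]) (auto simp: W_def)
  \<comment> \<open>With g = \<open>gA p\<close>, the identity (q \<eta>_j - 1) (g(u) - g(\<eta>_j))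
    = f(g(u), \<eta>_j) = p q (u - \<eta>_j) / (q u - 1) turns differences of poles into differences
    of variables. \<open>P\<close> is what then stands above the product of the u -
    \<eta>_j.\<close>
  define P where "P = (\<lambda>u. - (u powi (- y n) * (\<Prod>i\<in>W. \<eta> i powi (- y i))) * (1 / denom p V (\<eta>(n := u)))
      * (1 / (q * u - 1)) * (bethe_sum p xs (insert v V) (\<eta>(n := u, v := gA p u)) * (1 / (gA p u - 1)))
      * ((q * u - 1) / (of_real p * q)) ^ card W)"
  have prod_eq: "(\<Prod>a\<in>\<eta> ` W. u - a) = (\<Prod>j\<in>W. u - \<eta> j)" for u
    by (subst prod.reindex[OF injW]) simp
  have eq: "pole_term p xs y v V n (\<eta>(n := u)) = P u / (\<Prod>a\<in>\<eta> ` W. u - a)"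
    if u: "norm u > 4 / (1 - p)" for u
  proof -
    have nz: "1 - q * u \<noteq> 0" "q * u - 1 \<noteq> 0" using good_nonzero[OF p' gu'[OF u]] by (auto simp: q_def)
    have a: "(\<Prod>i\<in>V. (\<eta>(n := u)) i powi (- y i)) = u powi (- y n) * (\<Prod>i\<in>W. \<eta> i powi (- y i))"
      unfolding W(1) using W(2,3) by (simp add: prod.insert) (intro disjI2 prod.cong, auto)
    have b: "(\<Prod>i\<in>V. q * (\<eta>(n := u)) i - 1) = (q * u - 1) * (\<Prod>j\<in>W. q * \<eta> j - 1)"
      unfolding W(1) using W(2,3) by (simp add: prod.insert) (intro disjI2 prod.cong, auto)
    have c: "(\<Prod>j\<in>V - {n}. gA p ((\<eta>(n := u)) n) - gA p ((\<eta>(n := u)) j)) = (\<Prod>j\<in>W. gA p u - gA p (\<eta> j))"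
      unfolding W_def by (intro prod.cong) auto
    have "(\<Prod>j\<in>W. q * \<eta> j - 1) * (\<Prod>j\<in>W. gA p u - gA p (\<eta> j))
        = (\<Prod>j\<in>W. (of_real p * q) / (q * u - 1) * (u - \<eta> j))"
      unfolding prod.distrib[symmetric]
    proof (rule prod.cong)
      fix j
      have "(q * \<eta> j - 1) * (gA p u - gA p (\<eta> j)) = fA p (gA p u) (\<eta> j)"
        using gA_factor[OF p good, of "gA p u" j] by (simp add: q_def)
      also have "\<dots> = of_real p * q * (\<eta> j - u) / (1 - q * u)"
        using fA_gA[of p u "\<eta> j"] nz by (simp add: q_def)
      also have "\<dots> = of_real p * q / (q * u - 1) * (u - \<eta> j)"
        using nz by (simp add: divide_simps) (simp add: algebra_simps)?
      finally show "(q * \<eta> j - 1) * (gA p u - gA p (\<eta> j)) = of_real p * q / (q * u - 1) * (u - \<eta> j)" .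
    qed simp
    also have "\<dots> = ((of_real p * q) / (q * u - 1)) ^ card W * (\<Prod>j\<in>W. u - \<eta> j)"
      by (simp only: prod.distrib prod_constant)
    finally have XY: "1 / ((\<Prod>j\<in>W. q * \<eta> j - 1) * (\<Prod>j\<in>W. gA p u - gA p (\<eta> j)))
        = ((q * u - 1) / (of_real p * q)) ^ card W / (\<Prod>j\<in>W. u - \<eta> j)"
      by (simp add: power_divide)
    have alg: "- A / (D * (E * X)) * (B / (G * Y)) = - A * (1 / D) * (1 / E) * (B * (1 / G)) * (1 / (X * Y))"
      for A B D E G X Y :: complex by (simp add: divide_inverse mult_ac)
    have "pole_term p xs y v V n (\<eta>(n := u)) = - (u powi (- y n) * (\<Prod>i\<in>W. \<eta> i powi (- y i)))
        / (denom p V (\<eta>(n := u)) * ((q * u - 1) * (\<Prod>j\<in>W. q * \<eta> j - 1)))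
        * (bethe_sum p xs (insert v V) (\<eta>(n := u, v := gA p u))
           / ((gA p u - 1) * (\<Prod>j\<in>W. gA p u - gA p (\<eta> j))))"
      unfolding pole_term_def a c b[unfolded q_def] by (simp add: q_def)
    also have "\<dots> = P u / (\<Prod>a\<in>\<eta> ` W. u - a)"
      unfolding alg XY P_def prod_eq by simp
    finally show ?thesis .
  qed
  have "circ_mean (r n) (\<lambda>u. P u / (\<Prod>a\<in>\<eta> ` W. u - a)) = 0"
  proof (rule circ_mean_at_infinity_removable[OF _ _ s r])
    show "finite (\<eta> ` W)" using W by simp
    show "norm a > 4 / (1 - p)" if "a \<in> \<eta> ` W" for a using that good by (auto simp: good_def)
    \<comment> \<open>The apparent pole \<eta>_j has modulus \<open>r j\<close>, and the radii are
      distinct.\<close>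
    show "norm a \<noteq> r n" if "a \<in> \<eta> ` W" for a
    proof -
      obtain j where j: "j \<in> W" "a = \<eta> j" using \<open>a \<in> \<eta> ` W\<close> by auto
      then have "norm a = r j" using norm_scal[OF \<xi> radius_pos] by (simp add: \<eta>_def)
      moreover have "r j \<noteq> r n" using inj_onD[OF inj, of j n] j n by (auto simp: W_def)
      ultimately show ?thesis by simp
    qed
    \<comment> \<open>Here the variables \<open>n\<close> and \<open>j\<close> coincide, so the
      antisymmetric numerator vanishes.\<close>
    show "P a = 0" if "a \<in> \<eta> ` W" for a
    proof -
      obtain j where j: "j \<in> W" "a = \<eta> j" using \<open>a \<in> \<eta> ` W\<close> by auto
      have "bethe_sum p xs (insert v V) (\<eta>(n := a, v := gA p a)) = 0"
        by (rule bethe_sum_coincident[of n _ j]) (use j W n V in auto)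
      then show ?thesis by (simp add: P_def)
    qed
    let ?U = "{u. norm u > 4 / (1 - p)}"
    have hg: "(\<lambda>u. gA p u) holomorphic_on ?U"
      by (rule holomorphic_on_gA[OF _ _ p']) (auto simp: good_def)
    have hi: "(\<lambda>u. (\<eta>(n := u)) i) holomorphic_on ?U" for i
      by (cases "i = n") auto
    have hi2: "(\<lambda>u. (\<eta>(n := u, v := gA p u)) i) holomorphic_on ?U" for i
      using hg by (cases "i = n"; cases "i = v") (auto simp: vn)
    have nz: "u \<noteq> 0" "gA p u \<noteq> 0" "gA p u - 1 \<noteq> 0" "q * u - 1 \<noteq> 0" if "u \<in> ?U" for u
      using good_nonzero[OF p' gu', of u] gA_bounds[OF p gu', of u] that by (auto simp: q_def)
    have nz2: "(\<eta>(n := u, v := gA p u)) i \<noteq> 0" if "u \<in> ?U" for u i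
      using nz[OF that] good_nonzero(1)[OF p' good] by auto
    have dn': "denom p V (\<eta>(n := u)) \<noteq> 0" if "u \<in> ?U" for u
      using dn that by simp
    show "P holomorphic_on ?U"
      unfolding P_def using nz dn' nz2 q0
      by (intro holomorphic_on_mult holomorphic_on_minus holomorphic_on_divide holomorphic_on_const
          holomorphic_on_power_int holomorphic_on_id holomorphic_on_ident holomorphic_on_denom hi
          holomorphic_on_diff holomorphic_on_bethe_sum hi2 hg holomorphic_on_power) auto
    have lin: "growth (\<lambda>u. (q * u - 1) / (of_real p * q)) 1"
    proof -
      have "growth (\<lambda>u. (q * u - 1) * (1 / (of_real p * q))) ((0 + 1) + 0)"
        by (intro growth_mult growth_diff growth_const growth_id) (auto intro: growth_mono[OF growth_const])
      then show ?thesis by simp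
    qed
    have "growth (\<lambda>u. 1 / (-1 + q * u)) (-1)" using q0 by (intro growth_inverse_linear)
    then have inv: "growth (\<lambda>u. 1 / (q * u - 1)) (-1)" by simp
    have "growth (\<lambda>u. 1 / (- \<eta> j + 1 * u)) (-1)" for j by (intro growth_inverse_linear) simp
    then have "growth (\<lambda>u. 1 / (u - \<eta> j)) (-1)" for j by simp
    then have pr: "growth (\<lambda>u. \<Prod>j\<in>W. 1 / (u - \<eta> j)) (\<Sum>j\<in>W. -1)" by (intro growth_prod)
    \<comment> \<open>The contributions of \<open>card V\<close> cancel, and so do those of
      \<open>W\<close>; what remains is \<open>- y n - 1\<close>.\<close>
    have "growth (\<lambda>u. P u * (\<Prod>j\<in>W. 1 / (u - \<eta> j)))
       (((((- y n + 0) + - int (card V)) + -1) + (int (card V) + 0) + int (card W) * 1) + (\<Sum>j\<in>W. -1))"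
      unfolding P_def using good V n
      by (intro growth_mult growth_minus growth_powi growth_const growth_inverse_denom p'
          inv growth_bethe_sum_pole growth_inverse_gA growth_power lin pr) auto
    then have "growth (\<lambda>u. P u * (\<Prod>j\<in>W. 1 / (u - \<eta> j))) (-1)"
      by (rule growth_mono) (use yn in auto)
    then have "growth (\<lambda>u. P u / (\<Prod>a\<in>\<eta> ` W. u - a)) (-1)"
      by (simp add: prod_eq prod_dividef)
    then show "((\<lambda>u. P u / (\<Prod>a\<in>\<eta> ` W. u - a)) \<longlongrightarrow> 0) at_infinity"
      by (rule growth_tendsto_0)
  qed
  moreover have "circ_mean (r n) (\<lambda>u. pole_term p xs y v V n (\<eta>(n := u)))
      = circ_mean (r n) (\<lambda>u. P u / (\<Prod>a\<in>\<eta> ` W. u - a))"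
    using r[of n] radius_pos[of n] by (intro circ_mean_cong eq) auto
  ultimately show "av n (\<lambda>\<xi>. pole_term p xs y v V n (scal r \<xi>)) \<xi> = 0"
    by (simp add: av_scal \<eta>_def)
qed

end


section \<open>Integration of the smallest variable by residues\<close>

lemma denom_cong: "(\<And>i. i \<in> V \<Longrightarrow> \<eta> i = \<eta>' i) \<Longrightarrow> denom p V \<eta> = denom p V \<eta>'"
  unfolding denom_def using fprod_cong[of V \<eta> \<eta>'] by (simp cong: prod.cong)

lemma fA_one_left: "fA p 1 z = of_real (1 - p) * (z - 1)"
  by (simp add: fA_def algebra_simps)

text \<open>With \<open>y v = -1\<close> the monomial contributes a factor \<xi>_v, which cancels
  the pole of the mean at 0. This leaves simple poles at 1 and at the points
  \<open>gA p \<xi>_n\<close>, all inside the contour.\<close>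

lemma av_bsum_residues:
  assumes p: "0 < p" "p < 1" and r: "\<And>i. r i > 4 / (1 - p)"
    and V: "finite V" "\<And>i. i \<in> V \<Longrightarrow> v < i" and inj: "inj_on r V"
    and xs: "sorted_wrt (<) xs" "\<And>x. x \<in> set xs \<Longrightarrow> x \<ge> 0" "xs \<noteq> []"
    and yv: "y v = -1" and \<xi>: "\<xi> \<in> torus"
  shows "av v (\<lambda>\<xi>. bsum p xs y (insert v V) (scal r \<xi>)) \<xi> =
     - (of_nat (card V + 2 - length xs) * of_real p ^ (length xs - 1) / of_real (1 - p) ^ card V)
        * bsum p xs y V (scal r \<xi>)
     + (\<Sum>n\<in>V. pole_term p xs y v V n (scal r \<xi>))"
proof -
  have p': "0 \<le> p" "p < 1" using p by auto
  have vV: "v \<notin> V" using V by auto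
  define \<eta> where "\<eta> = scal r \<xi>"
  define q where "q = complex_of_real (1 - p)"
  have q0: "q \<noteq> 0" using p by (simp add: q_def)
  have good: "good p (\<eta> i)" for i unfolding \<eta>_def by (rule good_scal[OF r \<xi> p'])
  have "0 < 4 / (1 - p)" using p by simp
  then have "r v > 0" using r[of v] by linarith
  then have rv: "r v > 1"
    using norm_scal[OF \<xi>, of r v] good_norm(1)[OF p' good, of v] by (simp add: \<eta>_def)
  define g where "g = (\<lambda>i. gA p (\<eta> i))"
  have inj\<eta>: "inj_on \<eta> V"
    unfolding \<eta>_def by (rule scal_inj[OF p r V(1) vV inj xs \<xi>])
  have injg: "inj_on g V"
  proof (rule inj_onI)
    fix i j assume ij: "i \<in> V" "j \<in> V" "g i = g j"
    then have "\<eta> i = \<eta> j" unfolding g_def by (intro gA_inj[OF p good good])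
    then show "i = j" by (rule inj_onD[OF inj\<eta> _ ij(1,2)])
  qed
  have g1: "g i \<noteq> 1" "norm (g i) < 1" for i unfolding g_def using gA_bounds[OF p good] by auto
  define A where "A = insert 1 (g ` V)"
  have A: "finite A" "1 \<notin> g ` V" using V g1(1) by (auto simp: A_def image_iff) (metis g1(1))?
  define K where "K = (\<lambda>z. bethe_sum p xs (insert v V) (\<eta>(v := z)))"
  \<comment> \<open>The part independent of \<xi>_v. Its sign comes from writing 1 - z as - (z -
    1).\<close>
  define C where "C = - (\<Prod>i\<in>V. \<eta> i powi (- y i)) / (denom p V \<eta> * (\<Prod>i\<in>V. q * \<eta> i - 1))"
  have "K holomorphic_on UNIV"
    unfolding K_def
  proof (rule holomorphic_on_bethe_sum)
    show "(\<lambda>z. (\<eta>(v := z)) i) holomorphic_on UNIV" for i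
      by (cases "i = v") auto
    fix i c assume "c \<in> set xs"
    then have "c \<ge> 0" by (rule xs(2))
    then show "(\<lambda>z. (\<eta>(v := z)) i powi c) holomorphic_on UNIV"
      by (cases "i = v") (auto simp: power_int_def intro!: holomorphic_intros)
  qed
  then have res: "circ_mean (r v) (\<lambda>z. z * (K z / (\<Prod>a\<in>A. z - a))) = (\<Sum>a\<in>A. K a / (\<Prod>b\<in>A - {a}. a - b))"
    using A rv g1(2) by (intro circ_mean_simple_poles) (auto simp: A_def intro: less_trans)
  have integrand: "bsum p xs y (insert v V) (\<eta>(v := z)) = C * (z * (K z / (\<Prod>a\<in>A. z - a)))" for z
  proof -
    have 1: "(\<Prod>i\<in>insert v V. (\<eta>(v := z)) i powi (- y i)) = z * (\<Prod>i\<in>V. \<eta> i powi (- y i))"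
      using V vV yv by (simp add: prod.insert) (intro disjI2 prod.cong, auto)
    have "denom p V (\<eta>(v := z)) = denom p V \<eta>" by (rule denom_cong) (use vV in auto)
    moreover have "(\<Prod>i\<in>V. fA p z ((\<eta>(v := z)) i)) = (\<Prod>i\<in>V. (q * \<eta> i - 1) * (z - g i))"
    proof (rule prod.cong)
      fix i assume "i \<in> V"
      then have "(\<eta>(v := z)) i = \<eta> i" using vV by auto
      then show "fA p z ((\<eta>(v := z)) i) = (q * \<eta> i - 1) * (z - g i)"
        unfolding g_def q_def by (simp only: gA_factor[OF p good])
    qed simp
    ultimately have 2: "denom p (insert v V) (\<eta>(v := z))
        = (1 - z) * ((\<Prod>i\<in>V. q * \<eta> i - 1) * (\<Prod>i\<in>V. z - g i)) * denom p V \<eta>"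
      using denom_insert_min[OF V, of p "\<eta>(v := z)"] by (simp add: prod.distrib)
    have 3: "(\<Prod>a\<in>A. z - a) = (z - 1) * (\<Prod>i\<in>V. z - g i)"
      unfolding A_def using A V by (simp add: prod.reindex[OF injg])
    have alg: "B * (z * P) / ((1 - z) * (X * Y) * D) = - P / (D * X) * (z * (B / ((z - 1) * Y)))"
      for B P X Y D :: complex
    proof -
      have "inverse (1 - z) = - inverse (z - 1)"
        by (metis inverse_minus_eq minus_diff_eq)
      then show ?thesis by (simp add: divide_inverse mult_ac)
    qed
    show ?thesis
      unfolding bsum_def 1 2 3 K_def C_def by (rule alg)
  qed
  have sum_A: "(\<Sum>a\<in>A. K a / (\<Prod>b\<in>A - {a}. a - b))
     = K 1 / (\<Prod>i\<in>V. 1 - g i) + (\<Sum>n\<in>V. K (g n) / ((g n - 1) * (\<Prod>j\<in>V - {n}. g n - g j)))"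
  proof -
    have "A - {1} = g ` V" using A by (auto simp: A_def)
    then have 1: "(\<Prod>b\<in>A - {1}. 1 - b) = (\<Prod>i\<in>V. 1 - g i)" by (simp add: prod.reindex[OF injg])
    have 2: "(\<Prod>b\<in>A - {g n}. g n - b) = (g n - 1) * (\<Prod>j\<in>V - {n}. g n - g j)" if n: "n \<in> V" for n
    proof -
      have "A - {g n} = insert 1 (g ` (V - {n}))"
        using A n g1(1)[of n] inj_onD[OF injg _ _ n] by (auto simp: A_def)
      moreover have "inj_on g (V - {n})" by (rule inj_on_subset[OF injg]) auto
      moreover have "1 \<notin> g ` (V - {n})" using A(2) by auto
      ultimately show ?thesis using V by (simp add: prod.reindex)
    qed
    have "(\<Sum>a\<in>A. K a / (\<Prod>b\<in>A - {a}. a - b)) = K 1 / (\<Prod>b\<in>A - {1}. 1 - b)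
        + (\<Sum>a\<in>g ` V. K a / (\<Prod>b\<in>A - {a}. a - b))"
      unfolding A_def using A V by (subst sum.insert) auto
    also have "(\<Sum>a\<in>g ` V. K a / (\<Prod>b\<in>A - {a}. a - b)) = (\<Sum>n\<in>V. K (g n) / (\<Prod>b\<in>A - {g n}. g n - b))"
      by (subst sum.reindex[OF injg]) simp
    finally show ?thesis using 1 2 by simp
  qed
  have pole: "C * (K (g n) / ((g n - 1) * (\<Prod>j\<in>V - {n}. g n - g j))) = pole_term p xs y v V n \<eta>" for n
    by (simp add: C_def K_def g_def q_def pole_term_def)
  have "C * (K 1 / (\<Prod>i\<in>V. 1 - g i))
     = - (of_nat (card V + 2 - length xs) * of_real p ^ (length xs - 1) / q ^ card V) * bsum p xs y V \<eta>"
  proof -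
    have K1: "K 1 = (-1) ^ card V * of_nat (card V + 2 - length xs) * of_real p ^ (length xs - 1)
       * (\<Prod>i\<in>V. 1 - \<eta> i) * bethe_sum p xs V \<eta>"
      unfolding K_def by (rule bethe_sum_insert_one[OF V xs(3)])
    \<comment> \<open>Each pair of factors is f(1, \<eta>_i) = - q (1 - \<eta>_i). The products of
      the 1 - \<eta>_i then cancel those in \<open>K1\<close>, and the integrand for
      \<open>V\<close> is left.\<close>
    have "(\<Prod>i\<in>V. q * \<eta> i - 1) * (\<Prod>i\<in>V. 1 - g i) = (\<Prod>i\<in>V. (- q) * (1 - \<eta> i))"
      unfolding prod.distrib[symmetric]
    proof (rule prod.cong)
      fix i
      have "(q * \<eta> i - 1) * (1 - g i) = fA p 1 (\<eta> i)"
        unfolding g_def q_def by (simp only: gA_factor[OF p good])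
      then show "(q * \<eta> i - 1) * (1 - g i) = (- q) * (1 - \<eta> i)"
        by (simp add: fA_one_left q_def algebra_simps)
    qed simp
    also have "\<dots> = (-1) ^ card V * q ^ card V * (\<Prod>i\<in>V. 1 - \<eta> i)"
      by (simp only: prod.distrib prod_constant power_minus[of q])
    finally have XY: "(\<Prod>i\<in>V. q * \<eta> i - 1) * (\<Prod>i\<in>V. 1 - g i)
        = (-1) ^ card V * q ^ card V * (\<Prod>i\<in>V. 1 - \<eta> i)" .
    have nz: "(\<Prod>i\<in>V. 1 - \<eta> i) \<noteq> 0"
      using good_nonzero(2)[OF p' good] V by (subst prod_zero_iff) auto
    have alg: "- P / (D * X) * (e * c * b * Z * B / Y) = - (c * b / Q) * (B * P / D)"
      if "X * Y = e * Q * Z" "e \<noteq> 0" "Z \<noteq> 0" for P D X e c b Z B Y Q :: complex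
    proof -
      have "- P / (D * X) * (e * c * b * Z * B / Y) = - (P * e * c * b * Z * B) / (D * (X * Y))"
        by (simp add: divide_inverse mult_ac)
      also have "\<dots> = - (c * b / Q) * (B * P / D)"
        unfolding that(1) using that(2,3) by (simp add: divide_inverse mult_ac)
      finally show ?thesis .
    qed
    show ?thesis
      unfolding C_def K1 bsum_def by (rule alg[OF XY]) (use nz in auto)
  qed
  then have "C * (\<Sum>a\<in>A. K a / (\<Prod>b\<in>A - {a}. a - b)) =
      - (of_nat (card V + 2 - length xs) * of_real p ^ (length xs - 1) / q ^ card V) * bsum p xs y V \<eta>
      + (\<Sum>n\<in>V. pole_term p xs y v V n \<eta>)"
    unfolding sum_A by (simp only: distrib_left sum_distrib_left pole)
  then show ?thesis
    by (simp only: av_scal \<eta>_def[symmetric] q_def[symmetric] integrand circ_mean_cmult res)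
qed

text \<open>The residue at \<open>gA p \<xi>_n\<close> has mean 0 by integration over \<xi>_n, so
  only the residue at 1 survives.\<close>

lemma torus_mean_bsum_residue_normalized:
  assumes p: "0 < p" "p < 1" and r: "\<And>i. r i > 4 / (1 - p)"
    and V: "finite V" "\<And>i. i \<in> V \<Longrightarrow> v < i" and inj: "inj_on r V"
    and xs: "sorted_wrt (<) xs" "\<And>x. x \<in> set xs \<Longrightarrow> x \<ge> 0" "xs \<noteq> []"
    and y: "y v = -1" "\<And>i. i \<in> V \<Longrightarrow> y i \<ge> 0" and ls: "insert v V \<subseteq> set ls"
  shows "torus_mean ls (\<lambda>\<xi>. bsum p xs y (insert v V) (scal r \<xi>)) =
     - (of_nat (card V + 2 - length xs) * of_real p ^ (length xs - 1) / of_real (1 - p) ^ card V)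
        * torus_mean ls (\<lambda>\<xi>. bsum p xs y V (scal r \<xi>))"
proof -
  have p': "0 \<le> p" "p < 1" using p by auto
  have vV: "v \<notin> V" using V by auto
  let ?c = "- (of_nat (card V + 2 - length xs) * of_real p ^ (length xs - 1) / of_real (1 - p) ^ card V) :: complex"
  have c: "continuous_on torus (\<lambda>\<xi>. bsum p xs y U (scal r \<xi>))" for U
    using p' r by (intro continuous_on_bsum continuous_on_const continuous_on_scal good_scal) auto
  have cp: "continuous_on torus (\<lambda>\<xi>. pole_term p xs y v V n (scal r \<xi>))" if "n \<in> V" for n
    by (rule continuous_on_pole_term[OF p r V(1) vV inj xs that])
  have "torus_mean ls (\<lambda>\<xi>. bsum p xs y (insert v V) (scal r \<xi>))
      = torus_mean ls (av v (\<lambda>\<xi>. bsum p xs y (insert v V) (scal r \<xi>)))"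
    using torus_mean_av[OF c, of v ls] ls by simp
  also have "\<dots> = torus_mean ls (\<lambda>\<xi>. ?c * bsum p xs y V (scal r \<xi>)
      + (\<Sum>n\<in>V. pole_term p xs y v V n (scal r \<xi>)))"
    by (rule torus_mean_cong) (rule av_bsum_residues[where y = y and v = v, OF p r V inj xs y(1)])
  also have "\<dots> = torus_mean ls (\<lambda>\<xi>. ?c * bsum p xs y V (scal r \<xi>))
      + torus_mean ls (\<lambda>\<xi>. \<Sum>n\<in>V. pole_term p xs y v V n (scal r \<xi>))"
    by (intro torus_mean_add continuous_on_mult continuous_on_const c continuous_on_sum cp)
  also have "torus_mean ls (\<lambda>\<xi>. \<Sum>n\<in>V. pole_term p xs y v V n (scal r \<xi>))
      = (\<Sum>n\<in>V. torus_mean ls (\<lambda>\<xi>. pole_term p xs y v V n (scal r \<xi>)))"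
    by (rule torus_mean_sum[OF cp])
  also have "\<dots> = 0"
    using ls y(2) by (intro sum.neutral ballI torus_mean_pole_term[OF p r V(1) vV inj xs]) auto
  finally show ?thesis by (simp only: torus_mean_cmult add_0_right)
qed

lemma torus_mean_bsum_residue:
  assumes p: "0 < p" "p < 1" and r: "\<And>i. r i > 4 / (1 - p)"
    and V: "finite V" "\<And>i. i \<in> V \<Longrightarrow> v < i" and inj: "inj_on r V"
    and xs: "sorted_wrt (<) xs" "xs \<noteq> []" "y v < hd xs"
    and y: "\<And>i. i \<in> V \<Longrightarrow> y v < y i" and ls: "insert v V \<subseteq> set ls"
  shows "torus_mean ls (\<lambda>\<xi>. bsum p xs y (insert v V) (scal r \<xi>)) =
     - (of_nat (card V + 2 - length xs) * of_real p ^ (length xs - 1) / of_real (1 - p) ^ card V)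
        * torus_mean ls (\<lambda>\<xi>. bsum p xs y V (scal r \<xi>))"
proof -
  have p': "0 \<le> p" "p < 1" using p by auto
  \<comment> \<open>Translates \<open>y v\<close> to -1. All of \<open>xs\<close> and all other
    \<open>y i\<close> exceed \<open>y v\<close>, so they become non-negative.\<close>
  define c where "c = - y v - 1"
  define xs' where "xs' = map (\<lambda>x. x + c) xs"
  define y' where "y' = (\<lambda>i. y i + c)"
  have sh: "torus_mean ls (\<lambda>\<xi>. bsum p xs y U (scal r \<xi>)) = torus_mean ls (\<lambda>\<xi>. bsum p xs' y' U (scal r \<xi>))" for U
    unfolding xs'_def y'_def
    by (intro torus_mean_cong bsum_shift[symmetric] good_nonzero[OF p' good_scal[OF r _ p']])
  have "x \<ge> hd xs" if "x \<in> set xs" for x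
    using xs(1,2) that by (cases xs) auto
  then have "x \<ge> 0" if "x \<in> set xs'" for x
    using that xs(3) by (force simp: xs'_def c_def)
  moreover have "sorted_wrt (<) xs'"
    using xs(1) by (simp add: xs'_def sorted_wrt_map)
  moreover have "length xs' = length xs" "xs' \<noteq> []" using xs by (auto simp: xs'_def)
  ultimately show ?thesis
    unfolding sh using torus_mean_bsum_residue_normalized[OF p r V inj, of xs' y' ls] y ls
    by (fastforce simp: y'_def c_def)
qed


text \<open>The particles are numbered from \<open>a + 1\<close>; the recursion over the first particle increases \<open>a\<close>. The
  truncated subtraction is harmless, since the integrand vanishes if \<open>card V < m\<close>. The factor
  \<open>1 / k!\<close> compensates for the orderings of \<open>S\<close>.\<close>

definition kappa :: "real \<Rightarrow> nat \<Rightarrow> nat \<Rightarrow> nat set \<Rightarrow> real" where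
  "kappa p a m V = (let k = card V + 1 - m in
     (p / (1 - p)) powi ((\<Sum>i\<in>V. int i - int a) - int (m * (m - 1) div 2) - int m * int k)
       * (1 - p) ^ (k * (k - 1) div 2) / fact k)"

definition wsum :: "real \<Rightarrow> nat \<Rightarrow> int list \<Rightarrow> (nat \<Rightarrow> int) \<Rightarrow> nat set \<Rightarrow> (nat \<Rightarrow> complex) \<Rightarrow> complex" where
  "wsum p a xs y I \<eta> = (\<Sum>V\<in>Pow I. of_real (kappa p a (length xs) V) * bsum p xs y V \<eta>)"

section \<open>Recursion of the weights\<close>

lemma triangle_Suc: "Suc k * k div 2 = k * (k - 1) div 2 + k"
proof -
  have "Suc k * k = k * (k - 1) + 2 * k" by (cases k) auto
  then show ?thesis by simp
qed

text \<open>The new label raises k by one and the exponent of \<tau> by 1 - m. Together with p^(m -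
  1) the latter gives q^(m - 1), the triangular exponent gives q^k, and (m - 1) + k =
  \<open>card V\<close>. The count \<open>card V + 2 - m\<close> is k + 1 and cancels against the
  factorial.\<close>

lemma kappa_insert:
  assumes p: "0 < p" "p < 1" and V: "finite V" "Suc a \<notin> V" and m: "1 \<le> m" "m \<le> card V + 1"
  shows "kappa p a m (insert (Suc a) V) * (real (card V + 2 - m) * p ^ (m - 1) / (1 - p) ^ card V)
     = kappa p a m V"
proof -
  define k where "k = card V + 1 - m"
  define \<tau> where "\<tau> = p / (1 - p)"
  define e where "e = (\<Sum>i\<in>V. int i - int a) - int (m * (m - 1) div 2) - int m * int k"
  have \<tau>: "\<tau> \<noteq> 0" using p by (simp add: \<tau>_def)
  have k: "card V + 2 - m = Suc k" "card (insert (Suc a) V) + 1 - m = Suc k" "card V = (m - 1) + k"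
    using V m by (auto simp: k_def)
  have ex: "(\<Sum>i\<in>insert (Suc a) V. int i - int a) - int (m * (m - 1) div 2) - int m * int (Suc k)
      = e - int (m - 1)"
    using V m by (simp add: e_def algebra_simps)
  have "\<tau> powi (e - int (m - 1)) * \<tau> ^ (m - 1) = \<tau> powi e"
    using \<tau> by (simp add: power_int_diff)
  then have t: "\<tau> powi (e - int (m - 1)) * p ^ (m - 1) = \<tau> powi e * (1 - p) ^ (m - 1)"
    using p by (simp add: \<tau>_def power_divide field_simps)
  have kap: "kappa p a m (insert (Suc a) V)
      = \<tau> powi (e - int (m - 1)) * (1 - p) ^ (Suc k * k div 2) / fact (Suc k)"
    unfolding kappa_def Let_def k(2) ex \<tau>_def[symmetric] by simp
  have "kappa p a m (insert (Suc a) V) * (real (card V + 2 - m) * p ^ (m - 1) / (1 - p) ^ card V)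
     = (\<tau> powi (e - int (m - 1)) * p ^ (m - 1)) * (1 - p) ^ (k * (k - 1) div 2) * (1 - p) ^ k
        / fact k / (1 - p) ^ ((m - 1) + k)"
    unfolding kap k(1) triangle_Suc unfolding k(3) fact_Suc power_add
    by (simp add: divide_simps del: of_nat_Suc)
  also have "\<dots> = \<tau> powi e * (1 - p) ^ (k * (k - 1) div 2) / fact k"
    unfolding t using p by (simp add: power_add)
  also have "\<dots> = kappa p a m V"
    by (simp add: kappa_def Let_def k_def \<tau>_def e_def)
  finally show ?thesis .
qed

text \<open>k is unchanged. Removing the first label and raising the origin \<open>a\<close> lowers
  the sum by \<open>card V + 1\<close>, which is m + k, the joint change of the triangular number
  and of the product of m and k.\<close>

lemma kappa_head:
  assumes V: "finite V" "Suc a \<notin> V" and m: "m \<le> card V"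
  shows "kappa p a (Suc m) (insert (Suc a) V) = kappa p (Suc a) m V"
proof -
  define k where "k = card V + 1 - m"
  have k: "card (insert (Suc a) V) + 1 - Suc m = k" "card V + 1 = m + k"
    using V m by (auto simp: k_def)
  have "(\<Sum>i\<in>V. int i - int a) = (\<Sum>i\<in>V. int i - int (Suc a)) + int (card V)"
    by (simp add: sum_subtractf algebra_simps)
  moreover have "Suc m * (Suc m - 1) div 2 = m * (m - 1) div 2 + m"
    using triangle_Suc[of m] by simp
  ultimately have "(\<Sum>i\<in>insert (Suc a) V. int i - int a) - int (Suc m * (Suc m - 1) div 2) - int (Suc m) * int k
      = (\<Sum>i\<in>V. int i - int (Suc a)) - int (m * (m - 1) div 2) - int m * int k"
    using V k by (simp add: algebra_simps)
  then show ?thesis unfolding kappa_def Let_def k(1) by (simp only: k_def)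
qed

context
  fixes p :: real and r :: "nat \<Rightarrow> real" and ls :: "nat list" and N :: nat
  assumes p: "0 < p" "p < 1" and r: "\<And>i. r i > 4 / (1 - p)"
    and inj: "inj_on r {..N}" and ls: "{1..N} \<subseteq> set ls"
begin

lemma p_nonneg: "0 \<le> p" using p by simp

lemma cont_bterm: "continuous_on torus (\<lambda>\<xi>. bterm p xs y M (scal r \<xi>))"
  using p r by (intro continuous_on_bterm continuous_on_const continuous_on_scal good_scal) auto

lemma cont_bsum: "continuous_on torus (\<lambda>\<xi>. bsum p xs y V (scal r \<xi>))"
  using p r by (intro continuous_on_bsum continuous_on_const continuous_on_scal good_scal) auto

lemma mean_wsum:
  "torus_mean ls (\<lambda>\<xi>. wsum p a xs y I (scal r \<xi>))
     = (\<Sum>V\<in>Pow I. of_real (kappa p a (length xs) V) * torus_mean ls (\<lambda>\<xi>. bsum p xs y V (scal r \<xi>)))"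
  unfolding wsum_def
  by (subst torus_mean_sum) (auto intro!: continuous_on_mult continuous_on_const cont_bsum simp: torus_mean_cmult)

lemma mean_bsum:
  "torus_mean ls (\<lambda>\<xi>. bsum p xs y V (scal r \<xi>))
     = (\<Sum>M\<in>permutations_of_set V. pairprod isgn M * torus_mean ls (\<lambda>\<xi>. bterm p xs y M (scal r \<xi>)))"
  unfolding bsum_eq_sum_bterm
  by (subst torus_mean_sum) (auto intro!: continuous_on_mult continuous_on_const cont_bterm simp: torus_mean_cmult)

text \<open>In every arrangement it is the leading variable that is moved to infinity.\<close>

lemma mean_bsum_eq_0:
  assumes "V \<subseteq> {1..N}" "\<And>n. n \<in> V \<Longrightarrow> x < y n"
  shows "torus_mean ls (\<lambda>\<xi>. bsum p (x # xs) y V (scal r \<xi>)) = 0"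
proof (cases "V = {}")
  case True
  then show ?thesis by (simp add: bsum_short)
next
  case False
  show ?thesis unfolding mean_bsum
  proof (rule sum.neutral, rule ballI)
    fix M assume M: "M \<in> permutations_of_set V"
    then have "hd M \<in> V" using False by (cases M) (auto simp: permutations_of_set_def)
    then have "torus_mean ls (\<lambda>\<xi>. bterm p (x # xs) y M (scal r \<xi>)) = 0"
      using M assms ls by (intro torus_mean_bterm_eq_0[OF p_nonneg p(2) r, of M "hd M"])
        (auto simp: permutations_of_set_def)
    then show "pairprod isgn M * torus_mean ls (\<lambda>\<xi>. bterm p (x # xs) y M (scal r \<xi>)) = 0" by simp
  qed
qed

text \<open>With \<Lambda> empty any variable may be moved to infinity, and every set other than the
  singleton contains one with \<open>x < y n\<close>. For the singleton all factors cancel.\<close>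

lemma mean_bsum_singleton:
  assumes "V \<subseteq> {1..N}" "v \<in> V" "y v = x" "\<And>n. n \<in> V - {v} \<Longrightarrow> x < y n"
  shows "torus_mean ls (\<lambda>\<xi>. bsum p [x] y V (scal r \<xi>)) = (if V = {v} then 1 else 0)"
proof (cases "V = {v}")
  case True
  have "bsum p [x] y V (scal r \<xi>) = 1" if "\<xi> \<in> torus" for \<xi>
  proof -
    have "good p (scal r \<xi> v)" by (rule good_scal[OF r that p_nonneg p(2)])
    moreover have "lt_pairs {v} = {}" by (auto simp: lt_pairs_def)
    ultimately show ?thesis
      using assms(3) True good_nonzero[OF p_nonneg p(2)]
      by (simp add: bsum_eq_sum_bterm bterm_def denom_def fprod_def power_int_minus)
  qed
  then have "torus_mean ls (\<lambda>\<xi>. bsum p [x] y V (scal r \<xi>)) = torus_mean ls (\<lambda>\<xi>. 1)"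
    by (rule torus_mean_cong)
  then show ?thesis using True by simp
next
  case False
  then obtain n where n: "n \<in> V" "n \<noteq> v" using assms(2) by auto
  have "torus_mean ls (\<lambda>\<xi>. bsum p [x] y V (scal r \<xi>)) = 0"
    unfolding mean_bsum
  proof (rule sum.neutral, rule ballI)
    fix M assume M: "M \<in> permutations_of_set V"
    have "torus_mean ls (\<lambda>\<xi>. bterm p [x] y M (scal r \<xi>)) = 0"
      using M assms ls n by (intro torus_mean_bterm_eq_0[OF p_nonneg p(2) r, of M n])
        (auto simp: permutations_of_set_def)
    then show "pairprod isgn M * torus_mean ls (\<lambda>\<xi>. bterm p [x] y M (scal r \<xi>)) = 0" by simp
  qed
  then show ?thesis using False by simp
qed

text \<open>Arrangements led by another label have mean 0. In those led by \<open>v\<close>, the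
  factors 1 - \<xi>_v and f(\<xi>_v, .) are exactly the ones that \<open>v\<close> contributes to
  the denominator.\<close>

lemma mean_bsum_head:
  assumes V: "V \<subseteq> {1..N}" "v \<in> {1..N}" "\<And>i. i \<in> V \<Longrightarrow> v < i" and y: "y v = x" "\<And>n. n \<in> V \<Longrightarrow> x < y n"
  shows "torus_mean ls (\<lambda>\<xi>. bsum p (x # x' # xs) y (insert v V) (scal r \<xi>))
       = torus_mean ls (\<lambda>\<xi>. bsum p (x' # xs) y V (scal r \<xi>))"
proof -
  have fin: "finite V" using V(1) finite_subset by blast
  have vV: "v \<notin> V" using V(3) by auto
  have b: "bterm p (x # x' # xs) y (v # M) (scal r \<xi>) = bterm p (x' # xs) y M (scal r \<xi>)"
    if M: "M \<in> permutations_of_set V" and \<xi>: "\<xi> \<in> torus" for M \<xi>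
  proof -
    define \<eta> where "\<eta> = scal r \<xi>"
    have good: "good p (\<eta> i)" for i unfolding \<eta>_def by (rule good_scal[OF r \<xi> p_nonneg p(2)])
    have M': "set M = V" "distinct M" using M by (auto simp: permutations_of_set_def)
    have nz: "\<eta> v \<noteq> 0" "1 - \<eta> v \<noteq> 0" using good_nonzero[OF p_nonneg p(2) good] by auto
    have 1: "(\<Prod>w\<leftarrow>map \<eta> M. fA p (\<eta> v) w) = (\<Prod>i\<in>V. fA p (\<eta> v) (\<eta> i))"
      using M' prod.distinct_set_conv_list[of M "\<lambda>i. fA p (\<eta> v) (\<eta> i)"] by (simp add: comp_def)
    have 2: "(\<Prod>i\<in>V. fA p (\<eta> v) (\<eta> i)) \<noteq> 0"
      using fin fA_nonzero[OF p_nonneg p(2) good good] by (subst prod_zero_iff) auto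
    have 3: "denom p (insert v V) \<eta> = (1 - \<eta> v) * (\<Prod>i\<in>V. fA p (\<eta> v) (\<eta> i)) * denom p V \<eta>"
      by (rule denom_insert_min[OF fin V(3)])
    have 4: "\<eta> v powi x * \<eta> v powi (- y v) = 1"
      using y(1) nz by (simp add: power_int_minus)
    have 5: "(\<Prod>i\<in>insert v V. \<eta> i powi (- y i)) = \<eta> v powi (- y v) * (\<Prod>i\<in>V. \<eta> i powi (- y i))"
      using fin vV by simp
    have alg: "(1 - z) * X * P * B * (X' * Q) / ((1 - z) * P * D) = B * Q / D"
      if "1 - z \<noteq> 0" "P \<noteq> 0" "X * X' = 1" for z X P B X' Q D :: complex
    proof -
      have "(1 - z) * X * P * B * (X' * Q) / ((1 - z) * P * D)
          = (X * X') * (((1 - z) * P) * (B * Q)) / (((1 - z) * P) * D)"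
        by (simp only: mult_ac)
      also have "\<dots> = B * Q / D"
        unfolding that(3) mult_1 by (rule nonzero_mult_divide_mult_cancel_left) (use that in simp)
      finally show ?thesis .
    qed
    have "bterm p (x # x' # xs) y (v # M) \<eta> = (1 - \<eta> v) * \<eta> v powi x * (\<Prod>i\<in>V. fA p (\<eta> v) (\<eta> i))
        * bethe p (x' # xs) (map \<eta> M) * (\<eta> v powi (- y v) * (\<Prod>i\<in>V. \<eta> i powi (- y i)))
        / ((1 - \<eta> v) * (\<Prod>i\<in>V. fA p (\<eta> v) (\<eta> i)) * denom p V \<eta>)"
      unfolding bterm_def list.map bethe.simps list.set M' 1 3 5 by (rule refl)
    also have "\<dots> = bterm p (x' # xs) y M \<eta>"
      unfolding bterm_def M' by (rule alg[OF nz(2) 2 4])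
    finally show ?thesis by (simp only: \<eta>_def)
  qed
  have sg: "pairprod isgn (v # M) = pairprod isgn M" if "M \<in> permutations_of_set V" for M
    using pairprod_isgn_insert_min[of "[]" M v] that V(3) by (auto simp: permutations_of_set_def)
  have "torus_mean ls (\<lambda>\<xi>. bsum p (x # x' # xs) y (insert v V) (scal r \<xi>))
     = (\<Sum>M\<in>(#) v ` permutations_of_set V. pairprod isgn M
          * torus_mean ls (\<lambda>\<xi>. bterm p (x # x' # xs) y M (scal r \<xi>)))"
    unfolding mean_bsum
  proof (rule sum.mono_neutral_right)
    show "(#) v ` permutations_of_set V \<subseteq> permutations_of_set (insert v V)"
      using vV by (auto simp: permutations_of_set_def)
    show "\<forall>M\<in>permutations_of_set (insert v V) - (#) v ` permutations_of_set V.
       pairprod isgn M * torus_mean ls (\<lambda>\<xi>. bterm p (x # x' # xs) y M (scal r \<xi>)) = 0"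
    proof
      fix M assume M: "M \<in> permutations_of_set (insert v V) - (#) v ` permutations_of_set V"
      then obtain n M' where nM: "M = n # M'" by (cases M) (auto simp: permutations_of_set_def)
      have "n \<noteq> v"
      proof
        assume "n = v"
        then have "M' \<in> permutations_of_set V"
          using M nM vV by (auto simp: permutations_of_set_def)
        then show False using M nM \<open>n = v\<close> by auto
      qed
      then have "n \<in> V" using M nM by (auto simp: permutations_of_set_def)
      then have "torus_mean ls (\<lambda>\<xi>. bterm p (x # x' # xs) y M (scal r \<xi>)) = 0"
        using M nM V ls y by (intro torus_mean_bterm_eq_0[OF p_nonneg p(2) r, of M n])
          (auto simp: permutations_of_set_def)
      then show "pairprod isgn M * torus_mean ls (\<lambda>\<xi>. bterm p (x # x' # xs) y M (scal r \<xi>)) = 0"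
        by simp
    qed
  qed auto
  also have "\<dots> = (\<Sum>M\<in>permutations_of_set V. pairprod isgn (v # M)
          * torus_mean ls (\<lambda>\<xi>. bterm p (x # x' # xs) y (v # M) (scal r \<xi>)))"
    by (subst sum.reindex) (auto simp: comp_def)
  also have "\<dots> = (\<Sum>M\<in>permutations_of_set V. pairprod isgn M
          * torus_mean ls (\<lambda>\<xi>. bterm p (x' # xs) y M (scal r \<xi>)))"
    by (intro sum.cong refl arg_cong2[of _ _ _ _ "(*)"] sg torus_mean_cong b)
  also have "\<dots> = torus_mean ls (\<lambda>\<xi>. bsum p (x' # xs) y V (scal r \<xi>))"
    by (rule mean_bsum[symmetric])
  finally show ?thesis .
qed

end


lemma sum_Pow_insert:
  fixes g :: "nat set \<Rightarrow> complex"
  assumes "finite I" "v \<notin> I"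
  shows "(\<Sum>V\<in>Pow (insert v I). g V) = (\<Sum>V\<in>Pow I. g V + g (insert v V))"
proof -
  have "inj_on (insert v) (Pow I)"
    using assms(2) by (auto simp: inj_on_def)
  moreover have "Pow I \<inter> insert v ` Pow I = {}" using assms(2) by auto
  ultimately show ?thesis
    unfolding Pow_insert sum.distrib using assms(1)
    by (subst sum.union_disjoint) (auto simp: sum.reindex)
qed

context
  fixes p :: real and r :: "nat \<Rightarrow> real" and ls :: "nat list" and N :: nat
  assumes p: "0 < p" "p < 1" and r: "\<And>i. r i > 4 / (1 - p)"
    and inj: "inj_on r {..N}" and ls: "{1..N} \<subseteq> set ls"
begin

lemmas mean_wsum' = mean_wsum[OF p r inj ls]

lemma torus_mean_wsum_initial:
  assumes "sorted_wrt (<) xs" "xs \<noteq> []" "strict_mono_on {a<..N} y"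
  shows "torus_mean ls (\<lambda>\<xi>. wsum p a xs y {a<..N} (scal r \<xi>))
      = (if a + length xs \<le> N \<and> map y [a + 1..<a + 1 + length xs] = xs then 1 else 0)"
  using assms
proof (induction xs arbitrary: a)
  case (Cons x xs)
  let ?E = "\<lambda>xs V. torus_mean ls (\<lambda>\<xi>. bsum p xs y V (scal r \<xi>))"
  show ?case
  proof (cases "a < N")
    case False
    then have "{a<..N} = {}" by auto
    then show ?thesis using False by (simp add: wsum_def bsum_short)
  next
    case True
    define v where "v = Suc a"
    define I where "I = {v<..N}"
    have I: "{a<..N} = insert v I" "v \<notin> I" "finite I" "I \<subseteq> {1..N}" "v \<in> {1..N}"
      using True by (auto simp: I_def v_def)
    have ymono: "y v < y i" if "i \<in> I" for i
      using Cons.prems(3) that True by (auto simp: strict_mono_on_def I_def v_def)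
    have vless: "v < i" if "i \<in> I" for i using that by (simp add: I_def)
    have upt: "map y [a + 1..<a + 1 + length (x # xs)] = y v # map y [v + 1..<v + 1 + length xs]"
      by (subst upt_conv_Cons) (simp_all add: v_def)
    have expand: "torus_mean ls (\<lambda>\<xi>. wsum p a (x # xs) y {a<..N} (scal r \<xi>))
      = (\<Sum>V\<in>Pow I. of_real (kappa p a (length (x # xs)) V) * ?E (x # xs) V
           + of_real (kappa p a (length (x # xs)) (insert v V)) * ?E (x # xs) (insert v V))"
      unfolding mean_wsum' I(1) by (rule sum_Pow_insert[OF I(3,2)])
    consider "y v > x" | "y v = x" | "y v < x" by linarith
    then show ?thesis
    proof cases
      case 1
      have "?E (x # xs) V = 0" if "V \<subseteq> insert v I" for V
        using that 1 ymono I(4,5)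
        by (intro mean_bsum_eq_0[OF p r inj ls]) force+
      then have "torus_mean ls (\<lambda>\<xi>. wsum p a (x # xs) y {a<..N} (scal r \<xi>)) = 0"
        unfolding mean_wsum' I(1) by (intro sum.neutral) auto
      then show ?thesis using 1 unfolding upt by simp
    next
      case 2
      have z: "?E (x # xs) V = 0" if "V \<in> Pow I" for V
        using that 2 ymono I(4) by (intro mean_bsum_eq_0[OF p r inj ls]) force+
      show ?thesis
      proof (cases xs)
        case Nil
        have e: "?E [x] (insert v V) = (if V = {} then 1 else 0)" if "V \<in> Pow I" for V
        proof -
          have "?E [x] (insert v V) = (if insert v V = {v} then 1 else 0)"
            by (intro mean_bsum_singleton[OF p r inj ls]) (use that 2 ymono I in auto)
          moreover have "insert v V = {v} \<longleftrightarrow> V = {}" using that I(2) by auto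
          ultimately show ?thesis by simp
        qed
        have "torus_mean ls (\<lambda>\<xi>. wsum p a (x # xs) y {a<..N} (scal r \<xi>))
            = (\<Sum>V\<in>Pow I. if V = {} then 1 else 0)"
          unfolding expand using z e
          by (intro sum.cong) (auto simp: Nil kappa_def v_def)
        also have "\<dots> = 1" using I(3) by (simp add: sum.delta)
        finally show ?thesis using 2 True unfolding upt by (simp add: Nil)
      next
        case xs: (Cons x' xs')
        have "of_real (kappa p a (length (x # xs)) (insert v V)) * ?E (x # xs) (insert v V)
            = of_real (kappa p v (length xs) V) * ?E xs V" if V: "V \<in> Pow I" for V
        proof -
          have E: "?E (x # xs) (insert v V) = ?E xs V"
            unfolding xs using V I 2 ymono vless
            by (intro mean_bsum_head[OF p r inj ls]) auto
          show ?thesis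
          proof (cases "length xs \<le> card V")
            case True
            have "finite V" using V I(3) finite_subset by auto
            then have "kappa p a (length (x # xs)) (insert v V) = kappa p v (length xs) V"
              using kappa_head[of V a "length xs" p] True V I(2) by (auto simp: v_def)
            then show ?thesis by (simp only: E)
          next
            case False
            then have "?E xs V = 0" by (simp add: bsum_short)
            then show ?thesis by (simp only: E mult_zero_right)
          qed
        qed
        then have "torus_mean ls (\<lambda>\<xi>. wsum p a (x # xs) y {a<..N} (scal r \<xi>))
           = torus_mean ls (\<lambda>\<xi>. wsum p v xs y {v<..N} (scal r \<xi>))"
          unfolding expand mean_wsum' I_def[symmetric] using z by (intro sum.cong) auto
        also have "\<dots> = (if v + length xs \<le> N \<and> map y [v + 1..<v + 1 + length xs] = xs then 1 else 0)"
          using Cons.prems xs by (intro Cons.IH) (auto simp: strict_mono_on_def v_def)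
        finally show ?thesis using 2 unfolding upt by (simp add: v_def)
      qed
    next
      case 3
      \<comment> \<open>Each set cancels against its enlargement by the first label:
        \<open>kappa_insert\<close> matches the coefficient of the residue at 1, whose sign is
        negative.\<close>
      have "of_real (kappa p a (length (x # xs)) V) * ?E (x # xs) V
           + of_real (kappa p a (length (x # xs)) (insert v V)) * ?E (x # xs) (insert v V) = 0"
        if V: "V \<in> Pow I" for V
      proof -
        have fin: "finite V" using V I(3) finite_subset by auto
        let ?c = "real (card V + 2 - length (x # xs)) * p ^ (length (x # xs) - 1) / (1 - p) ^ card V"
        have E: "?E (x # xs) (insert v V) = - of_real ?c * ?E (x # xs) V"
        proof -
          have "inj_on r V" by (rule inj_on_subset[OF inj]) (use V I(4) in auto)
          then have "?E (x # xs) (insert v V) = - (of_nat (card V + 2 - length (x # xs))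
              * of_real p ^ (length (x # xs) - 1) / of_real (1 - p) ^ card V) * ?E (x # xs) V"
            using V I vless ymono 3 Cons.prems ls fin
            by (intro torus_mean_bsum_residue[OF p r]) auto
          then show ?thesis by simp
        qed
        show ?thesis
        proof (cases "length (x # xs) \<le> card V")
          case True
          have "kappa p a (length (x # xs)) (insert v V) * ?c = kappa p a (length (x # xs)) V"
            unfolding v_def by (rule kappa_insert[OF p fin]) (use True V I(2) in \<open>auto simp: v_def\<close>)
          then have "complex_of_real (kappa p a (length (x # xs)) V)
              = of_real (kappa p a (length (x # xs)) (insert v V)) * of_real ?c"
            by (metis of_real_mult)
          then show ?thesis unfolding E by simp
        next
          case False
          then have "?E (x # xs) V = 0" by (simp add: bsum_short)
          then show ?thesis by (simp only: E mult_zero_right add_0_right)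
        qed
      qed
      then have "torus_mean ls (\<lambda>\<xi>. wsum p a (x # xs) y {a<..N} (scal r \<xi>)) = 0"
        unfolding expand by (intro sum.neutral) auto
      then show ?thesis using 3 unfolding upt by simp
    qed
  qed
qed simp

end


section \<open>Passage to the limit in \<open>p\<close> and in the radii\<close>

lemma sum_ge_triangle:
  assumes "finite V" "\<And>i. i \<in> V \<Longrightarrow> i \<ge> (1::nat)"
  shows "card V * (card V + 1) \<le> 2 * \<Sum>V"
  using assms
proof (induction V rule: finite_linorder_max_induct)
  case (insert b A)
  have "A \<subseteq> {1..<b}" using insert by auto
  then have "card A \<le> b - 1" using card_mono[of "{1..<b}" A] by simp
  moreover have "b \<ge> 1" using insert by auto
  ultimately have "card A + 1 \<le> b" by linarith
  moreover have "b \<notin> A" using insert by auto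
  ultimately show ?case using insert by simp
qed simp

text \<open>A set of n = m + k - 1 positive labels has sum at least n (n + 1) / 2, so the exponent
  is at least k (k - 1) / 2. A negative power of \<tau> would not extend continuously to p = 0; for
  exponent 0 the convention \<tau>^0 = 1 is the limit.\<close>

lemma kappa_exponent_nonneg:
  assumes "finite V" "V \<subseteq> {1..}" "1 \<le> m" "m \<le> card V"
  shows "0 \<le> (\<Sum>i\<in>V. int i - int 0) - int (m * (m - 1) div 2) - int m * int (card V + 1 - m)"
proof -
  define k where "k = card V + 1 - m"
  have n: "card V + 1 = m + k" "k \<ge> 1" using assms by (auto simp: k_def)
  have "card V * (card V + 1) \<le> 2 * \<Sum>V"
    using assms(1,2) by (intro sum_ge_triangle) auto
  then have "int (card V * (card V + 1)) \<le> int (2 * \<Sum>V)" by (rule zle_int[THEN iffD2])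
  then have "int (card V) * (int (card V) + 1) \<le> 2 * int (\<Sum>V)"
    by (simp only: of_nat_mult of_nat_add of_nat_1 of_nat_numeral)
  moreover have "int (card V) = int m + int k - 1" using n by linarith
  ultimately have "(int m + int k - 1) * (int m + int k) \<le> 2 * int (\<Sum>V)" by simp
  moreover have "(int m + int k - 1) * (int m + int k)
      = int m * (int m - 1) + 2 * (int m * int k) + int k * (int k - 1)"
    by (simp add: algebra_simps)
  moreover have "0 \<le> int k * (int k - 1)" using n by simp
  moreover have "2 * int (m * (m - 1) div 2) \<le> int m * (int m - 1)"
  proof -
    have "int (m * (m - 1)) = int m * (int m - 1)" using assms(3) by (simp add: of_nat_diff)
    moreover have "int (2 * (m * (m - 1) div 2)) \<le> int (m * (m - 1))"
      by (rule zle_int[THEN iffD2]) simp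
    ultimately show ?thesis by (simp only: of_nat_mult of_nat_numeral)
  qed
  ultimately show ?thesis unfolding k_def[symmetric] by simp
qed

lemma continuous_on_kappa:
  assumes "continuous_on A P" "\<And>x. x \<in> A \<Longrightarrow> P x < 1"
    and "finite V" "V \<subseteq> {1..}" "1 \<le> m" "m \<le> card V"
  shows "continuous_on A (\<lambda>x. kappa (P x) 0 m V)"
proof -
  define e where "e = (\<Sum>i\<in>V. int i - int 0) - int (m * (m - 1) div 2) - int m * int (card V + 1 - m)"
  have "e \<ge> 0" unfolding e_def by (rule kappa_exponent_nonneg[OF assms(3-6)])
  then have "kappa q 0 m V = (q / (1 - q)) ^ nat e
      * (1 - q) ^ ((card V + 1 - m) * (card V + 1 - m - 1) div 2) / fact (card V + 1 - m)" for q
    unfolding kappa_def Let_def e_def[symmetric] by (simp add: power_int_def)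
  moreover have "1 - P x \<noteq> 0" if "x \<in> A" for x using assms(2)[OF that] by simp
  ultimately show ?thesis
    using assms(1) by (auto intro!: continuous_intros)
qed

text \<open>Both degeneracies are removed by one parameter s: \<open>p\<close> becomes p + s, and
  the radius of variable i becomes R + s i. The identity holds for small s > 0, its right-hand side
  is constant in s, and its left-hand side is continuous at 0.\<close>

theorem torus_mean_wsum_initial_closed:
  assumes p: "0 \<le> p" "p < 1" and R: "R > 4 / (1 - p)" and ls: "{1..N} \<subseteq> set ls"
    and xs: "sorted_wrt (<) xs" "xs \<noteq> []" and y: "strict_mono_on {0<..N} y"
  shows "torus_mean ls (\<lambda>\<xi>. wsum p 0 xs y {0<..N} (scal (\<lambda>_. R) \<xi>))
      = (if length xs \<le> N \<and> map y [1..<1 + length xs] = xs then 1 else 0)" (is "_ = ?d")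
proof -
  have R0: "R > 0" using R p by (smt (verit) divide_nonneg_pos)
  \<comment> \<open>Half of the slack in 1 - p > 4 / R, so that the bound on the radius persists for
    p + s with \<open>s \<le> e\<close>.\<close>
  define e where "e = ((1 - p) - 4 / R) / 2"
  have e: "e > 0" using R R0 p by (simp add: e_def field_simps)
  have e1: "1 - p - e > 4 / R" using e by (simp add: e_def field_simps)
  then have e2: "p + e < 1" using R0 by (smt (verit) divide_nonneg_pos)
  define P where "P = (\<lambda>s::real. p + s)"
  define rr where "rr = (\<lambda>(s::real) (i::nat). R + s * real i)"
  have P: "0 \<le> P s" "P s < 1" "rr s i > 4 / (1 - P s)" if "s \<in> {0..e}" for s i
  proof -
    show "0 \<le> P s" "P s < 1" using that p e2 by (auto simp: P_def)
    have "4 / R < 1 - P s" using that e1 by (auto simp: P_def)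
    moreover have "1 - P s > 0" using that e2 by (simp add: P_def)
    ultimately have "4 / (1 - P s) < R" using R0 by (simp add: field_simps)
    also have "R \<le> rr s i" using that by (simp add: rr_def)
    finally show "rr s i > 4 / (1 - P s)" .
  qed
  define G where "G = (\<lambda>s. \<Sum>V\<in>Pow {0<..N}. of_real (kappa (P s) 0 (length xs) V)
      * torus_mean ls (\<lambda>\<xi>. bsum (P s) xs y V (scal (rr s) \<xi>)))"
  have G: "torus_mean ls (\<lambda>\<xi>. wsum (P s) 0 xs y {0<..N} (scal (rr s) \<xi>)) = G s" if "s \<in> {0..e}" for s
  proof -
    have "continuous_on torus (\<lambda>\<xi>. bsum (P s) xs y V (scal (rr s) \<xi>))" for V
      using P[OF that] by (intro continuous_on_bsum continuous_on_const continuous_on_scal good_scal) auto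
    then show ?thesis unfolding wsum_def G_def
      by (subst torus_mean_sum) (auto intro!: continuous_on_mult continuous_on_const simp: torus_mean_cmult)
  qed
  have contG: "continuous_on {0..e} G"
    unfolding G_def
  proof (rule continuous_on_sum)
    fix V assume V: "V \<in> Pow {0<..N}"
    then have fin: "finite V" using finite_subset by blast
    show "continuous_on {0..e} (\<lambda>s. of_real (kappa (P s) 0 (length xs) V)
      * torus_mean ls (\<lambda>\<xi>. bsum (P s) xs y V (scal (rr s) \<xi>)))"
    proof (cases "length xs \<le> card V")
      case False
      then show ?thesis by (simp add: bsum_short)
    next
      case True
      have "continuous_on {0..e} (\<lambda>s. kappa (P s) 0 (length xs) V)"
        using P xs V True fin by (intro continuous_on_kappa)
          (auto simp: P_def intro!: continuous_intros simp: Suc_le_eq)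
      moreover have "continuous_on ({0..e} \<times> torus) (\<lambda>(s, \<xi>). bsum (P s) xs y V (scal (rr s) \<xi>))"
      proof -
        have "continuous_on ({0..e} \<times> torus) (\<lambda>x. bsum (P (fst x)) xs y V (scal (rr (fst x)) (snd x)))"
        proof (rule continuous_on_bsum)
          show "continuous_on ({0..e} \<times> torus) (\<lambda>x. P (fst x))"
            unfolding P_def by (intro continuous_intros)
          have c: "continuous_on ({0..e} \<times> torus) (\<lambda>x. snd x i)" for i
            by (intro continuous_on_coordinate continuous_on_snd continuous_on_id)
          show "continuous_on ({0..e} \<times> torus) (\<lambda>x. scal (rr (fst x)) (snd x) i)" for i
            unfolding scal_def rr_def by (intro continuous_intros c)
        qed (use P in \<open>auto intro!: good_scal\<close>)
        then show ?thesis by (simp add: split_def)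
      qed
      from continuous_on_torus_mean[OF this]
      have "continuous_on {0..e} (\<lambda>s. torus_mean ls (\<lambda>\<xi>. bsum (P s) xs y V (scal (rr s) \<xi>)))" .
      ultimately show ?thesis by (intro continuous_on_mult continuous_on_of_real)
    qed
  qed
  have constG: "G s = ?d" if "s \<in> {0<..<e}" for s
  proof -
    have s: "s \<in> {0..e}" using that by auto
    have "inj_on (rr s) {..N}" using that by (auto simp: inj_on_def rr_def)
    moreover have "0 < P s" using that p by (simp add: P_def)
    ultimately show ?thesis
      using torus_mean_wsum_initial[of "P s" "rr s" N ls xs 0 y] P[OF s] ls xs y
      by (simp add: G[OF s, symmetric])
  qed
  have cl: "closure {0<..<e} = {0..e}" using e by simp
  have "G 0 = ?d"
  proof (rule continuous_constant_on_closure[where f = G and S = "{0<..<e}" and x = 0])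
    show "continuous_on (closure {0<..<e}) G" unfolding cl by (rule contG)
    show "0 \<in> closure {0<..<e}" unfolding cl using e by simp
  qed (rule constG)
  moreover have "P 0 = p" "rr 0 = (\<lambda>_. R)" by (auto simp: P_def rr_def)
  ultimately show ?thesis using G[of 0] e by simp
qed


section \<open>The boundary condition and the dynamics\<close>

definition etot :: "real \<Rightarrow> nat set \<Rightarrow> (nat \<Rightarrow> complex) \<Rightarrow> complex" where
  "etot p V \<eta> = (\<Sum>i\<in>V. epsA p (\<eta> i))"

text \<open>The weight \<open>H\<close> is kept abstract, since the boundary condition needs only
  its invariance under relabelling. It will be a power for the jump chain and an exponential at time
  t.\<close>

definition phi :: "real \<Rightarrow> real \<Rightarrow> nat \<Rightarrow> int list \<Rightarrow> (nat set \<Rightarrow> (nat \<Rightarrow> complex) \<Rightarrow> complex) \<Rightarrow> (nat \<Rightarrow> int) \<Rightarrow> complex" where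
  "phi p R N xs H y = torus_mean [1..<Suc N] (\<lambda>\<xi>. \<Sum>V\<in>Pow {1..N}.
     of_real (kappa p 0 (length xs) V)
       * (bsum p xs y V (scal (\<lambda>_. R) \<xi>) * H V (scal (\<lambda>_. R) \<xi>)))"

lemma denom_relabel:
  assumes "inj_on f V" "\<And>a b. a \<in> V \<Longrightarrow> b \<in> V \<Longrightarrow> f a < f b \<longleftrightarrow> a < b"
  shows "denom p (f ` V) \<eta> = denom p V (\<eta> \<circ> f)"
proof -
  have "lt_pairs (f ` V) = map_prod f f ` lt_pairs V"
    using assms(2) by (auto simp: lt_pairs_def image_iff)
  moreover have "inj_on (map_prod f f) (lt_pairs V)"
    using assms(1) by (auto simp: inj_on_def lt_pairs_def)
  ultimately have "fprod p (f ` V) \<eta> = fprod p V (\<eta> \<circ> f)"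
    unfolding fprod_def by (simp add: prod.reindex split_def)
  then show ?thesis
    using assms(1) by (simp add: denom_def prod.reindex)
qed

text \<open>The exponent increases by one with the label. Its being non-negative matters at p = 0,
  where \<tau> = 0 and exponents of either sign could not be added.\<close>

lemma kappa_shift_label:
  assumes U: "finite U" "i \<notin> U" "Suc i \<notin> U" "U \<subseteq> {1..}" "1 \<le> i" and m: "1 \<le> m" "m \<le> card U + 1"
  shows "kappa p 0 m (insert (Suc i) U) = p / (1 - p) * kappa p 0 m (insert i U)"
proof -
  have c: "card (insert (Suc i) U) = card (insert i U)" using U by simp
  define e where "e = (\<Sum>l\<in>insert i U. int l - int 0) - int (m * (m - 1) div 2)
      - int m * int (card (insert i U) + 1 - m)"
  have "e \<ge> 0"
    unfolding e_def by (rule kappa_exponent_nonneg) (use U m in auto)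
  then have pw: "(p / (1 - p)) powi (e + 1) = (p / (1 - p)) powi e * (p / (1 - p))"
    by (intro power_int_add_1) auto
  have ex: "(\<Sum>l\<in>insert (Suc i) U. int l - int 0) - int (m * (m - 1) div 2)
      - int m * int (card (insert i U) + 1 - m) = e + 1"
    using U by (simp add: e_def)
  show ?thesis
    unfolding kappa_def Let_def c ex pw e_def[symmetric] by simp
qed

context
  fixes p R :: real and N :: nat and xs :: "int list"
    and H :: "nat set \<Rightarrow> (nat \<Rightarrow> complex) \<Rightarrow> complex"
  assumes p: "0 \<le> p" "p < 1" and R: "R > 4 / (1 - p)" and xs: "xs \<noteq> []"
    and H_cont: "\<And>V. V \<subseteq> {1..N} \<Longrightarrow> continuous_on torus (\<lambda>\<xi>. H V (scal (\<lambda>_. R) \<xi>))"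
    and H_relabel: "\<And>V f \<eta>. inj_on f V \<Longrightarrow> H (f ` V) \<eta> = H V (\<eta> \<circ> f)"
begin

abbreviation "sc \<equiv> scal (\<lambda>_. R)"

lemma sc_good: "\<xi> \<in> torus \<Longrightarrow> good p (sc \<xi> i)"
  using good_scal[OF R] p by simp

lemma sc_comp: "sc (\<xi> \<circ> f) = sc \<xi> \<circ> f"
  by (simp add: scal_def comp_def)

lemma cont_bsum_H:
  assumes "V \<subseteq> {1..N}"
  shows "continuous_on torus (\<lambda>\<xi>. bsum p xs y V (sc \<xi>) * H V (sc \<xi>))"
  using p by (intro continuous_on_mult continuous_on_bsum continuous_on_const continuous_on_scal H_cont assms)
    (auto simp: sc_good)

lemma phi_eq:
  "phi p R N xs H y = (\<Sum>V\<in>Pow {1..N}. of_real (kappa p 0 (length xs) V)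
     * torus_mean [1..<Suc N] (\<lambda>\<xi>. bsum p xs y V (sc \<xi>) * H V (sc \<xi>)))"
  unfolding phi_def
  by (subst torus_mean_sum) (auto intro!: continuous_on_mult[OF continuous_on_const] cont_bsum_H
      simp: torus_mean_cmult)

text \<open>On the right two particles share a site. These are not states of the process, but the
  formula makes sense for them. The sets V are grouped by which of the labels i and i + 1 they
  contain.\<close>

lemma phi_boundary:
  assumes i: "1 \<le> i" "Suc i \<le> N" and y: "y (Suc i) = y i + 1"
  shows "phi p R N xs H y = of_real p * phi p R N xs H (y(i := y i + 1))
     + of_real (1 - p) * phi p R N xs H (y(Suc i := y i))"
proof -
  define j where "j = Suc i"
  define ls where "ls = [1..<Suc N]"
  define q where "q = complex_of_real (1 - p)"
  define \<pi> where "\<pi> = Transposition.transpose i j"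
  have pq: "complex_of_real p = 1 - q" by (simp add: q_def)
  define D where "D = (\<lambda>V \<xi>. bsum p xs y V (sc \<xi>) * H V (sc \<xi>)
     - of_real p * (bsum p xs (y(i := y i + 1)) V (sc \<xi>) * H V (sc \<xi>))
     - q * (bsum p xs (y(j := y i)) V (sc \<xi>) * H V (sc \<xi>)))"
  define K where "K = (\<lambda>V. complex_of_real (kappa p 0 (length xs) V))"
  have D_cont: "continuous_on torus (D V)" if "V \<subseteq> {1..N}" for V
    unfolding D_def using that
    by (intro continuous_on_diff continuous_on_mult[OF continuous_on_const] cont_bsum_H)
  have meanD: "torus_mean ls (D V) = torus_mean ls (\<lambda>\<xi>. bsum p xs y V (sc \<xi>) * H V (sc \<xi>))
     - of_real p * torus_mean ls (\<lambda>\<xi>. bsum p xs (y(i := y i + 1)) V (sc \<xi>) * H V (sc \<xi>))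
     - q * torus_mean ls (\<lambda>\<xi>. bsum p xs (y(j := y i)) V (sc \<xi>) * H V (sc \<xi>))" if "V \<subseteq> {1..N}" for V
    unfolding D_def using that
    by (simp add: torus_mean_diff torus_mean_cmult continuous_on_diff
        continuous_on_mult[OF continuous_on_const] cont_bsum_H)
  define I where "I = {1..N} - {i, j}"
  have I: "{1..N} = insert i (insert j I)" "i \<notin> insert j I" "j \<notin> I" "finite I" "finite (insert j I)"
    using i by (auto simp: I_def j_def)
  have Isub: "I \<subseteq> {1..N}" "i \<in> {1..N}" "j \<in> {1..N}" using i by (auto simp: I_def j_def)
  have ij: "i \<noteq> j" by (simp add: j_def)
  have \<pi>[simp]: "\<pi> i = j" "\<pi> j = i" by (auto simp: \<pi>_def)
  have \<pi>U: "\<pi> l = l" if "l \<in> I" for l using that by (auto simp: \<pi>_def I_def)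
  have inj\<pi>: "inj_on \<pi> V" for V
    unfolding \<pi>_def by (metis inj_on_subset inj_transpose subset_UNIV)
  have mean_\<pi>: "torus_mean ls (\<lambda>\<xi>. F (\<xi> \<circ> \<pi>)) = torus_mean ls F" if "continuous_on torus F" for F
    unfolding \<pi>_def using i that by (intro torus_mean_transpose) (auto simp: ls_def j_def)
  define mU where "mU = (\<lambda>U (\<eta>::nat \<Rightarrow> complex). \<Prod>l\<in>U. \<eta> l powi (- y l))"
  have mU\<pi>: "mU U (\<eta> \<circ> \<pi>) = mU U \<eta>" if "U \<subseteq> I" for U \<eta>
    unfolding mU_def using that \<pi>U by (intro prod.cong) auto
  have b: "bsum p xs y' V \<eta> = bethe_sum p xs V \<eta> / denom p V \<eta> * (\<Prod>l\<in>V. \<eta> l powi (- y' l))" for y' V \<eta>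
    by (simp add: bsum_def)
  have key: "K U * torus_mean ls (D U) + K (insert j U) * torus_mean ls (D (insert j U))
     + (K (insert i U) * torus_mean ls (D (insert i U))
        + K (insert i (insert j U)) * torus_mean ls (D (insert i (insert j U)))) = 0" if U: "U \<in> Pow I" for U
  proof -
    have fin: "finite U" using U I(4) finite_subset by auto
    have iU: "i \<notin> U" "j \<notin> U" using U by (auto simp: I_def)
    have sub: "U \<subseteq> {1..N}" "insert i U \<subseteq> {1..N}" "insert j U \<subseteq> {1..N}" "insert i (insert j U) \<subseteq> {1..N}"
      using U Isub by auto
    have mu: "(\<Prod>l\<in>U. \<eta> l powi (- y' l)) = mU U \<eta>" if "\<And>l. l \<in> U \<Longrightarrow> y' l = y l" for y' \<eta>
      unfolding mU_def using that by (intro prod.cong) auto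
    have mu1: "(\<Prod>l\<in>U. \<eta> l powi (- (y(i := c)) l)) = mU U \<eta>" "(\<Prod>l\<in>U. \<eta> l powi (- (y(j := c)) l)) = mU U \<eta>" for c \<eta>
      using iU by (auto intro!: mu)
    \<comment> \<open>Neither label present: the three integrands agree, and 1 = p + q.\<close>
    have D0: "torus_mean ls (D U) = 0"
    proof -
      have "D U \<xi> = 0" for \<xi>
      proof -
        define X where "X = bethe_sum p xs U (sc \<xi>) / denom p U (sc \<xi>)"
        show ?thesis
          unfolding D_def b mu1 mu[OF refl] pq X_def[symmetric] by (simp add: algebra_simps)
      qed
      then have "torus_mean ls (D U) = torus_mean ls (\<lambda>_. 0)" by (intro torus_mean_cong)
      then show ?thesis by simp
    qed
    \<comment> \<open>Both present: the three monomials combine to a multiple of f(\<xi>_i,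
      \<xi>_j), which cancels the one factor of the denominator that is not symmetric in the two
      variables. The remainder is antisymmetric and has mean 0.\<close>
    have D2: "torus_mean ls (D (insert i (insert j U))) = 0"
    proof -
      let ?V = "insert i (insert j U)"
      define F where "F = (\<lambda>(\<eta>::nat \<Rightarrow> complex) n. \<Prod>l\<in>U. if l < n then fA p (\<eta> l) (\<eta> n) else fA p (\<eta> n) (\<eta> l))"
      have F\<pi>: "F (\<eta> \<circ> \<pi>) i = F \<eta> j" "F (\<eta> \<circ> \<pi>) j = F \<eta> i" for \<eta>
      proof -
        have less: "l < i \<longleftrightarrow> l < j" if "l \<in> U" for l using that iU by (auto simp: j_def less_Suc_eq)
        show "F (\<eta> \<circ> \<pi>) i = F \<eta> j" "F (\<eta> \<circ> \<pi>) j = F \<eta> i"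
          unfolding F_def using U \<pi>U less by (auto intro!: prod.cong)
      qed
      define Q where "Q = (\<lambda>\<eta>. (\<Prod>l\<in>?V. 1 - \<eta> l) * (F \<eta> i * F \<eta> j * fprod p U \<eta>))"
      have denom: "denom p ?V \<eta> = fA p (\<eta> i) (\<eta> j) * Q \<eta>" for \<eta>
      proof -
        have "fprod p ?V \<eta> = (fA p (\<eta> i) (\<eta> j) * F \<eta> i) * (F \<eta> j * fprod p U \<eta>)"
          using iU ij fin by (simp add: fprod_insert F_def j_def)
        then show ?thesis by (simp add: denom_def Q_def mult_ac)
      qed
      have Q\<pi>: "Q (\<eta> \<circ> \<pi>) = Q \<eta>" for \<eta>
      proof -
        have "(\<Prod>l\<in>?V. 1 - (\<eta> \<circ> \<pi>) l) = (\<Prod>l\<in>?V. 1 - \<eta> l)"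
        proof -
          have "(\<Prod>l\<in>U. 1 - \<eta> (\<pi> l)) = (\<Prod>l\<in>U. 1 - \<eta> l)"
            using U \<pi>U by (intro prod.cong) auto
          then show ?thesis using iU ij fin by (simp add: mult_ac)
        qed
        moreover have "fprod p U (\<eta> \<circ> \<pi>) = fprod p U \<eta>"
          using U \<pi>U by (intro fprod_cong) auto
        ultimately show ?thesis by (simp only: Q_def F\<pi> mult_ac)
      qed
      \<comment> \<open>Both variables now carry the exponent \<open>- y i - 1\<close>, so only the
        Bethe sum changes under the exchange.\<close>
      define Z where "Z = (\<lambda>\<eta>. bethe_sum p xs ?V \<eta> / Q \<eta> * (mU U \<eta> * (\<eta> i powi (- y i - 1) * \<eta> j powi (- y i - 1))) * H ?V \<eta>)"
      have DZ: "D ?V \<xi> = - Z (sc \<xi>)" if \<xi>: "\<xi> \<in> torus" for \<xi>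
      proof -
        define \<eta> where "\<eta> = sc \<xi>"
        have g: "good p (\<eta> l)" for l unfolding \<eta>_def by (rule sc_good[OF \<xi>])
        have nz: "\<eta> i \<noteq> 0" "\<eta> j \<noteq> 0" "fA p (\<eta> i) (\<eta> j) \<noteq> 0"
          using good_nonzero(1)[OF p g] fA_nonzero[OF p g g] by auto
        have P: "(\<Prod>l\<in>?V. \<eta> l powi (- y' l)) = \<eta> i powi (- y' i) * (\<eta> j powi (- y' j) * (\<Prod>l\<in>U. \<eta> l powi (- y' l)))" for y'
          using iU ij fin by simp
        have s: "z powi (- y i) = z powi (- y i - 1) * z" if "z \<noteq> 0" for z :: complex
          using that power_int_add_1[of z "- y i - 1"] by simp
        have s': "z powi (- (y i + 1)) = z powi (- y i - 1)" for z :: complex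
          by (rule arg_cong[of _ _ "\<lambda>n. z powi n"]) simp
        define a where "a = \<eta> i powi (- y i - 1)"
        define c where "c = \<eta> j powi (- y i - 1)"
        have P1: "(\<Prod>l\<in>?V. \<eta> l powi (- y l)) = (a * \<eta> i) * (c * mU U \<eta>)"
          unfolding P mu[OF refl] y[folded j_def] s' s[OF nz(1)] a_def c_def ..
        have P2: "(\<Prod>l\<in>?V. \<eta> l powi (- (y(i := y i + 1)) l)) = a * (c * mU U \<eta>)"
          unfolding P mu1 using ij by (simp add: y[folded j_def] s' a_def c_def)
        have P3: "(\<Prod>l\<in>?V. \<eta> l powi (- (y(j := y i)) l)) = (a * \<eta> i) * ((c * \<eta> j) * mU U \<eta>)"
          unfolding P mu1 using ij by (simp add: s[OF nz(1)] s[OF nz(2)] a_def c_def)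
        have comb: "\<eta> i - of_real p - q * \<eta> i * \<eta> j = - fA p (\<eta> i) (\<eta> j)"
          by (simp add: fA_def q_def)
        define X where "X = bethe_sum p xs ?V \<eta> / denom p ?V \<eta>"
        have "D ?V \<xi> = X * (a * c * mU U \<eta>) * H ?V \<eta> * (\<eta> i - of_real p - q * \<eta> i * \<eta> j)"
          unfolding D_def b \<eta>_def[symmetric] P1 P2 P3 X_def[symmetric] by (simp add: algebra_simps)
        also have "\<dots> = - (X * fA p (\<eta> i) (\<eta> j)) * (mU U \<eta> * (a * c)) * H ?V \<eta>"
          unfolding comb by (simp add: mult_ac)
        also have "X * fA p (\<eta> i) (\<eta> j) = bethe_sum p xs ?V \<eta> / Q \<eta>"
          unfolding X_def denom using nz(3) by simp
        finally show ?thesis by (simp add: Z_def \<eta>_def[symmetric] a_def c_def)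
      qed
      have Z\<pi>: "Z (\<eta> \<circ> \<pi>) = - Z \<eta>" for \<eta>
      proof -
        have "bethe_sum p xs ?V (\<eta> \<circ> \<pi>) = - bethe_sum p xs ?V \<eta>"
          unfolding \<pi>_def by (rule bethe_sum_transpose) (use ij in auto)
        moreover have "H ?V (\<eta> \<circ> \<pi>) = H ?V \<eta>"
        proof -
          have "\<pi> ` U = U" using U \<pi>U by force
          then have "\<pi> ` ?V = ?V" by auto
          then show ?thesis using H_relabel[OF inj\<pi>, of ?V \<eta>] by simp
        qed
        moreover have "mU U (\<eta> \<circ> \<pi>) = mU U \<eta>" using U by (intro mU\<pi>) auto
        ultimately show ?thesis unfolding Z_def Q\<pi> by (simp add: mult_ac)
      qed
      have "continuous_on torus (D ?V)" by (rule D_cont[OF sub(4)])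
      then have "torus_mean ls (D ?V) = torus_mean ls (\<lambda>\<xi>. D ?V (\<xi> \<circ> \<pi>))"
        by (rule mean_\<pi>[symmetric])
      also have "\<dots> = torus_mean ls (\<lambda>\<xi>. - D ?V \<xi>)"
      proof (rule torus_mean_cong)
        fix \<xi> :: "nat \<Rightarrow> complex" assume \<xi>: "\<xi> \<in> torus"
        then have "\<xi> \<circ> \<pi> \<in> torus" by (simp add: torus_def)
        then show "D ?V (\<xi> \<circ> \<pi>) = - D ?V \<xi>"
          using \<xi> by (simp only: DZ sc_comp Z\<pi>)
      qed
      also have "\<dots> = - torus_mean ls (D ?V)" by (rule torus_mean_uminus)
      finally show ?thesis by simp
    qed
    \<comment> \<open>One present: exchanging the variables carries one term to the other, with
      factors p and - q, and the ratio p / q of the weights makes the two cancel.\<close>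
    have D1: "K (insert j U) * torus_mean ls (D (insert j U)) + K (insert i U) * torus_mean ls (D (insert i U)) = 0"
    proof (cases "length xs \<le> card U + 1")
      case False
      have "card (insert i U) < length xs" "card (insert j U) < length xs"
        using False fin iU by auto
      then have "D (insert i U) = (\<lambda>_. 0)" "D (insert j U) = (\<lambda>_. 0)"
        by (auto simp: D_def bsum_short)
      then show ?thesis by simp
    next
      case True
      define X where "X = (\<lambda>n \<xi>. bethe_sum p xs (insert n U) (sc \<xi>) / denom p (insert n U) (sc \<xi>)
         * (mU U (sc \<xi>) * (sc \<xi> n powi (- y i) - sc \<xi> n powi (- y i - 1))) * H (insert n U) (sc \<xi>))"
      have Dj: "D (insert j U) \<xi> = - q * X j \<xi>" if \<xi>: "\<xi> \<in> torus" for \<xi>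
      proof -
        have P: "(\<Prod>l\<in>insert j U. \<eta> l powi (- y' l)) = \<eta> j powi (- y' j) * (\<Prod>l\<in>U. \<eta> l powi (- y' l))" for y' and \<eta> :: "nat \<Rightarrow> complex"
          using iU fin by simp
        have yj: "y j = y i + 1" using y by (simp add: j_def)
        define B where "B = bethe_sum p xs (insert j U) (sc \<xi>) / denom p (insert j U) (sc \<xi>)"
        show ?thesis
          unfolding D_def b P mu1 mu[OF refl] X_def pq B_def[symmetric]
          using ij by (simp add: yj right_diff_distrib left_diff_distrib mult_ac)
      qed
      have Di: "D (insert i U) \<xi> = of_real p * X i \<xi>" if \<xi>: "\<xi> \<in> torus" for \<xi>
      proof -
        have P: "(\<Prod>l\<in>insert i U. \<eta> l powi (- y' l)) = \<eta> i powi (- y' i) * (\<Prod>l\<in>U. \<eta> l powi (- y' l))" for y' and \<eta> :: "nat \<Rightarrow> complex"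
          using iU fin by simp
        define B where "B = bethe_sum p xs (insert i U) (sc \<xi>) / denom p (insert i U) (sc \<xi>)"
        show ?thesis
          unfolding D_def b P mu1 mu[OF refl] X_def pq B_def[symmetric]
          using ij by (simp add: right_diff_distrib left_diff_distrib mult_ac)
      qed
      have Xc: "continuous_on torus (X n)" if n: "n \<in> {i, j}" for n
      proof -
        have nz: "sc \<xi> l \<noteq> 0" if "\<xi> \<in> torus" for \<xi> l
          using good_nonzero(1)[OF p sc_good[OF that]] .
        have dn: "denom p (insert n U) (sc \<xi>) \<noteq> 0" if "\<xi> \<in> torus" for \<xi>
          by (rule denom_nonzero[OF p _ sc_good[OF that]]) (use fin in simp)
        show ?thesis
          unfolding X_def mU_def using nz dn n sub
          by (intro continuous_on_mult continuous_on_divide continuous_on_bethe_sum continuous_on_denom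
              continuous_on_const continuous_on_scal continuous_on_prod continuous_on_power_int
              continuous_on_diff H_cont) auto
      qed
      have XX: "X j \<xi> = X i (\<xi> \<circ> \<pi>)" for \<xi>
      proof -
        have im: "\<pi> ` insert i U = insert j U" using U \<pi>U by force
        \<comment> \<open>\<open>j\<close> is the successor of \<open>i\<close>, so no label of
          \<open>U\<close> lies between them and the exchange preserves the order.\<close>
        have mono: "\<pi> a < \<pi> b \<longleftrightarrow> a < b" if "a \<in> insert i U" "b \<in> insert i U" for a b
        proof -
          have *: "\<pi> l = (if l = i then Suc i else l) \<and> l \<noteq> Suc i" if "l \<in> insert i U" for l
            using that U \<pi>U iU by (auto simp: j_def)
          have "(if a = i then Suc i else a) < (if b = i then Suc i else b) \<longleftrightarrow> a < b"
            using *[OF that(1)] *[OF that(2)] by arith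
          then show ?thesis using *[OF that(1)] *[OF that(2)] by simp
        qed
        have 1: "bethe_sum p xs (insert j U) (sc \<xi>) = bethe_sum p xs (insert i U) (sc \<xi> \<circ> \<pi>)"
          unfolding im[symmetric] by (rule bethe_sum_relabel[OF inj\<pi>]) (rule mono)
        have 2: "denom p (insert j U) (sc \<xi>) = denom p (insert i U) (sc \<xi> \<circ> \<pi>)"
          unfolding im[symmetric] by (rule denom_relabel[OF inj\<pi>]) (rule mono)
        have 3: "H (insert j U) (sc \<xi>) = H (insert i U) (sc \<xi> \<circ> \<pi>)"
          unfolding im[symmetric] by (rule H_relabel[OF inj\<pi>])
        show ?thesis
          unfolding X_def sc_comp 1 2 3 using U by (simp add: mU\<pi>)
      qed
      have "torus_mean ls (D (insert j U)) = torus_mean ls (\<lambda>\<xi>. - q * X j \<xi>)"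
        by (rule torus_mean_cong) (rule Dj)
      also have "\<dots> = - q * torus_mean ls (X j)" by (rule torus_mean_cmult)
      also have "torus_mean ls (X j) = torus_mean ls (X i)"
        unfolding XX by (rule mean_\<pi>) (simp add: Xc)
      finally have 1: "torus_mean ls (D (insert j U)) = - q * torus_mean ls (X i)" .
      have "torus_mean ls (D (insert i U)) = torus_mean ls (\<lambda>\<xi>. of_real p * X i \<xi>)"
        by (rule torus_mean_cong) (rule Di)
      also have "\<dots> = of_real p * torus_mean ls (X i)" by (rule torus_mean_cmult)
      finally have 2: "torus_mean ls (D (insert i U)) = of_real p * torus_mean ls (X i)" .
      have "kappa p 0 (length xs) (insert j U) = p / (1 - p) * kappa p 0 (length xs) (insert i U)"
        unfolding j_def
      proof (rule kappa_shift_label[OF fin iU(1)])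
        show "Suc i \<notin> U" using iU by (simp add: j_def)
        show "U \<subseteq> {1..}" using sub(1) by auto
        show "1 \<le> length xs" using xs by (cases xs) auto
      qed (use i True in auto)
      then have "(1 - p) * kappa p 0 (length xs) (insert j U) = p * kappa p 0 (length xs) (insert i U)"
        using p by simp
      then have "q * K (insert j U) = of_real p * K (insert i U)"
        unfolding q_def K_def by (metis of_real_mult)
      then have "K (insert j U) * (- q * t) + K (insert i U) * (of_real p * t) = 0" for t
        by (metis (no_types, lifting) add.commute add.left_inverse mult.commute mult.left_commute mult_minus_left)
      then show ?thesis unfolding 1 2 .
    qed
    show ?thesis using D0 D1 D2 by (simp add: add_ac)
  qed
  have "(\<Sum>V\<in>Pow {1..N}. K V * torus_mean ls (D V)) = 0"
    unfolding I(1) sum_Pow_insert[OF I(5,2)] sum.distrib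
    unfolding sum_Pow_insert[OF I(4,3)] sum.distrib[symmetric]
    using key by (intro sum.neutral) auto
  moreover have "(\<Sum>V\<in>Pow {1..N}. K V * torus_mean ls (D V))
      = phi p R N xs H y - of_real p * phi p R N xs H (y(i := y i + 1)) - q * phi p R N xs H (y(j := y i))"
  proof -
    have "(\<Sum>V\<in>Pow {1..N}. K V * torus_mean ls (D V))
       = (\<Sum>V\<in>Pow {1..N}. K V * torus_mean ls (\<lambda>\<xi>. bsum p xs y V (sc \<xi>) * H V (sc \<xi>))
     - of_real p * (K V * torus_mean ls (\<lambda>\<xi>. bsum p xs (y(i := y i + 1)) V (sc \<xi>) * H V (sc \<xi>)))
     - q * (K V * torus_mean ls (\<lambda>\<xi>. bsum p xs (y(j := y i)) V (sc \<xi>) * H V (sc \<xi>))))"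
      by (intro sum.cong refl) (simp add: meanD algebra_simps)
    then show ?thesis
      unfolding phi_eq K_def ls_def by (simp add: sum_subtractf sum_distrib_left)
  qed
  ultimately show ?thesis unfolding q_def j_def by (simp add: algebra_simps)
qed

end


section \<open>One step of the jump chain\<close>

lemma bsum_cong: "(\<And>i. i \<in> V \<Longrightarrow> y i = y' i) \<Longrightarrow> bsum p xs y V \<eta> = bsum p xs y' V \<eta>"
  unfolding bsum_def by (simp cong: prod.cong)

lemma phi_cong:
  assumes "\<And>i. i \<in> {1..N} \<Longrightarrow> y i = y' i"
  shows "phi p R N xs H y = phi p R N xs H y'"
proof -
  have "bsum p xs y V \<eta> = bsum p xs y' V \<eta>" if "V \<in> Pow {1..N}" for V \<eta>
    using that assms by (intro bsum_cong) auto
  then have "(\<Sum>V\<in>Pow {1..N}. of_real (kappa p 0 (length xs) V) * (bsum p xs y V \<eta> * H V \<eta>))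
     = (\<Sum>V\<in>Pow {1..N}. of_real (kappa p 0 (length xs) V) * (bsum p xs y' V \<eta> * H V \<eta>))" for \<eta>
    by (intro sum.cong) auto
  then show ?thesis unfolding phi_def by simp
qed

lemma bsum_shift_coordinate:
  assumes "finite V" "\<eta> i \<noteq> 0"
  shows "bsum p xs (y(i := y i + c)) V \<eta> = bsum p xs y V \<eta> * (if i \<in> V then \<eta> i powi (- c) else 1)"
proof (cases "i \<in> V")
  case True
  then obtain U where U: "V = insert i U" "i \<notin> U" by (meson mk_disjoint_insert)
  have "(\<Prod>l\<in>U. \<eta> l powi (- (y(i := y i + c)) l)) = (\<Prod>l\<in>U. \<eta> l powi (- y l))"
    using U by (intro prod.cong) auto
  moreover have "\<eta> i powi (- (y i + c)) = \<eta> i powi (- y i) * \<eta> i powi (- c)"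
    using assms by (simp flip: power_int_add)
  ultimately have "(\<Prod>l\<in>V. \<eta> l powi (- (y(i := y i + c)) l)) = (\<Prod>l\<in>V. \<eta> l powi (- y l)) * \<eta> i powi (- c)"
    using U assms by simp
  then show ?thesis using True by (simp add: bsum_def)
next
  case False
  then have "bsum p xs (y(i := y i + c)) V \<eta> = bsum p xs y V \<eta>" by (intro bsum_cong) auto
  then show ?thesis using False by simp
qed

definition hweight :: "real \<Rightarrow> nat \<Rightarrow> nat \<Rightarrow> nat set \<Rightarrow> (nat \<Rightarrow> complex) \<Rightarrow> complex" where
  "hweight p N n V \<eta> = (1 + etot p V \<eta> / of_nat N) ^ n"

lemma etot_relabel: "inj_on f V \<Longrightarrow> etot p (f ` V) \<eta> = etot p V (\<eta> \<circ> f)"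
  by (simp add: etot_def sum.reindex)

lemma continuous_on_etot:
  assumes "\<And>i. i \<in> V \<Longrightarrow> R \<noteq> 0"
  shows "continuous_on torus (\<lambda>\<xi>. etot p V (scal (\<lambda>_. R) \<xi>))"
proof -
  have "scal (\<lambda>_. R) \<xi> i \<noteq> 0" if "\<xi> \<in> torus" "i \<in> V" for \<xi> i
  proof -
    have "norm (\<xi> i) = 1" using that(1) by (simp add: torus_def)
    then have "\<xi> i \<noteq> 0" by auto
    then show ?thesis using assms[OF that(2)] by (simp add: scal_def)
  qed
  then show ?thesis
    unfolding etot_def epsA_def
    by (intro continuous_on_sum continuous_on_diff continuous_on_add continuous_on_mult
        continuous_on_divide continuous_on_const continuous_on_scal) auto
qed

lemma sorted_asep_right:
  assumes "sorted_wrt (<) Y" "i < length Y"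
  shows "sorted_wrt (<) (asep_right Y i)"
proof -
  have "Y[i := Y ! i + 1] ! a < Y[i := Y ! i + 1] ! b"
    if ab: "a < b" "b < length Y" and n: "Y ! i + 1 \<notin> set Y" for a b
  proof -
    have "Y ! a < Y ! b" using assms ab by (simp add: sorted_wrt_iff_nth_less)
    moreover have "Y ! b \<noteq> Y ! i + 1" using n ab by (metis nth_mem)
    ultimately show ?thesis using ab assms by (auto simp: nth_list_update)
  qed
  then show ?thesis using assms by (auto simp: asep_right_def sorted_wrt_iff_nth_less)
qed

lemma sorted_asep_left:
  assumes "sorted_wrt (<) Y" "i < length Y"
  shows "sorted_wrt (<) (asep_left Y i)"
proof -
  have "Y[i := Y ! i - 1] ! a < Y[i := Y ! i - 1] ! b"
    if ab: "a < b" "b < length Y" and n: "Y ! i - 1 \<notin> set Y" for a b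
  proof -
    have "Y ! a < Y ! b" using assms ab by (simp add: sorted_wrt_iff_nth_less)
    moreover have "Y ! a \<noteq> Y ! i - 1" using n ab by (metis nth_mem order.strict_trans)
    ultimately show ?thesis using ab assms by (auto simp: nth_list_update)
  qed
  then show ?thesis using assms by (auto simp: asep_left_def sorted_wrt_iff_nth_less)
qed

lemma blocked_right_iff:
  fixes Y :: "int list"
  assumes Y: "sorted_wrt (<) Y" and i: "i < length Y"
  shows "Y ! i + 1 \<in> set Y \<longleftrightarrow> Suc i < length Y \<and> Y ! Suc i = Y ! i + 1"
proof
  assume "Y ! i + 1 \<in> set Y"
  then obtain k where k: "k < length Y" "Y ! k = Y ! i + 1" by (metis in_set_conv_nth)
  have lt: "Y ! a < Y ! b" if "a < b" "b < length Y" for a b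
    using Y that by (simp add: sorted_wrt_iff_nth_less)
  have "i < k"
  proof (rule ccontr)
    assume "\<not> i < k"
    then have "k = i \<or> k < i" by auto
    then show False using lt[of k i] k i by auto
  qed
  moreover have "\<not> Suc i < k" using lt[of i "Suc i"] lt[of "Suc i" k] k by force
  ultimately have "k = Suc i" by simp
  then show "Suc i < length Y \<and> Y ! Suc i = Y ! i + 1" using k by simp
qed (metis nth_mem)

lemma blocked_left_iff:
  fixes Y :: "int list"
  assumes Y: "sorted_wrt (<) Y" and i: "i < length Y"
  shows "Y ! i - 1 \<in> set Y \<longleftrightarrow> 0 < i \<and> Y ! (i - 1) = Y ! i - 1"
proof
  assume "Y ! i - 1 \<in> set Y"
  then obtain k where k: "k < length Y" "Y ! k = Y ! i - 1" by (metis in_set_conv_nth)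
  then have "Y ! k + 1 \<in> set Y" using i by simp
  then have "Suc k < length Y" "Y ! Suc k = Y ! k + 1"
    using blocked_right_iff[OF Y k(1)] by auto
  then have "Y ! Suc k = Y ! i" using k by simp
  then have "Suc k = i"
    using Y i \<open>Suc k < length Y\<close> by (metis linorder_neqE_nat order_less_irrefl sorted_wrt_iff_nth_less)
  then show "0 < i \<and> Y ! (i - 1) = Y ! i - 1" using k by auto
qed (use i in \<open>metis diff_le_self nth_mem order.strict_trans1\<close>)

context
  fixes p R :: real and N :: nat and xs :: "int list"
  assumes p: "0 \<le> p" "p < 1" and R: "R > 4 / (1 - p)" and xs: "xs \<noteq> []" "sorted_wrt (<) xs"
    and N: "N \<ge> 1"
begin

lemma R_nonzero: "R \<noteq> 0"
proof -
  have "0 \<le> 4 / (1 - p)" using p by simp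
  then show ?thesis using R by linarith
qed

lemma hweight_cont: "continuous_on torus (\<lambda>\<xi>. hweight p N n V (scal (\<lambda>_. R) \<xi>))"
  unfolding hweight_def using N R_nonzero
  by (intro continuous_on_power continuous_on_add continuous_on_divide continuous_on_const
      continuous_on_etot) auto

lemma hweight_relabel: "inj_on f V \<Longrightarrow> hweight p N n (f ` V) \<eta> = hweight p N n V (\<eta> \<circ> f)"
  by (simp add: hweight_def etot_relabel)

text \<open>Free dynamics, valid for arbitrary \<open>y\<close>: a jump of particle i multiplies the
  integrand by a power of \<xi>_i if i is in V and leaves it unchanged otherwise. Summed over the
  particles, this gives N plus the sum of the \<epsilon>(\<xi>_i) over V.\<close>

lemma phi_step:
  "of_nat N * phi p R N xs (hweight p N (Suc n)) y
     = (\<Sum>i\<in>{1..N}. of_real p * phi p R N xs (hweight p N n) (y(i := y i + 1))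
         + of_real (1 - p) * phi p R N xs (hweight p N n) (y(i := y i - 1)))"
proof -
  let ?sc = "scal (\<lambda>_. R)"
  define T where "T = (\<lambda>n y V. torus_mean [1..<Suc N] (\<lambda>\<xi>. bsum p xs y V (?sc \<xi>) * hweight p N n V (?sc \<xi>)))"
  have pe: "phi p R N xs (hweight p N n) y = (\<Sum>V\<in>Pow {1..N}. of_real (kappa p 0 (length xs) V) * T n y V)" for n y
    unfolding T_def by (rule phi_eq[OF p R xs(1) hweight_cont hweight_relabel])
  have c: "continuous_on torus (\<lambda>\<xi>. bsum p xs y V (?sc \<xi>) * hweight p N n V (?sc \<xi>))" if "V \<subseteq> {1..N}" for n y V
    by (rule cont_bsum_H[OF p R xs(1) hweight_cont hweight_relabel that])
  have step: "of_nat N * T (Suc n) y V = (\<Sum>i\<in>{1..N}. of_real p * T n (y(i := y i + 1)) V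
      + of_real (1 - p) * T n (y(i := y i - 1)) V)" if V: "V \<in> Pow {1..N}" for V
  proof -
    have fin: "finite V" using V finite_subset by auto
    have V': "V \<subseteq> {1..N}" using V by simp
    have pt: "of_nat N * (bsum p xs y V (?sc \<xi>) * hweight p N (Suc n) V (?sc \<xi>))
       = (\<Sum>i\<in>{1..N}. of_real p * (bsum p xs (y(i := y i + 1)) V (?sc \<xi>) * hweight p N n V (?sc \<xi>))
           + of_real (1 - p) * (bsum p xs (y(i := y i - 1)) V (?sc \<xi>) * hweight p N n V (?sc \<xi>)))"
      if \<xi>: "\<xi> \<in> torus" for \<xi>
    proof -
      define \<eta> where "\<eta> = ?sc \<xi>"
      have nz: "\<eta> i \<noteq> 0" for i
        using good_nonzero(1)[OF p good_scal[OF R \<xi> p]] by (simp add: \<eta>_def)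
      have e: "of_real p * (bsum p xs (y(i := y i + 1)) V \<eta> * h)
           + of_real (1 - p) * (bsum p xs (y(i := y i - 1)) V \<eta> * h)
         = bsum p xs y V \<eta> * h * (1 + (if i \<in> V then epsA p (\<eta> i) else 0))" for i h
        using bsum_shift_coordinate[OF fin nz, of p xs y i 1]
          bsum_shift_coordinate[OF fin nz, of p xs y i "-1"]
        by (simp add: epsA_def power_int_minus field_simps)
      have "(\<Sum>i\<in>{1..N}. of_real p * (bsum p xs (y(i := y i + 1)) V \<eta> * hweight p N n V \<eta>)
           + of_real (1 - p) * (bsum p xs (y(i := y i - 1)) V \<eta> * hweight p N n V \<eta>))
         = bsum p xs y V \<eta> * hweight p N n V \<eta> * (\<Sum>i\<in>{1..N}. 1 + (if i \<in> V then epsA p (\<eta> i) else 0))"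
        unfolding e sum_distrib_left ..
      also have "(\<Sum>i\<in>{1..N}. 1 + (if i \<in> V then epsA p (\<eta> i) else 0)) = of_nat N + etot p V \<eta>"
        unfolding sum.distrib etot_def using V'
        by (simp add: sum.inter_restrict[symmetric] Int_absorb1)
      also have "\<dots> = of_nat N * (1 + etot p V \<eta> / of_nat N)"
        using N by (simp add: field_simps)
      finally have *: "(\<Sum>i\<in>{1..N}. of_real p * (bsum p xs (y(i := y i + 1)) V \<eta> * hweight p N n V \<eta>)
           + of_real (1 - p) * (bsum p xs (y(i := y i - 1)) V \<eta> * hweight p N n V \<eta>))
         = bsum p xs y V \<eta> * hweight p N n V \<eta> * (of_nat N * (1 + etot p V \<eta> / of_nat N))" .
      show ?thesis unfolding \<eta>_def[symmetric] * by (simp add: hweight_def mult_ac)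
    qed
    have "of_nat N * T (Suc n) y V = torus_mean [1..<Suc N] (\<lambda>\<xi>. of_nat N *
        (bsum p xs y V (?sc \<xi>) * hweight p N (Suc n) V (?sc \<xi>)))"
      unfolding T_def by (rule torus_mean_cmult[symmetric])
    also have "\<dots> = torus_mean [1..<Suc N] (\<lambda>\<xi>. \<Sum>i\<in>{1..N}.
           of_real p * (bsum p xs (y(i := y i + 1)) V (?sc \<xi>) * hweight p N n V (?sc \<xi>))
           + of_real (1 - p) * (bsum p xs (y(i := y i - 1)) V (?sc \<xi>) * hweight p N n V (?sc \<xi>)))"
      by (rule torus_mean_cong) (rule pt)
    also have "\<dots> = (\<Sum>i\<in>{1..N}. torus_mean [1..<Suc N] (\<lambda>\<xi>.
           of_real p * (bsum p xs (y(i := y i + 1)) V (?sc \<xi>) * hweight p N n V (?sc \<xi>))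
           + of_real (1 - p) * (bsum p xs (y(i := y i - 1)) V (?sc \<xi>) * hweight p N n V (?sc \<xi>))))"
      by (intro torus_mean_sum continuous_on_add continuous_on_mult[OF continuous_on_const] c V')
    also have "\<dots> = (\<Sum>i\<in>{1..N}. of_real p * T n (y(i := y i + 1)) V
      + of_real (1 - p) * T n (y(i := y i - 1)) V)"
      unfolding T_def torus_mean_cmult[symmetric]
      by (intro sum.cong refl torus_mean_add continuous_on_mult[OF continuous_on_const] c V')
    finally show ?thesis .
  qed
  have "of_nat N * phi p R N xs (hweight p N (Suc n)) y
     = (\<Sum>V\<in>Pow {1..N}. of_real (kappa p 0 (length xs) V) * (of_nat N * T (Suc n) y V))"
    unfolding pe sum_distrib_left by (intro sum.cong) (auto simp: mult_ac)
  also have "\<dots> = (\<Sum>V\<in>Pow {1..N}. \<Sum>i\<in>{1..N}. of_real p * (of_real (kappa p 0 (length xs) V) * T n (y(i := y i + 1)) V)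
      + of_real (1 - p) * (of_real (kappa p 0 (length xs) V) * T n (y(i := y i - 1)) V))"
    by (intro sum.cong refl) (simp only: step sum_distrib_left distrib_left mult_ac)
  also have "\<dots> = (\<Sum>i\<in>{1..N}. \<Sum>V\<in>Pow {1..N}. of_real p * (of_real (kappa p 0 (length xs) V) * T n (y(i := y i + 1)) V)
      + of_real (1 - p) * (of_real (kappa p 0 (length xs) V) * T n (y(i := y i - 1)) V))"
    by (rule sum.swap)
  also have "\<dots> = (\<Sum>i\<in>{1..N}. of_real p * phi p R N xs (hweight p N n) (y(i := y i + 1))
         + of_real (1 - p) * phi p R N xs (hweight p N n) (y(i := y i - 1)))"
    unfolding pe sum.distrib sum_distrib_left ..
  finally show ?thesis .
qed

text \<open>The chain differs from the free recursion \<open>phi_step\<close> only in its blocked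
  jumps, whose total effect is 0 by \<open>phi_boundary\<close>.\<close>

lemma phi_eq_jump_prob:
  assumes "sorted_wrt (<) Y" "length Y = N" "length xs \<le> N"
  shows "phi p R N xs (hweight p N n) (\<lambda>i. Y ! (i - 1))
     = of_real (jump_prob p n Y (\<lambda>X. take (length xs) X = xs))"
  using assms
proof (induction n arbitrary: Y)
  case 0
  define y where "y = (\<lambda>i. Y ! (i - 1))"
  have set: "{0<..N} = {1..N}" by auto
  have "strict_mono_on {0<..N} y"
    using 0 by (auto simp: strict_mono_on_def y_def sorted_wrt_iff_nth_less)
  then have "torus_mean [1..<Suc N] (\<lambda>\<xi>. wsum p 0 xs y {0<..N} (scal (\<lambda>_. R) \<xi>))
      = (if length xs \<le> N \<and> map y [1..<1 + length xs] = xs then 1 else 0)"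
    using xs by (intro torus_mean_wsum_initial_closed[OF p R]) auto
  moreover have "map y [1..<1 + length xs] = take (length xs) Y"
    using 0 by (intro nth_equalityI) (auto simp: y_def simp del: upt_Suc)
  ultimately show ?case
    unfolding y_def[symmetric] using 0 by (simp add: phi_def wsum_def hweight_def set)
next
  case (Suc n)
  define y where "y = (\<lambda>i. Y ! (i - 1))"
  define \<Phi> where "\<Phi> = phi p R N xs (hweight p N n)"
  define J where "J = (\<lambda>Y. complex_of_real (jump_prob p n Y (\<lambda>X. take (length xs) X = xs)))"
  define up where "up = (\<lambda>i. \<Phi> (y(Suc i := y (Suc i) + 1)))"
  define dn where "dn = (\<lambda>i. \<Phi> (y(Suc i := y (Suc i) - 1)))"
  define BR where "BR = (\<lambda>i. Suc i < N \<and> Y ! Suc i = Y ! i + 1)"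
  define BL where "BL = (\<lambda>i. 0 < i \<and> Y ! (i - 1) = Y ! i - 1)"
  have IH: "J X = \<Phi> (\<lambda>i. X ! (i - 1))" if "sorted_wrt (<) X" "length X = N" for X
    unfolding J_def \<Phi>_def using Suc.IH[OF that] Suc.prems by simp
  have upd: "\<Phi> (\<lambda>l. Y[i := c] ! (l - 1)) = \<Phi> (y(Suc i := c))" if "i < N" for i c
    unfolding \<Phi>_def by (rule phi_cong) (use that Suc.prems in \<open>auto simp: y_def nth_list_update\<close>)
  have right: "J (asep_right Y i) = (if BR i then \<Phi> y else up i)" if i: "i < N" for i
  proof -
    have "J (asep_right Y i) = \<Phi> (\<lambda>l. asep_right Y i ! (l - 1))"
      using i Suc.prems by (intro IH sorted_asep_right) (auto simp: asep_right_def)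
    then show ?thesis
      using blocked_right_iff[of Y i] upd[OF i] i Suc.prems
      by (auto simp: asep_right_def BR_def up_def y_def)
  qed
  have left: "J (asep_left Y i) = (if BL i then \<Phi> y else dn i)" if i: "i < N" for i
  proof -
    have "J (asep_left Y i) = \<Phi> (\<lambda>l. asep_left Y i ! (l - 1))"
      using i Suc.prems by (intro IH sorted_asep_left) (auto simp: asep_left_def)
    then show ?thesis
      using blocked_left_iff[of Y i] upd[OF i] i Suc.prems
      by (auto simp: asep_left_def BL_def dn_def y_def)
  qed
  let ?p = "complex_of_real p" and ?q = "complex_of_real (1 - p)"
  \<comment> \<open>The right jump of a particle is blocked exactly when the left jump of the next
    one is, and the boundary condition says that the corrections of such a pair cancel. The index
    shift loses nothing: the last particle is never blocked on its right, the first never on its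
    left.\<close>
  have cancel: "(\<Sum>i<N. ?p * (if BR i then \<Phi> y - up i else 0)) + (\<Sum>i<N. ?q * (if BL i then \<Phi> y - dn i else 0)) = 0"
  proof -
    obtain N' where N': "N = Suc N'" using N by (cases N) auto
    have "(\<Sum>i<N. ?p * (if BR i then \<Phi> y - up i else 0)) = (\<Sum>i<N'. ?p * (if BR i then \<Phi> y - up i else 0))"
      unfolding N' sum.lessThan_Suc by (simp add: BR_def N')
    moreover have "(\<Sum>i<N. ?q * (if BL i then \<Phi> y - dn i else 0)) = (\<Sum>i<N'. ?q * (if BL (Suc i) then \<Phi> y - dn (Suc i) else 0))"
      unfolding N' sum.lessThan_Suc_shift by (simp add: BL_def)
    moreover have "?p * (if BR i then \<Phi> y - up i else 0) + ?q * (if BL (Suc i) then \<Phi> y - dn (Suc i) else 0) = 0"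
      if i: "i < N'" for i
    proof -
      have eq: "BL (Suc i) \<longleftrightarrow> BR i" using i N' by (auto simp: BL_def BR_def)
      show ?thesis
      proof (cases "BR i")
        case True
        have b: "y (Suc (Suc i)) = y (Suc i) + 1" using True by (simp add: BR_def y_def)
        have "\<Phi> y = ?p * \<Phi> (y(Suc i := y (Suc i) + 1)) + ?q * \<Phi> (y(Suc (Suc i) := y (Suc i)))"
          unfolding \<Phi>_def
          by (rule phi_boundary[OF p R xs(1) hweight_cont hweight_relabel]) (use i N' b in auto)
        moreover have "y (Suc (Suc i)) - 1 = y (Suc i)" using b by simp
        ultimately have "\<Phi> y - (?p * up i + ?q * dn (Suc i)) = 0" by (simp add: up_def dn_def)
        moreover have "?p * (\<Phi> y - up i) + ?q * (\<Phi> y - dn (Suc i)) = \<Phi> y - (?p * up i + ?q * dn (Suc i))"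
          by (simp add: algebra_simps)
        ultimately have "?p * (\<Phi> y - up i) + ?q * (\<Phi> y - dn (Suc i)) = 0" by (simp only:)
        then show ?thesis using True eq by simp
      qed (simp add: eq)
    qed
    ultimately show ?thesis by (simp add: sum.distrib[symmetric])
  qed
  have "(\<Sum>i<N. ?p * J (asep_right Y i) + ?q * J (asep_left Y i))
     = (\<Sum>i<N. (?p * up i + ?q * dn i) + (?p * (if BR i then \<Phi> y - up i else 0)
          + ?q * (if BL i then \<Phi> y - dn i else 0)))"
    by (intro sum.cong refl) (auto simp: right left algebra_simps)
  also have "\<dots> = (\<Sum>i<N. ?p * up i + ?q * dn i)"
    unfolding sum.distrib using cancel by simp
  also have "\<dots> = (\<Sum>i\<in>{1..N}. ?p * \<Phi> (y(i := y i + 1)) + ?q * \<Phi> (y(i := y i - 1)))"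
    unfolding up_def dn_def by (rule sum.reindex_bij_witness[of _ "\<lambda>i. i - 1" Suc]) auto
  also have "\<dots> = of_nat N * phi p R N xs (hweight p N (Suc n)) y"
    unfolding \<Phi>_def by (rule phi_step[symmetric])
  finally have "phi p R N xs (hweight p N (Suc n)) y
      = (\<Sum>i<N. ?p * J (asep_right Y i) + ?q * J (asep_left Y i)) / of_nat N"
    using N by simp
  then show ?case
    unfolding y_def[symmetric] using Suc.prems by (simp add: J_def)
qed

end


section \<open>Summation over the number of events\<close>

lemma compact_torus: "compact torus"
proof -
  have eq: "torus = PiE UNIV (\<lambda>_. sphere 0 1)"
    by (auto simp: torus_def PiE_UNIV_domain)
  have "compactin (product_topology (\<lambda>_. euclidean) UNIV) (PiE UNIV (\<lambda>_::nat. sphere (0::complex) 1))"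
    by (subst compactin_PiE) auto
  then show ?thesis
    unfolding eq by (simp add: euclidean_product_topology)
qed

lemma bounded_on_torus:
  assumes "continuous_on torus F"
  obtains B :: real where "B \<ge> 0" "\<And>\<xi>. \<xi> \<in> torus \<Longrightarrow> norm (F \<xi> :: complex) \<le> B"
proof -
  have "bounded (F ` torus)"
    using compact_continuous_image[OF assms compact_torus] by (rule compact_imp_bounded)
  then obtain B where "\<forall>x\<in>F ` torus. norm x \<le> B" by (auto simp: bounded_iff)
  then show ?thesis by (intro that[of "max B 0"]) fastforce+
qed

text \<open>Compactness of the torus bounds both functions, so the exponential series converges
  uniformly and may be averaged term by term.\<close>

lemma sums_torus_mean_exp:
  assumes F: "continuous_on torus F" and X: "continuous_on torus X"
  shows "(\<lambda>n. torus_mean ls (\<lambda>\<xi>. F \<xi> * (X \<xi> ^ n / fact n))) sums torus_mean ls (\<lambda>\<xi>. F \<xi> * exp (X \<xi>))"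
proof -
  obtain B C where B: "B \<ge> 0" "\<And>\<xi>. \<xi> \<in> torus \<Longrightarrow> norm (F \<xi>) \<le> B"
      and C: "C \<ge> 0" "\<And>\<xi>. \<xi> \<in> torus \<Longrightarrow> norm (X \<xi>) \<le> C"
    using bounded_on_torus[OF F] bounded_on_torus[OF X] by metis
  have cont: "continuous_on torus (\<lambda>\<xi>. F \<xi> * (X \<xi> ^ n / fact n))" for n
    by (intro continuous_intros F X) auto
  have "uniform_limit torus (\<lambda>n \<xi>. \<Sum>i<n. F \<xi> * (X \<xi> ^ i / fact i))
      (\<lambda>\<xi>. \<Sum>i. F \<xi> * (X \<xi> ^ i / fact i)) sequentially"
  proof (rule Weierstrass_m_test)
    show "norm (F \<xi> * (X \<xi> ^ n / fact n)) \<le> B * (C ^ n / fact n)" if "\<xi> \<in> torus" for n \<xi>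
    proof -
      have "norm (X \<xi> ^ n / fact n) \<le> C ^ n / fact n"
        using C(2)[OF that] by (simp add: norm_divide norm_power divide_right_mono power_mono)
      then show ?thesis
        unfolding norm_mult using B that by (intro mult_mono) auto
    qed
    show "summable (\<lambda>n. B * (C ^ n / fact n))"
      using summable_exp[of C] by (intro summable_mult) (simp add: field_simps)
  qed
  moreover have "(\<Sum>i. F \<xi> * (X \<xi> ^ i / fact i)) = F \<xi> * exp (X \<xi>)" for \<xi>
  proof -
    have "(\<lambda>i. X \<xi> ^ i / fact i) sums exp (X \<xi>)"
      using exp_converges[of "X \<xi>"] by (simp add: scaleR_conv_of_real field_simps)
    from sums_mult[OF this] show ?thesis by (rule sums_unique[symmetric])
  qed
  ultimately have "uniform_limit torus (\<lambda>n \<xi>. \<Sum>i<n. F \<xi> * (X \<xi> ^ i / fact i))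
      (\<lambda>\<xi>. F \<xi> * exp (X \<xi>)) sequentially" by simp
  then have "(\<lambda>n. torus_mean ls (\<lambda>\<xi>. \<Sum>i<n. F \<xi> * (X \<xi> ^ i / fact i)))
      \<longlonglongrightarrow> torus_mean ls (\<lambda>\<xi>. F \<xi> * exp (X \<xi>))"
    by (intro tendsto_torus_mean continuous_on_sum cont continuous_intros F X)
  moreover have "torus_mean ls (\<lambda>\<xi>. \<Sum>i<n. F \<xi> * (X \<xi> ^ i / fact i))
      = (\<Sum>i<n. torus_mean ls (\<lambda>\<xi>. F \<xi> * (X \<xi> ^ i / fact i)))" for n
    by (rule torus_mean_sum[OF cont])
  ultimately show ?thesis unfolding sums_def by (simp only:)
qed

text \<open>With \<epsilon> the sum over V, the terms e^(-N t) (N t)^n (1 + \<epsilon> / N)^n / n!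
  add up to e^(\<epsilon> t): the Poisson normalisation cancels the constant part of the step
  factor.\<close>

lemma asep_prob_eq_phi:
  assumes p: "0 \<le> p" "p < 1" and R: "R > 4 / (1 - p)" and xs: "xs \<noteq> []" "sorted_wrt (<) xs"
    and N: "N \<ge> 1" and Y: "sorted_wrt (<) Y" "length Y = N" "length xs \<le> N"
  shows "complex_of_real (asep_prob p t Y (\<lambda>X. take (length xs) X = xs))
     = phi p R N xs (\<lambda>V \<eta>. exp (etot p V \<eta> * of_real t)) (\<lambda>i. Y ! (i - 1))"
proof -
  define y where "y = (\<lambda>i. Y ! (i - 1))"
  define K where "K = (\<lambda>V. complex_of_real (kappa p 0 (length xs) V))"
  define a where "a = exp (- of_nat N * complex_of_real t)"
  let ?ls = "[1..<Suc N]"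
  let ?sc = "scal (\<lambda>_. R)"
  let ?b = "\<lambda>V \<xi>. bsum p xs y V (?sc \<xi>)"
  have R0: "R \<noteq> 0" by (rule R_nonzero[OF p R xs N])
  have cb: "continuous_on torus (?b V)" for V
    using p R by (intro continuous_on_bsum continuous_on_const continuous_on_scal good_scal) auto
  have ce: "continuous_on torus (\<lambda>\<xi>. etot p V (?sc \<xi>))" for V
    using R0 by (intro continuous_on_etot)
  define X where "X = (\<lambda>V \<xi>. of_nat N * of_real t + etot p V (?sc \<xi>) * of_real t)"
  have cX: "continuous_on torus (X V)" for V
    unfolding X_def by (intro continuous_intros ce)
  define f where "f = (\<lambda>n. exp (- real N * t) * (real N * t) ^ n / fact n * jump_prob p n Y (\<lambda>X. take (length xs) X = xs))"
  have "complex_of_real (f n) = (\<Sum>V\<in>Pow {1..N}. K V * (a * torus_mean ?ls (\<lambda>\<xi>. ?b V \<xi> * (X V \<xi> ^ n / fact n))))" for n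
  proof -
    have "complex_of_real (f n) = a * (of_nat N * of_real t) ^ n / fact n * phi p R N xs (hweight p N n) y"
      unfolding f_def y_def phi_eq_jump_prob[OF p R xs N Y] a_def
      by (simp add: exp_of_real[symmetric])
    also have "\<dots> = (\<Sum>V\<in>Pow {1..N}. K V * (a * ((of_nat N * of_real t) ^ n / fact n
        * torus_mean ?ls (\<lambda>\<xi>. ?b V \<xi> * hweight p N n V (?sc \<xi>)))))"
    proof -
      have "phi p R N xs (hweight p N n) y = (\<Sum>V\<in>Pow {1..N}. K V * torus_mean ?ls (\<lambda>\<xi>. ?b V \<xi> * hweight p N n V (?sc \<xi>)))"
        unfolding K_def
        by (rule phi_eq[OF p R xs(1) hweight_cont[OF p R xs N] hweight_relabel[OF p R xs N]])
      then show ?thesis by (simp add: sum_distrib_left mult_ac)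
    qed
    also have "\<dots> = (\<Sum>V\<in>Pow {1..N}. K V * (a * torus_mean ?ls (\<lambda>\<xi>. ?b V \<xi> * (X V \<xi> ^ n / fact n))))"
    proof (intro sum.cong refl arg_cong[of _ _ "\<lambda>z. K _ * (a * z)"])
      fix V
      have "X V \<xi> ^ n = (of_nat N * of_real t) ^ n * hweight p N n V (?sc \<xi>)" for \<xi>
      proof -
        have "X V \<xi> = of_nat N * of_real t * (1 + etot p V (?sc \<xi>) / of_nat N)"
          using N unfolding X_def by (simp add: field_simps)
        then show ?thesis by (simp only: hweight_def power_mult_distrib)
      qed
      then have "?b V \<xi> * (X V \<xi> ^ n / fact n)
          = (of_nat N * of_real t) ^ n / fact n * (?b V \<xi> * hweight p N n V (?sc \<xi>))" for \<xi>
        by simp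
      then show "(of_nat N * of_real t) ^ n / fact n * torus_mean ?ls (\<lambda>\<xi>. ?b V \<xi> * hweight p N n V (?sc \<xi>))
         = torus_mean ?ls (\<lambda>\<xi>. ?b V \<xi> * (X V \<xi> ^ n / fact n))"
        by (simp only: torus_mean_cmult)
    qed
    finally show ?thesis .
  qed
  moreover have "(\<lambda>n. \<Sum>V\<in>Pow {1..N}. K V * (a * torus_mean ?ls (\<lambda>\<xi>. ?b V \<xi> * (X V \<xi> ^ n / fact n))))
      sums (\<Sum>V\<in>Pow {1..N}. K V * (a * torus_mean ?ls (\<lambda>\<xi>. ?b V \<xi> * exp (X V \<xi>))))"
    by (intro sums_sum sums_mult sums_torus_mean_exp cb cX)
  moreover have "a * torus_mean ?ls (\<lambda>\<xi>. ?b V \<xi> * exp (X V \<xi>))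
      = torus_mean ?ls (\<lambda>\<xi>. ?b V \<xi> * exp (etot p V (?sc \<xi>) * of_real t))" for V
  proof -
    have "a * (?b V \<xi> * exp (X V \<xi>)) = ?b V \<xi> * exp (etot p V (?sc \<xi>) * of_real t)" for \<xi>
      unfolding a_def X_def exp_add by (simp add: exp_minus)
    then show ?thesis unfolding torus_mean_cmult[symmetric] by (simp only:)
  qed
  moreover have "phi p R N xs (\<lambda>V \<eta>. exp (etot p V \<eta> * of_real t)) y
     = (\<Sum>V\<in>Pow {1..N}. K V * torus_mean ?ls (\<lambda>\<xi>. ?b V \<xi> * exp (etot p V (?sc \<xi>) * of_real t)))"
    unfolding K_def
    by (rule phi_eq[OF p R xs(1)]) (auto intro!: continuous_intros ce simp: etot_relabel)
  ultimately have "(\<lambda>n. complex_of_real (f n)) sums phi p R N xs (\<lambda>V \<eta>. exp (etot p V \<eta> * of_real t)) y"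
    by simp
  then have "summable f" "(\<Sum>n. complex_of_real (f n)) = phi p R N xs (\<lambda>V \<eta>. exp (etot p V \<eta> * of_real t)) y"
    by (auto simp: sums_iff)
  moreover from this have "complex_of_real (suminf f) = (\<Sum>n. complex_of_real (f n))"
    by (intro suminf_of_real)
  ultimately show ?thesis
    unfolding asep_prob_def Y(2) f_def[symmetric] y_def[symmetric] by (simp add: f_def)
qed


section \<open>Iterated contour integrals\<close>

lemma foldr_av_factor:
  assumes "i \<notin> set is"
  shows "foldr av is (\<lambda>\<xi>. F \<xi> * h (\<xi> i)) \<xi> = foldr av is F \<xi> * h (\<xi> i)"
  using assms
proof (induction "is" arbitrary: \<xi>)
  case (Cons j js)
  have "foldr av (j # js) (\<lambda>\<xi>. F \<xi> * h (\<xi> i)) \<xi> = av j (\<lambda>\<xi>. foldr av js F \<xi> * h (\<xi> i)) \<xi>"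
  proof -
    have "foldr av js (\<lambda>\<xi>. F \<xi> * h (\<xi> i)) = (\<lambda>\<xi>. foldr av js F \<xi> * h (\<xi> i))"
      by (rule ext, rule Cons.IH) (use Cons.prems in simp)
    then show ?thesis by (simp only: foldr_Cons comp_apply)
  qed
  also have "\<dots> = integral {0..1} (\<lambda>t. foldr av js F (\<xi>(j := cis (2 * pi * t))) * h (\<xi> i))"
    using Cons.prems by (simp add: av_def)
  also have "\<dots> = foldr av (j # js) F \<xi> * h (\<xi> i)"
    by (simp add: av_def)
  finally show ?case .
qed simp

text \<open>\<open>iter_cint\<close> starts from the point 0 and the torus mean from 1. Prescribing
  the coordinates outside the list by \<open>\<xi>0\<close> removes this difference and lets the
  induction store the outer variables there.\<close>

lemma iter_cint_override:
  assumes "distinct is"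
  shows "iter_cint R is (\<lambda>\<xi>. F (\<lambda>j. if j \<in> set is then \<xi> j else scal (\<lambda>_. R) \<xi>0 j))
     = (2 * complex_of_real pi * \<i>) ^ length is
       * foldr av is (\<lambda>\<xi>. F (scal (\<lambda>_. R) \<xi>) * (\<Prod>i\<in>set is. scal (\<lambda>_. R) \<xi> i)) \<xi>0"
  using assms
proof (induction "is" arbitrary: \<xi>0)
  case Nil
  then show ?case by simp
next
  case (Cons i js)
  let ?sc = "scal (\<lambda>_. R)"
  let ?G = "\<lambda>\<xi>. F (?sc \<xi>) * (\<Prod>i\<in>set js. ?sc \<xi> i)"
  have i: "i \<notin> set js" "distinct js" using Cons.prems by auto
  have inner: "iter_cint R js (\<lambda>\<xi>. F (\<lambda>j. if j \<in> set (i # js) then (\<xi>(i := of_real R * c)) j else ?sc \<xi>0 j))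
      = (2 * complex_of_real pi * \<i>) ^ length js * foldr av js ?G (\<xi>0(i := c))" for c
  proof -
    have "(\<lambda>j. if j \<in> set (i # js) then (\<xi>(i := of_real R * c)) j else ?sc \<xi>0 j)
        = (\<lambda>j. if j \<in> set js then \<xi> j else ?sc (\<xi>0(i := c)) j)" for \<xi>
      using i by (auto simp: fun_eq_iff scal_def)
    then show ?thesis by (simp only: Cons.IH[OF i(2)])
  qed
  have "iter_cint R (i # js) (\<lambda>\<xi>. F (\<lambda>j. if j \<in> set (i # js) then \<xi> j else ?sc \<xi>0 j))
     = 2 * complex_of_real pi * \<i> * integral {0..1} (\<lambda>t. iter_cint R js (\<lambda>\<xi>. F (\<lambda>j. if j \<in> set (i # js)
          then (\<xi>(i := of_real R * cis (2 * pi * t))) j else ?sc \<xi>0 j)) * (of_real R * cis (2 * pi * t)))"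
    by (simp only: iter_cint.simps contour_integral_circlepath_mean circ_mean_def)
  also have "\<dots> = 2 * complex_of_real pi * \<i> * integral {0..1} (\<lambda>t. (2 * complex_of_real pi * \<i>) ^ length js
      * (foldr av js ?G (\<xi>0(i := cis (2 * pi * t))) * (of_real R * cis (2 * pi * t))))"
    by (simp only: inner mult.assoc)
  also have "\<dots> = (2 * complex_of_real pi * \<i>) ^ length (i # js) * integral {0..1} (\<lambda>t.
      foldr av js ?G (\<xi>0(i := cis (2 * pi * t))) * (of_real R * cis (2 * pi * t)))"
    by (simp only: integral_mult_right) simp
  also have "(\<lambda>t. foldr av js ?G (\<xi>0(i := cis (2 * pi * t))) * (of_real R * cis (2 * pi * t)))
     = (\<lambda>t. foldr av js (\<lambda>\<xi>. ?G \<xi> * (of_real R * \<xi> i)) (\<xi>0(i := cis (2 * pi * t))))"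
    by (simp add: foldr_av_factor[OF i(1), of ?G "\<lambda>z. of_real R * z"])
  also have "(\<lambda>\<xi>. ?G \<xi> * (of_real R * \<xi> i)) = (\<lambda>\<xi>. F (?sc \<xi>) * (\<Prod>i\<in>set (i # js). ?sc \<xi> i))"
    using i by (simp add: fun_eq_iff scal_def mult_ac)
  finally show ?case by (simp only: foldr_Cons comp_apply av_def)
qed

lemma foldr_av_indep:
  assumes "\<And>\<xi> i z. i \<in> set is \<Longrightarrow> G (\<xi>(i := z)) = G \<xi>"
  shows "foldr av is G \<xi> = G \<xi>"
  using assms
proof (induction "is" arbitrary: \<xi>)
  case (Cons i js)
  have "foldr av js G = G"
    by (rule ext, rule Cons.IH, rule Cons.prems) simp
  then have "foldr av (i # js) G \<xi> = av i G \<xi>" by (simp only: foldr_Cons comp_apply)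
  also have "\<dots> = G \<xi>" by (rule av_indep) (rule Cons.prems, simp)
  finally show ?case .
qed simp

text \<open>The variables outside \<open>V\<close> are averaged too, without effect, as the
  integrand ignores them. The product over \<open>V\<close> collects the factors from the
  d\<xi>_i.\<close>

lemma iter_cint_eq_torus_mean:
  assumes V: "V \<subseteq> {1..N}"
    and dep: "\<And>\<xi> \<xi>'. (\<And>i. i \<in> V \<Longrightarrow> \<xi> i = \<xi>' i) \<Longrightarrow> F \<xi> = F \<xi>'"
    and cont: "continuous_on torus (\<lambda>\<xi>. F (scal (\<lambda>_. R) \<xi>))"
  shows "(1 / (2 * complex_of_real pi * \<i>)) ^ card V * iter_cint R (sorted_list_of_set V) F
     = torus_mean [1..<Suc N] (\<lambda>\<xi>. F (scal (\<lambda>_. R) \<xi>) * (\<Prod>i\<in>V. scal (\<lambda>_. R) \<xi> i))"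
proof -
  let ?sc = "scal (\<lambda>_. R)"
  have fin: "finite V" using V finite_subset by blast
  define js where "js = sorted_list_of_set V"
  define ks where "ks = sorted_list_of_set ({1..N} - V)"
  define G where "G = (\<lambda>\<xi>. F (?sc \<xi>) * (\<Prod>i\<in>V. ?sc \<xi> i))"
  have js: "set js = V" "distinct js" "length js = card V" using fin by (auto simp: js_def)
  have "F \<xi> = F (\<lambda>j. if j \<in> set js then \<xi> j else ?sc (\<lambda>_. 1) j)" for \<xi>
    by (rule dep) (simp add: js)
  then have "iter_cint R js F = iter_cint R js (\<lambda>\<xi>. F (\<lambda>j. if j \<in> set js then \<xi> j else ?sc (\<lambda>_. 1) j))"
    by (simp only:)
  also have "\<dots> = (2 * complex_of_real pi * \<i>) ^ length js
      * foldr av js (\<lambda>\<xi>. F (?sc \<xi>) * (\<Prod>i\<in>set js. ?sc \<xi> i)) (\<lambda>_. 1)"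
    by (rule iter_cint_override[OF js(2)])
  also have "\<dots> = (2 * complex_of_real pi * \<i>) ^ card V * foldr av js G (\<lambda>_. 1)"
    by (simp only: js(1,3) G_def)
  finally have 1: "(1 / (2 * complex_of_real pi * \<i>)) ^ card V * iter_cint R js F = foldr av js G (\<lambda>_. 1)"
    by (simp add: power_one_over)
  have "continuous_on torus G"
    unfolding G_def by (intro continuous_on_mult cont continuous_on_prod continuous_on_scal)
  moreover have "mset [1..<Suc N] = mset (js @ ks)"
    using V fin by (subst set_eq_iff_mset_eq_distinct[symmetric]) (auto simp: js_def ks_def)
  ultimately have "torus_mean [1..<Suc N] G = foldr av js (foldr av ks G) (\<lambda>_. 1)"
    by (subst torus_mean_mset[of G _ "js @ ks"]) (auto simp: torus_mean_def)
  also have "foldr av ks G = G"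
  proof (rule ext, rule foldr_av_indep)
    fix \<xi> :: "nat \<Rightarrow> complex" and i z assume "i \<in> set ks"
    then have i: "i \<notin> V" by (simp add: ks_def)
    have "F (?sc (\<xi>(i := z))) = F (?sc \<xi>)" by (rule dep) (use i in \<open>auto simp: scal_def\<close>)
    moreover have "(\<Prod>l\<in>V. ?sc (\<xi>(i := z)) l) = (\<Prod>l\<in>V. ?sc \<xi> l)"
      using i by (intro prod.cong) (auto simp: scal_def)
    ultimately show "G (\<xi>(i := z)) = G \<xi>" by (simp add: G_def)
  qed
  finally show ?thesis using 1 by (simp add: js_def G_def)
qed

section \<open>Identification with the sum over S and \<Lambda>\<close>

lemma bethe_append:
  assumes "length ls + 1 = length xs"
  shows "bethe p xs (ls @ ms) = (\<Prod>l\<leftarrow>ls. 1 - l) * (\<Prod>a<length ls. ls ! a powi (xs ! a))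
     * pairprod (fA p) ls * (\<Prod>l\<leftarrow>ls. \<Prod>w\<leftarrow>ms. fA p l w)
     * ((1 - prod_list ms) * pairprod (\<lambda>a b. b - a) ms * (\<Prod>w\<leftarrow>ms. w powi (last xs)))"
  using assms
proof (induction ls arbitrary: xs)
  case Nil
  then obtain x where "xs = [x]" by (cases xs) auto
  then show ?case by simp
next
  case (Cons l ls)
  then obtain x x' xs' where xs: "xs = x # x' # xs'" by (cases xs; cases "tl xs") auto
  have IH: "bethe p (x' # xs') (ls @ ms) = (\<Prod>l\<leftarrow>ls. 1 - l) * (\<Prod>a<length ls. ls ! a powi ((x' # xs') ! a))
     * pairprod (fA p) ls * (\<Prod>l\<leftarrow>ls. \<Prod>w\<leftarrow>ms. fA p l w)
     * ((1 - prod_list ms) * pairprod (\<lambda>a b. b - a) ms * (\<Prod>w\<leftarrow>ms. w powi (last (x' # xs'))))"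
    using Cons xs by simp
  have "(\<Prod>a<length (l # ls). (l # ls) ! a powi (xs ! a)) = l powi x * (\<Prod>a<length ls. ls ! a powi ((x' # xs') ! a))"
    by (simp add: xs prod.lessThan_Suc_shift del: prod.lessThan_Suc)
  moreover have "last xs = last (x' # xs')" by (simp add: xs)
  ultimately show ?case
    unfolding xs append_Cons bethe.simps(4) IH by (simp add: xs mult_ac)
qed

lemma pairprod_eq_double_prod:
  "(\<Prod>a<length L. \<Prod>b\<in>{a<..<length L}. s (L ! a) (L ! b)) = pairprod s L"
proof (induction L)
  case (Cons x L)
  have "i \<in> {0<..<Suc n} \<longleftrightarrow> i \<in> Suc ` {..<n}"
    "i \<in> {Suc a<..<Suc n} \<longleftrightarrow> i \<in> Suc ` {a<..<n}" for i a n :: nat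
    by (cases i; auto)+
  then have 0: "{0<..<Suc n} = Suc ` {..<n}" "{Suc a<..<Suc n} = Suc ` {a<..<n}" for a n
    by blast+
  have "(\<Prod>a<length (x # L). \<Prod>b\<in>{a<..<length (x # L)}. s ((x # L) ! a) ((x # L) ! b))
     = (\<Prod>b<length L. s x (L ! b)) * (\<Prod>a<length L. \<Prod>b\<in>{a<..<length L}. s (L ! a) (L ! b))"
    by (simp add: prod.lessThan_Suc_shift 0 prod.reindex del: prod.lessThan_Suc)
  also have "(\<Prod>b<length L. s x (L ! b)) = (\<Prod>w\<leftarrow>L. s x w)"
    by (simp add: prod.list_conv_set_nth atLeast0LessThan)
  finally show ?case using Cons by simp
qed simp

lemma sgn_list_eq:
  assumes "distinct L"
  shows "complex_of_real (sgn_list L) = pairprod isgn L"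
proof -
  let ?A = "SIGMA a:{..<length L}. {a<..<length L}"
  have "pairprod isgn L = (\<Prod>(a, b)\<in>?A. isgn (L ! a) (L ! b))"
    unfolding pairprod_eq_double_prod[symmetric] by (subst prod.Sigma) auto
  also have "\<dots> = (\<Prod>x\<in>?A. if L ! fst x > L ! snd x then -1 else 1)"
  proof (rule prod.cong)
    fix x assume "x \<in> ?A"
    then obtain a b where x: "x = (a, b)" "a < b" "b < length L" by auto
    then have "L ! a \<noteq> L ! b" using assms by (simp add: nth_eq_iff_index_eq)
    then show "(case x of (a, b) \<Rightarrow> isgn (L ! a) (L ! b)) = (if L ! fst x > L ! snd x then -1 else 1)"
      using x by (auto simp: isgn_def sgn_if)
  qed simp
  also have "\<dots> = (-1) ^ card (?A \<inter> {x. L ! fst x > L ! snd x})"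
    by (subst prod.If_cases) auto
  also have "?A \<inter> {x. L ! fst x > L ! snd x} = {(a, b). a < b \<and> b < length L \<and> L ! a > L ! b}"
    by auto
  finally show ?thesis by (simp add: sgn_list_def)
qed

text \<open>\<sigma>(S, W) counts the pairs with s \<ge> l among all pairs, so the exponent is minus
  the number of pairs with s < l. These are the inversions between the blocks when W is listed
  before S.\<close>

lemma cross_sign:
  assumes fin: "finite S" "finite W" and disj: "S \<inter> W = {}"
  shows "(-1) powi (int (sigma_pairs S W) - int (card W) * int (card S)) = (\<Prod>l\<in>W. \<Prod>s\<in>S. isgn l s)"
proof -
  define C where "C = {(l, s). l \<in> W \<and> s \<in> S \<and> s < l}"
  have "(\<Prod>l\<in>W. \<Prod>s\<in>S. isgn l s) = (\<Prod>x\<in>W \<times> S. isgn (fst x) (snd x))"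
    by (simp add: prod.cartesian_product split_def)
  also have "\<dots> = (\<Prod>x\<in>W \<times> S. if snd x < fst x then -1 else 1)"
    using disj by (intro prod.cong) (auto simp: isgn_def sgn_if)
  also have "\<dots> = (-1) ^ card ((W \<times> S) \<inter> {x. snd x < fst x})"
    using fin by (subst prod.If_cases) auto
  also have "(W \<times> S) \<inter> {x. snd x < fst x} = C" by (auto simp: C_def)
  finally have 1: "(\<Prod>l\<in>W. \<Prod>s\<in>S. isgn l s) = (-1) ^ card C" .
  have "{(i, j). i \<in> S \<and> j \<in> W \<and> j \<le> i} = (\<lambda>(l, s). (s, l)) ` (W \<times> S - C)"
    by (auto simp: C_def image_iff)
  then have "sigma_pairs S W = card (W \<times> S - C)"
    unfolding sigma_pairs_def by (simp add: card_image inj_on_def split_def prod_eq_iff)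
  also have "\<dots> = card (W \<times> S) - card C"
    using fin by (intro card_Diff_subset) (auto simp: C_def intro: finite_subset[of _ "W \<times> S"])
  finally have sp: "sigma_pairs S W = card (W \<times> S) - card C" .
  have "C \<subseteq> W \<times> S" by (auto simp: C_def)
  then have "card C \<le> card (W \<times> S)" using fin by (intro card_mono) auto
  then have "int (sigma_pairs S W) = int (card W) * int (card S) - int (card C)"
    unfolding sp by (simp add: of_nat_diff card_cartesian_product)
  then have "(-1) powi (int (sigma_pairs S W) - int (card W) * int (card S)) = (-1 :: complex) powi (- int (card C))"
    by simp
  also have "\<dots> = (-1) ^ card C" by (cases "even (card C)") (simp_all add: power_int_minus)
  finally show ?thesis using 1 by simp
qed


lemma asep_integrand_cong:
  assumes "\<And>i. i \<in> S \<union> set L \<Longrightarrow> \<xi> i = \<xi>' i" "length L = m - 1"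
  shows "asep_integrand p t m xs Y S L \<xi> = asep_integrand p t m xs Y S L \<xi>'"
proof -
  have L: "\<xi> (L ! a) = \<xi>' (L ! a)" if "a < m - 1" for a
    using assms that by simp
  have
    "(\<Prod>i\<in>set L. \<Prod>j\<in>S. fA p (\<xi> i) (\<xi> j)) = (\<Prod>i\<in>set L. \<Prod>j\<in>S. fA p (\<xi>' i) (\<xi>' j))"
    "(\<Prod>a<m-1. \<Prod>b\<in>{a<..<m-1}. fA p (\<xi> (L ! a)) (\<xi> (L ! b)))
       = (\<Prod>a<m-1. \<Prod>b\<in>{a<..<m-1}. fA p (\<xi>' (L ! a)) (\<xi>' (L ! b)))"
    "(\<Prod>(i, j)\<in>{(i, j). i \<in> S \<union> set L \<and> j \<in> S \<union> set L \<and> i < j}. fA p (\<xi> i) (\<xi> j))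
       = (\<Prod>(i, j)\<in>{(i, j). i \<in> S \<union> set L \<and> j \<in> S \<union> set L \<and> i < j}. fA p (\<xi>' i) (\<xi>' j))"
    "(\<Prod>j\<in>S. \<xi> j) = (\<Prod>j\<in>S. \<xi>' j)"
    "(\<Prod>(i, j)\<in>{(i, j). i \<in> S \<and> j \<in> S \<and> i < j}. \<xi> j - \<xi> i)
       = (\<Prod>(i, j)\<in>{(i, j). i \<in> S \<and> j \<in> S \<and> i < j}. \<xi>' j - \<xi>' i)"
    "(\<Prod>j\<in>S. 1 - \<xi> j) = (\<Prod>j\<in>S. 1 - \<xi>' j)"
    "(\<Prod>a<m-1. \<xi> (L ! a) powi (xs ! a)) = (\<Prod>a<m-1. \<xi>' (L ! a) powi (xs ! a))"
    "(\<Prod>j\<in>S. \<xi> j powi (xs ! (m - 1))) = (\<Prod>j\<in>S. \<xi>' j powi (xs ! (m - 1)))"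
    "(\<Prod>i\<in>S \<union> set L. \<xi> i powi (- (Y ! (i - 1)) - 1)) = (\<Prod>i\<in>S \<union> set L. \<xi>' i powi (- (Y ! (i - 1)) - 1))"
    "(\<Sum>i\<in>S \<union> set L. epsA p (\<xi> i) * complex_of_real t) = (\<Sum>i\<in>S \<union> set L. epsA p (\<xi>' i) * complex_of_real t)"
    using assms(1) L by (auto intro!: prod.cong sum.cong)
  then show ?thesis
    unfolding asep_integrand_def Let_def by (simp only:)
qed

text \<open>Holds for every arrangement \<open>Ms\<close>: its sign turns the Vandermonde factor in
  that order into the one in increasing order. The auxiliary factors 1 - \<xi>_l cancel against
  \<open>denom\<close>, and the product of the \<xi>_i raises the exponents to
  \<open>- y i\<close>.\<close>

lemma asep_integrand_eq_bterm:
  assumes p: "0 \<le> p" "p < 1" and good: "\<And>i. good p (\<eta> i)"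
    and S: "finite S" "Ms \<in> permutations_of_set S"
    and L: "distinct L" "set L \<inter> S = {}" "length L + 1 = length xs"
  shows "asep_integrand p t (length xs) xs Y S L \<eta> * (\<Prod>i\<in>S \<union> set L. \<eta> i)
     = pairprod isgn Ms * bterm p xs (\<lambda>i. Y ! (i - 1)) (L @ Ms) \<eta> * exp (etot p (S \<union> set L) \<eta> * of_real t)"
proof -
  define V where "V = S \<union> set L"
  define y where "y = (\<lambda>i. Y ! (i - 1))"
  have Ms: "set Ms = S" "distinct Ms" using S(2) by (auto simp: permutations_of_set_def)
  have m: "length xs - 1 = length L" using L(3) by simp
  have nz: "\<eta> i \<noteq> 0" "1 - \<eta> i \<noteq> 0" for i using good_nonzero[OF p good] by auto
  have dl: "(\<Prod>l\<leftarrow>map f L. g l) = (\<Prod>i\<in>set L. g (f i))" for f :: "nat \<Rightarrow> complex" and g :: "complex \<Rightarrow> complex"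
    using prod.distinct_set_conv_list[OF L(1), of "\<lambda>i. g (f i)"] by (simp add: comp_def)
  have dm: "(\<Prod>l\<leftarrow>map f Ms. g l) = (\<Prod>i\<in>S. g (f i))" for f :: "nat \<Rightarrow> complex" and g :: "complex \<Rightarrow> complex"
    using prod.distinct_set_conv_list[OF Ms(2), of "\<lambda>i. g (f i)"] Ms(1) by (simp add: comp_def)
  define A where "A = (\<Prod>i\<in>set L. \<Prod>j\<in>S. fA p (\<eta> i) (\<eta> j))"
  define B where "B = (\<Prod>a<length xs - 1. \<Prod>b\<in>{a<..<length xs - 1}. fA p (\<eta> (L ! a)) (\<eta> (L ! b)))"
  define Va where "Va = (\<Prod>(i, j)\<in>lt_pairs S. \<eta> j - \<eta> i)"
  define DS where "DS = (\<Prod>j\<in>S. 1 - \<eta> j)"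
  define DL where "DL = (\<Prod>j\<in>set L. 1 - \<eta> j)"
  define O' where "O' = 1 - (\<Prod>j\<in>S. \<eta> j)"
  define E1 where "E1 = (\<Prod>a<length xs - 1. \<eta> (L ! a) powi (xs ! a))"
  define E2 where "E2 = (\<Prod>j\<in>S. \<eta> j powi (xs ! (length xs - 1)))"
  define E3 where "E3 = (\<Prod>i\<in>V. \<eta> i powi (- y i - 1))"
  define E4 where "E4 = (\<Prod>i\<in>V. \<eta> i powi (- y i))"
  define X where "X = exp (etot p V \<eta> * of_real t)"
  have integrand: "asep_integrand p t (length xs) xs Y S L \<eta> = A * B / fprod p V \<eta> * O' * Va / DS * E1 * E2 * E3 * X"
    unfolding asep_integrand_def Let_def A_def B_def fprod_def lt_pairs_def Va_def DS_def O'_def E1_def E2_def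
      E3_def X_def V_def y_def etot_def sum_distrib_right ..
  have E34: "E3 * (\<Prod>i\<in>V. \<eta> i) = E4"
    unfolding E3_def E4_def prod.distrib[symmetric]
  proof (rule prod.cong)
    fix i
    show "\<eta> i powi (- y i - 1) * \<eta> i = \<eta> i powi (- y i)"
      using power_int_add_1[of "\<eta> i" "- y i - 1"] nz(1)[of i] by simp
  qed simp
  have vand: "pairprod isgn Ms * pairprod (\<lambda>a b. b - a) (map \<eta> Ms) = Va"
  proof -
    have "pairprod isgn Ms * pairprod (\<lambda>a b. b - a) (map \<eta> Ms) = pairprod (\<lambda>i j. isgn i j * (\<eta> j - \<eta> i)) Ms"
      by (simp only: pairprod_map pairprod_mult)
    also have "\<dots> = (\<Prod>(i, j)\<in>lt_pairs (set Ms). isgn i j * (\<eta> j - \<eta> i))"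
    proof (rule pairprod_symmetric[OF _ Ms(2)])
      show "isgn b a * (\<eta> a - \<eta> b) = isgn a b * (\<eta> b - \<eta> a)" for a b
        by (subst isgn_anti[of b a]) (simp add: algebra_simps)
    qed
    also have "\<dots> = Va"
      unfolding Va_def Ms by (intro prod.cong) (auto simp: lt_pairs_def isgn_less)
    finally show ?thesis .
  qed
  have "bethe p xs (map \<eta> (L @ Ms)) = DL * E1 * B * A * (O' * pairprod (\<lambda>a b. b - a) (map \<eta> Ms) * E2)"
  proof -
    have "(\<Prod>l\<leftarrow>map \<eta> L. 1 - l) = DL" unfolding dl DL_def ..
    moreover have "(\<Prod>a<length (map \<eta> L). map \<eta> L ! a powi (xs ! a)) = E1"
      unfolding E1_def m by (intro prod.cong) auto
    moreover have "pairprod (fA p) (map \<eta> L) = B"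
      unfolding B_def m pairprod_map by (rule pairprod_eq_double_prod[symmetric])
    moreover have "(\<Prod>l\<leftarrow>map \<eta> L. \<Prod>w\<leftarrow>map \<eta> Ms. fA p l w) = A" unfolding A_def dm dl ..
    moreover have "1 - prod_list (map \<eta> Ms) = O'"
      using dm[of "\<lambda>z. z" \<eta>] by (simp add: O'_def)
    moreover have "last xs = xs ! (length xs - 1)" using L(3) by (intro last_conv_nth) auto
    then have "(\<Prod>w\<leftarrow>map \<eta> Ms. w powi (last xs)) = E2" unfolding dm E2_def by simp
    ultimately show ?thesis
      using bethe_append[of "map \<eta> L" xs p "map \<eta> Ms"] L(3) by (simp only: map_append length_map)
  qed
  moreover have "set (L @ Ms) = V" using Ms by (auto simp: V_def)
  moreover have "denom p V \<eta> = DL * DS * fprod p V \<eta>"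
    unfolding denom_def V_def DL_def DS_def using S(1) L(2)
    by (subst prod.union_disjoint) (auto simp: mult_ac)
  ultimately have bt: "bterm p xs y (L @ Ms) \<eta>
      = DL * E1 * B * A * (O' * pairprod (\<lambda>a b. b - a) (map \<eta> Ms) * E2) * E4 / (DL * DS * fprod p V \<eta>)"
    unfolding bterm_def E4_def by (simp only:)
  have "DL \<noteq> 0" unfolding DL_def using nz by simp
  then have cancel: "DL * E1 * B * A * (O' * v * E2) * E4 / (DL * DS * fprod p V \<eta>)
      = A * B / fprod p V \<eta> * O' * v / DS * E1 * E2 * E4" for v
    by (simp add: divide_simps)
  have "pairprod isgn Ms * bterm p xs y (L @ Ms) \<eta>
      = A * B / fprod p V \<eta> * O' * (pairprod isgn Ms * pairprod (\<lambda>a b. b - a) (map \<eta> Ms)) / DS * E1 * E2 * E4"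
    unfolding bt cancel by (simp add: mult_ac)
  then have "pairprod isgn Ms * bterm p xs y (L @ Ms) \<eta> * X
      = A * B / fprod p V \<eta> * O' * Va / DS * E1 * E2 * (E3 * (\<Prod>i\<in>V. \<eta> i)) * X"
    unfolding vand E34 by (simp only:)
  then show ?thesis
    unfolding V_def[symmetric] y_def[symmetric] X_def[symmetric] integrand by (simp only: mult_ac)
qed

text \<open>\<sigma>(S) is the sum of S, since each s dominates s elements of {1..N}. So the power
  of \<tau> depends only on S \<union> \<Lambda>, and the signs are those of \<Lambda> listed before
  S, up to the order inside S.\<close>

lemma asep_coeff_eq:
  assumes S: "S \<subseteq> {1..N}" and L: "distinct L" "set L \<subseteq> {1..N} - S" "length L + 1 = m"
  shows "complex_of_real (asep_coeff p N m S L) = of_real (kappa p 0 m (S \<union> set L)) * fact (card S)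
      * (pairprod isgn L * (\<Prod>l\<in>set L. \<Prod>s\<in>S. isgn l s))"
proof -
  define k where "k = card S"
  have fin: "finite S" using S finite_subset by blast
  have disj: "S \<inter> set L = {}" using L by auto
  have cL: "card (set L) = m - 1" using L(1,3) by (simp add: distinct_card)
  have cV: "card (S \<union> set L) + 1 - m = k"
    using fin disj cL L(3) by (simp add: card_Un_disjoint k_def)
  have sig: "sigma_pairs S {1..N} = \<Sum>S"
  proof -
    have "{(i, j). i \<in> S \<and> j \<in> {1..N} \<and> j \<le> i} = (SIGMA i:S. {1..i})" using S by auto
    then show ?thesis unfolding sigma_pairs_def using fin by (simp add: card_SigmaI)
  qed
  have tri: "(\<Sum>a<n. int (a + 1)) = int (Suc n * n div 2)" for n
  proof (induction n)
    case (Suc n)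
    then show ?case using triangle_Suc[of "Suc n"] by simp
  qed simp
  have e: "(\<Sum>a<m-1. int (L ! a) - int (a + 1)) + int (sigma_pairs S {1..N}) - int m * int k
      = (\<Sum>i\<in>S \<union> set L. int i - int 0) - int (m * (m - 1) div 2) - int m * int k"
  proof -
    have "(\<Sum>a<m-1. int (L ! a)) = (\<Sum>i\<in>set L. int i)"
      using sum.distinct_set_conv_list[OF L(1), of int] L(3)
      by (simp add: sum.list_conv_set_nth atLeast0LessThan flip: L(3))
    moreover have "(\<Sum>a<m-1. int (a + 1)) = int (m * (m - 1) div 2)"
      using tri[of "m - 1"] L(3) by (cases m) auto
    moreover have "(\<Sum>i\<in>S \<union> set L. int i - int 0) = (\<Sum>i\<in>S. int i) + (\<Sum>i\<in>set L. int i)"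
      using fin disj by (simp add: sum.union_disjoint)
    ultimately show ?thesis unfolding sig by (simp add: sum_subtractf)
  qed
  have "kappa p 0 m (S \<union> set L) * fact k = (p / (1 - p)) powi ((\<Sum>a<m-1. int (L ! a) - int (a + 1))
      + int (sigma_pairs S {1..N}) - int m * int k) * (1 - p) ^ (k * (k - 1) div 2)"
    unfolding kappa_def Let_def cV e by simp
  then have kap: "(p / (1 - p)) powi ((\<Sum>a<m-1. int (L ! a) - int (a + 1))
      + int (sigma_pairs S {1..N}) - int m * int k) * (1 - p) ^ (k * (k - 1) div 2)
      = kappa p 0 m (S \<union> set L) * fact k" ..
  have cs: "(-1) powi (int (sigma_pairs S (set L)) - int (m - 1) * int k) = (\<Prod>l\<in>set L. \<Prod>s\<in>S. isgn l s)"
    using cross_sign[OF fin _ disj] by (simp add: cL k_def)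
  have "asep_coeff p N m S L = (-1) powi (int (sigma_pairs S (set L)) - int (m - 1) * int k) * sgn_list L
      * (kappa p 0 m (S \<union> set L) * fact k)"
    unfolding asep_coeff_def Let_def k_def[symmetric] kap[symmetric] by (simp only: mult.assoc)
  then have "complex_of_real (asep_coeff p N m S L)
      = (-1) powi (int (sigma_pairs S (set L)) - int (m - 1) * int k) * complex_of_real (sgn_list L)
        * (of_real (kappa p 0 m (S \<union> set L)) * fact k)"
    by (simp add: of_real_power_int)
  then show ?thesis unfolding cs sgn_list_eq[OF L(1)] unfolding k_def by (simp only: mult_ac)
qed


text \<open>A list with at least \<open>n\<close> entries splits uniquely after place
  \<open>n\<close> into \<Lambda> and an arrangement of S. Shorter lists occur only on the right,
  where \<open>zero\<close> removes them.\<close>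

lemma sum_split_permutations:
  fixes h :: "nat list \<Rightarrow> complex"
  assumes zero: "\<And>M. length M < n \<Longrightarrow> h M = 0" and fin: "finite I"
  shows "(\<Sum>S\<in>Pow I. \<Sum>L\<in>{L. length L = n \<and> distinct L \<and> set L \<subseteq> I - S}.
            \<Sum>Ms\<in>permutations_of_set S. h (L @ Ms))
       = (\<Sum>V\<in>Pow I. \<Sum>M\<in>permutations_of_set V. h M)"
proof -
  let ?T = "\<lambda>S. {L. length L = n \<and> distinct L \<and> set L \<subseteq> I - S}"
  have finT: "finite (?T S)" for S
    by (rule finite_subset[of _ "{L. set L \<subseteq> I \<and> length L = n}"])
       (auto intro: finite_lists_length_eq[OF fin])
  let ?A = "SIGMA S:Pow I. SIGMA L:?T S. permutations_of_set S"
  let ?B = "SIGMA V:Pow I. permutations_of_set V"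
  have "(\<Sum>S\<in>Pow I. \<Sum>L\<in>?T S. \<Sum>Ms\<in>permutations_of_set S. h (L @ Ms))
      = (\<Sum>x\<in>?A. h (fst (snd x) @ snd (snd x)))"
    using fin finT by (simp add: sum.Sigma split_def)
  also have "\<dots> = (\<Sum>x\<in>{x\<in>?B. n \<le> length (snd x)}. h (snd x))"
  proof (rule sum.reindex_bij_witness[of _
        "\<lambda>x. (set (drop n (snd x)), take n (snd x), drop n (snd x))"
        "\<lambda>x. (fst x \<union> set (fst (snd x)), fst (snd x) @ snd (snd x))"])
    fix x assume "x \<in> ?A"
    then obtain S L Ms where x: "x = (S, L, Ms)" "S \<subseteq> I" "length L = n" "distinct L" "set L \<subseteq> I - S"
        "set Ms = S" "distinct Ms"
      by (auto simp: permutations_of_set_def)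
    then show "(set (drop n (snd (fst x \<union> set (fst (snd x)), fst (snd x) @ snd (snd x)))),
           take n (snd (fst x \<union> set (fst (snd x)), fst (snd x) @ snd (snd x))),
           drop n (snd (fst x \<union> set (fst (snd x)), fst (snd x) @ snd (snd x)))) = x"
      by simp
    show "(fst x \<union> set (fst (snd x)), fst (snd x) @ snd (snd x)) \<in> {x\<in>?B. n \<le> length (snd x)}"
      using x by (auto simp: permutations_of_set_def)
    show "h (snd (fst x \<union> set (fst (snd x)), fst (snd x) @ snd (snd x))) = h (fst (snd x) @ snd (snd x))"
      by simp
  next
    fix x assume "x \<in> {x\<in>?B. n \<le> length (snd x)}"
    then obtain V M where x: "x = (V, M)" "V \<subseteq> I" "set M = V" "distinct M" "n \<le> length M"
      by (auto simp: permutations_of_set_def)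
    have u: "set (take n M) \<union> set (drop n M) = V" using x(3) by (metis append_take_drop_id set_append)
    have d: "set (take n M) \<inter> set (drop n M) = {}"
      using x(4) by (simp add: set_take_disj_set_drop_if_distinct)
    show "(fst (set (drop n (snd x)), take n (snd x), drop n (snd x))
         \<union> set (fst (snd (set (drop n (snd x)), take n (snd x), drop n (snd x)))),
         fst (snd (set (drop n (snd x)), take n (snd x), drop n (snd x)))
         @ snd (snd (set (drop n (snd x)), take n (snd x), drop n (snd x)))) = x"
      using x u by auto
    show "(set (drop n (snd x)), take n (snd x), drop n (snd x)) \<in> ?A"
      using x u d by (auto simp: permutations_of_set_def)
  qed
  also have "\<dots> = (\<Sum>x\<in>?B. h (snd x))"
  proof (rule sum.mono_neutral_left)
    show "\<forall>x\<in>?B - {x\<in>?B. n \<le> length (snd x)}. h (snd x) = 0"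
      using zero by (auto simp: not_le)
  qed (use fin in auto)
  also have "\<dots> = (\<Sum>V\<in>Pow I. \<Sum>M\<in>permutations_of_set V. h M)"
    using fin by (simp add: sum.Sigma split_def)
  finally show ?thesis .
qed

theorem theorem2:
  fixes N m :: nat and p t :: real and Y xs :: "int list"
  assumes "N \<ge> 1" and "0 \<le> p" and "p < 1" and "t \<ge> 0"
    and "length Y = N" and "sorted_wrt (<) Y"
    and "1 \<le> m" and "m \<le> N"
    and "length xs = m" and "sorted_wrt (<) xs"
  shows "\<forall>\<^sub>F R in at_top.
     complex_of_real (asep_prob p t Y (\<lambda>X. take m X = xs)) =
       (\<Sum>S\<in>Pow {1..N}.
          \<Sum>L\<in>{L. length L = m - 1 \<and> distinct L \<and> set L \<subseteq> {1..N} - S}.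
            complex_of_real (asep_coeff p N m S L)
            * (1 / (2 * complex_of_real pi * \<i>)) ^ card (S \<union> set L)
            * iter_cint R (sorted_list_of_set (S \<union> set L)) (asep_integrand p t m xs Y S L))"
  using eventually_gt_at_top[of "4 / (1 - p)"]
proof eventually_elim
  case R: (elim R)
  note p = assms(2,3)
  let ?sc = "scal (\<lambda>_. R)"
  let ?ls = "[1..<Suc N]"
  let ?T = "\<lambda>S. {L. length L = m - 1 \<and> distinct L \<and> set L \<subseteq> {1..N} - S}"
  define y where "y = (\<lambda>i. Y ! (i - 1))"
  have xs: "xs \<noteq> []" using assms by auto
  have good: "good p (?sc \<xi> i)" if "\<xi> \<in> torus" for \<xi> i using good_scal[OF R that p] .
  have R0: "R \<noteq> 0" by (rule R_nonzero[OF p R xs assms(10,1)])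
  have etot_cont: "continuous_on torus (\<lambda>\<xi>. etot p V (?sc \<xi>))" for V
    using R0 by (intro continuous_on_etot)
  \<comment> \<open>The summand as a function of the arrangement alone, \<Lambda> followed by
    S.\<close>
  define h where "h = (\<lambda>M \<eta>. complex_of_real (kappa p 0 m (set M)) * (pairprod isgn M * bterm p xs y M \<eta>)
      * exp (etot p (set M) \<eta> * of_real t))"
  have mean: "(1 / (2 * complex_of_real pi * \<i>)) ^ card (S \<union> set L)
        * iter_cint R (sorted_list_of_set (S \<union> set L)) (asep_integrand p t m xs Y S L)
      = torus_mean ?ls (\<lambda>\<xi>. asep_integrand p t m xs Y S L (?sc \<xi>) * (\<Prod>i\<in>S \<union> set L. ?sc \<xi> i))"
    and cont: "continuous_on torus (\<lambda>\<xi>. asep_integrand p t m xs Y S L (?sc \<xi>) * (\<Prod>i\<in>S \<union> set L. ?sc \<xi> i))"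
    and pointwise: "\<And>\<xi>. \<xi> \<in> torus \<Longrightarrow> complex_of_real (asep_coeff p N m S L)
        * (asep_integrand p t m xs Y S L (?sc \<xi>) * (\<Prod>i\<in>S \<union> set L. ?sc \<xi> i))
      = (\<Sum>Ms\<in>permutations_of_set S. h (L @ Ms) (?sc \<xi>))"
    if S: "S \<in> Pow {1..N}" and L: "L \<in> ?T S" for S L
  proof -
    have fin: "finite S" using S finite_subset by auto
    have L': "distinct L" "set L \<inter> S = {}" "length L + 1 = length xs" "set L \<subseteq> {1..N} - S"
      using L assms by auto
    \<comment> \<open>Any arrangement of S would do: continuity of the integrand is read off from
      \<open>bterm\<close>.\<close>
    define Ms0 where "Ms0 = sorted_list_of_set S"
    have Ms0: "Ms0 \<in> permutations_of_set S" using fin by (auto simp: Ms0_def permutations_of_set_def)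
    have eq: "asep_integrand p t m xs Y S L (?sc \<xi>) * (\<Prod>i\<in>S \<union> set L. ?sc \<xi> i)
       = pairprod isgn Ms * bterm p xs y (L @ Ms) (?sc \<xi>) * exp (etot p (S \<union> set L) (?sc \<xi>) * of_real t)"
      if "\<xi> \<in> torus" "Ms \<in> permutations_of_set S" for \<xi> Ms
      using asep_integrand_eq_bterm[OF p good[OF that(1)] fin that(2) L'(1-3), of t Y]
      unfolding y_def assms(9) .
    have "continuous_on torus (\<lambda>\<xi>. pairprod isgn Ms0 * bterm p xs y (L @ Ms0) (?sc \<xi>)
        * exp (etot p (S \<union> set L) (?sc \<xi>) * of_real t))"
      using p good by (intro continuous_on_mult continuous_on_const continuous_on_exp etot_cont
          continuous_on_bterm continuous_on_scal) auto
    then show c: "continuous_on torus (\<lambda>\<xi>. asep_integrand p t m xs Y S L (?sc \<xi>) * (\<Prod>i\<in>S \<union> set L. ?sc \<xi> i))"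
      by (rule continuous_on_cong[THEN iffD2, rotated 2]) (use eq Ms0 in auto)
    have nz: "(\<Prod>i\<in>S \<union> set L. ?sc \<xi> i) \<noteq> 0" if "\<xi> \<in> torus" for \<xi>
      using good_nonzero(1)[OF p good[OF that]] fin by simp
    have "continuous_on torus (\<lambda>\<xi>. asep_integrand p t m xs Y S L (?sc \<xi>) * (\<Prod>i\<in>S \<union> set L. ?sc \<xi> i)
        / (\<Prod>i\<in>S \<union> set L. ?sc \<xi> i))"
      using nz by (intro continuous_on_divide c continuous_on_prod continuous_on_scal) auto
    then have "continuous_on torus (\<lambda>\<xi>. asep_integrand p t m xs Y S L (?sc \<xi>))"
      by (rule continuous_on_cong[THEN iffD2, rotated 2]) (use nz in auto)
    then show "(1 / (2 * complex_of_real pi * \<i>)) ^ card (S \<union> set L)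
        * iter_cint R (sorted_list_of_set (S \<union> set L)) (asep_integrand p t m xs Y S L)
      = torus_mean ?ls (\<lambda>\<xi>. asep_integrand p t m xs Y S L (?sc \<xi>) * (\<Prod>i\<in>S \<union> set L. ?sc \<xi> i))"
      using S L by (intro iter_cint_eq_torus_mean asep_integrand_cong) auto
    fix \<xi> :: "nat \<Rightarrow> complex" assume \<xi>: "\<xi> \<in> torus"
    let ?I = "asep_integrand p t m xs Y S L (?sc \<xi>) * (\<Prod>i\<in>S \<union> set L. ?sc \<xi> i)"
    have coeff: "complex_of_real (asep_coeff p N m S L) = of_real (kappa p 0 m (S \<union> set L)) * fact (card S)
      * (pairprod isgn L * (\<Prod>l\<in>set L. \<Prod>s\<in>S. isgn l s))"
      by (rule asep_coeff_eq) (use S L L' assms in auto)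
    have h: "h (L @ Ms) (?sc \<xi>) = of_real (kappa p 0 m (S \<union> set L))
      * (pairprod isgn L * (\<Prod>l\<in>set L. \<Prod>s\<in>S. isgn l s)) * ?I" if Ms: "Ms \<in> permutations_of_set S" for Ms
    proof -
      have M: "set Ms = S" "distinct Ms" using Ms by (auto simp: permutations_of_set_def)
      have "set (L @ Ms) = S \<union> set L" using M by auto
      moreover have "(\<Prod>l\<leftarrow>L. \<Prod>s\<leftarrow>Ms. isgn l s) = (\<Prod>l\<in>set L. \<Prod>s\<in>S. isgn l s)"
        using prod.distinct_set_conv_list[OF L'(1), of "\<lambda>l. \<Prod>s\<in>S. isgn l s"]
          prod.distinct_set_conv_list[OF M(2), of "isgn _"] M(1) by simp
      ultimately show ?thesis
        unfolding h_def eq[OF \<xi> Ms] by (simp only: pairprod_append mult_ac)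
    qed
    \<comment> \<open>All arrangements of S give the same value; their number is the factorial by
      which \<open>kappa\<close> divides.\<close>
    have "(\<Sum>Ms\<in>permutations_of_set S. h (L @ Ms) (?sc \<xi>)) = fact (card S) * (of_real (kappa p 0 m (S \<union> set L))
      * (pairprod isgn L * (\<Prod>l\<in>set L. \<Prod>s\<in>S. isgn l s)) * ?I)"
      using fin by (simp add: h)
    then show "complex_of_real (asep_coeff p N m S L) * ?I = (\<Sum>Ms\<in>permutations_of_set S. h (L @ Ms) (?sc \<xi>))"
      unfolding coeff by (simp only: mult_ac)
  qed
  have "(\<Sum>S\<in>Pow {1..N}. \<Sum>L\<in>?T S. complex_of_real (asep_coeff p N m S L)
            * (1 / (2 * complex_of_real pi * \<i>)) ^ card (S \<union> set L)
            * iter_cint R (sorted_list_of_set (S \<union> set L)) (asep_integrand p t m xs Y S L))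
     = (\<Sum>S\<in>Pow {1..N}. \<Sum>L\<in>?T S. torus_mean ?ls (\<lambda>\<xi>. complex_of_real (asep_coeff p N m S L)
          * (asep_integrand p t m xs Y S L (?sc \<xi>) * (\<Prod>i\<in>S \<union> set L. ?sc \<xi> i))))"
    by (intro sum.cong refl) (simp only: torus_mean_cmult mean[symmetric] mult.assoc)
  also have "\<dots> = (\<Sum>S\<in>Pow {1..N}. torus_mean ?ls (\<lambda>\<xi>. \<Sum>L\<in>?T S. complex_of_real (asep_coeff p N m S L)
          * (asep_integrand p t m xs Y S L (?sc \<xi>) * (\<Prod>i\<in>S \<union> set L. ?sc \<xi> i))))"
    by (intro sum.cong refl torus_mean_sum[symmetric] continuous_on_mult[OF continuous_on_const] cont)
  also have "\<dots> = torus_mean ?ls (\<lambda>\<xi>. \<Sum>S\<in>Pow {1..N}. \<Sum>L\<in>?T S. complex_of_real (asep_coeff p N m S L)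
          * (asep_integrand p t m xs Y S L (?sc \<xi>) * (\<Prod>i\<in>S \<union> set L. ?sc \<xi> i)))"
    by (intro torus_mean_sum[symmetric] continuous_on_sum continuous_on_mult[OF continuous_on_const] cont)
  also have "\<dots> = torus_mean ?ls (\<lambda>\<xi>. \<Sum>V\<in>Pow {1..N}. \<Sum>M\<in>permutations_of_set V. h M (?sc \<xi>))"
  proof (rule torus_mean_cong)
    fix \<xi> :: "nat \<Rightarrow> complex" assume \<xi>: "\<xi> \<in> torus"
    have "(\<Sum>S\<in>Pow {1..N}. \<Sum>L\<in>?T S. complex_of_real (asep_coeff p N m S L)
          * (asep_integrand p t m xs Y S L (?sc \<xi>) * (\<Prod>i\<in>S \<union> set L. ?sc \<xi> i)))
        = (\<Sum>S\<in>Pow {1..N}. \<Sum>L\<in>?T S. \<Sum>Ms\<in>permutations_of_set S. h (L @ Ms) (?sc \<xi>))"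
      by (intro sum.cong refl pointwise \<xi>)
    also have "\<dots> = (\<Sum>V\<in>Pow {1..N}. \<Sum>M\<in>permutations_of_set V. h M (?sc \<xi>))"
      by (rule sum_split_permutations[of "m - 1" "\<lambda>M. h M (?sc \<xi>)"])
         (use assms in \<open>auto simp: h_def bterm_def bethe_short\<close>)
    finally show "(\<Sum>S\<in>Pow {1..N}. \<Sum>L\<in>?T S. complex_of_real (asep_coeff p N m S L)
          * (asep_integrand p t m xs Y S L (?sc \<xi>) * (\<Prod>i\<in>S \<union> set L. ?sc \<xi> i)))
        = (\<Sum>V\<in>Pow {1..N}. \<Sum>M\<in>permutations_of_set V. h M (?sc \<xi>))" .
  qed
  also have "\<dots> = phi p R N xs (\<lambda>V \<eta>. exp (etot p V \<eta> * of_real t)) y"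
    unfolding phi_def bsum_eq_sum_bterm sum_distrib_left sum_distrib_right
    by (intro torus_mean_cong sum.cong refl)
       (auto simp: h_def assms(9) permutations_of_set_def mult_ac)
  also have "\<dots> = complex_of_real (asep_prob p t Y (\<lambda>X. take m X = xs))"
    using asep_prob_eq_phi[OF p R xs assms(10,1,6,5), of t] assms(8,9) by (simp add: y_def)
  finally show ?case by (rule sym)
qed


end
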